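(* Let $d\ge 2$ and $n\ge 1$ be integers, let $G=G(d,1,n)$, let $c$ be a fixed Coxeter element of $G$, and let $k\ge 1$. For nonnegative integers $r_1,\dots,r_k$ let $a^{(d)}_{r_1,\ldots,r_k}$ be the number of $k$-tuples $(u_1,\dots,u_k)\in G^k$ with $u_1\cdots u_k=c$ and $\dim\operatorname{fix}(u_i)=r_i$ for $i=1,\dots,k$. Then \[ \sum_{r_1,\ldots,r_k\ge 0} a^{(d)}_{r_1,\ldots,r_k}\, x_1^{r_1}\cdots x_k^{r_k} \;=\; |G|^{k-1}\sum_{p_1,\ldots,p_k\ge 0} M^n_{p_1,\ldots,p_k}\,\frac{(x_1-1)^{(d)}_{p_1}}{d^{p_1}p_1!}\cdots\frac{(x_k-1)^{(d)}_{p_k}}{d^{p_k}p_k!}. \]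
   Context: $G(d,1,n)$ is the group of $n\times n$ complex matrices having exactly one nonzero entry in each row and each column, every nonzero entry being a $d$-th root of unity; it is a complex reflection group acting on $\mathbb{C}^n$, and $|G(d,1,n)|=d^n n!$. For $w\in G$, $\operatorname{fix}(w)=\{v\in\mathbb{C}^n: wv=v\}$. An element $w$ of a complex reflection group is regular if it has an eigenvector not lying in the fixed hyperplane of any reflection of the group; if the corresponding eigenvalue is a primitive $m$-th root of unity, $m$ is called a regular integer. The Coxeter number $h$ is the largest regular integer, and a Coxeter element is a regular element of order $h$ (for example, in $G(d,1,n)$ the generalized permutation matrix of the cycle $1\to2\to\cdots\to n\to1$ with one entry replaced by $e^{2\pi i/d}$). For integers $k$, $(x-1)^{(d)}_k:=(x-1)(x-1-d)(x-1-2d)\cdots(x-1-(k-1)d)$ (equal to $1$ for $k=0$). For nonnegative $n$ and integers $p_1,\dots,p_k$, $M^n_{p_1,\ldots,p_k}:=[x_1^{p_1}\cdots x_k^{p_k}]\big((1+x_1)\cdots(1+x_k)-x_1\cdots x_k\big)^n$ (zero if some $p_i<0$); equivalently $M^n_{p_1,\ldots,p_k}=\sum_{t\ge0}(-1)^t\binom{n}{t}\prod_{i=1}^k\binom{n-t}{p_i-t}$. *)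

theory Defs
  imports
    "HOL-Analysis.Analysis"
    "HOL-Algebra.Multiplicative_Group"
    "HOL-Library.Poly_Mapping"
begin

text \<open>Groups of complex $n \times n$ matrices are records over \<open>complex^'n^'n\<close>, where
  $n$ is \<open>CARD('n)\<close>.\<close>

type_synonym 'n cmat_group = "(complex^'n^'n) monoid"

definition Gd1n :: "nat \<Rightarrow> 'n::finite cmat_group" where
  "Gd1n d = \<lparr>carrier = {A. (\<forall>i. \<exists>!j. A $ i $ j \<noteq> 0) \<and> (\<forall>j. \<exists>!i. A $ i $ j \<noteq> 0) \<and>
                        (\<forall>i j. A $ i $ j \<noteq> 0 \<longrightarrow> (A $ i $ j) ^ d = 1)},
             monoid.mult = (**), one = mat 1\<rparr>"

definition fix_space :: "complex^'n^'n \<Rightarrow> (complex^'n) set" where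
  "fix_space w = {v. w *v v = v}"

definition reflections :: "'n::finite cmat_group \<Rightarrow> (complex^'n^'n) set" where
  "reflections G = {t \<in> carrier G. vec.dim (fix_space t) + 1 = CARD('n)}"

definition regular_eigenpair ::
    "'n::finite cmat_group \<Rightarrow> complex^'n^'n \<Rightarrow> complex \<Rightarrow> complex^'n \<Rightarrow> bool" where
  "regular_eigenpair G w l v \<longleftrightarrow>
     v \<noteq> 0 \<and> w *v v = l *s v \<and> (\<forall>t \<in> reflections G. v \<notin> fix_space t)"

definition regular_element :: "'n::finite cmat_group \<Rightarrow> complex^'n^'n \<Rightarrow> bool" where
  "regular_element G w \<longleftrightarrow> w \<in> carrier G \<and> (\<exists>l v. regular_eigenpair G w l v)"

definition primitive_root_of_unity :: "nat \<Rightarrow> complex \<Rightarrow> bool" where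
  "primitive_root_of_unity m z \<longleftrightarrow> m > 0 \<and> z ^ m = 1 \<and> (\<forall>j. 0 < j \<and> j < m \<longrightarrow> z ^ j \<noteq> 1)"

definition regular_integer :: "'n::finite cmat_group \<Rightarrow> nat \<Rightarrow> bool" where
  "regular_integer G m \<longleftrightarrow>
     (\<exists>w \<in> carrier G. \<exists>l v. regular_eigenpair G w l v \<and> primitive_root_of_unity m l)"

definition coxeter_number :: "'n::finite cmat_group \<Rightarrow> nat" where
  "coxeter_number G = (GREATEST m. regular_integer G m)"

definition coxeter_element :: "'n::finite cmat_group \<Rightarrow> complex^'n^'n \<Rightarrow> bool" where
  "coxeter_element G c \<longleftrightarrow> regular_element G c \<and> group.ord G c = coxeter_number G"

text \<open>Tuples $(u_1, \ldots, u_k)$ and $(r_1, \ldots, r_k)$ are lists of length $k$, so position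
  $i$ of a list holds the entry with index $i + 1$.\<close>

definition factorization_count ::
    "'n::finite cmat_group \<Rightarrow> complex^'n^'n \<Rightarrow> nat list \<Rightarrow> nat" where
  "factorization_count G c r =
     card {u. length u = length r \<and> set u \<subseteq> carrier G \<and>
              foldr (monoid.mult G) u (one G) = c \<and>
              (\<forall>i < length r. vec.dim (fix_space (u ! i)) = r ! i)}"

text \<open>Polynomials in the indeterminates $X_0, X_1, \ldots$ over \<open>'a\<close>: finitely supported maps
  from exponent vectors to coefficients, with convolution as multiplication.\<close>

type_synonym 'a multipoly = "(nat \<Rightarrow>\<^sub>0 nat) \<Rightarrow>\<^sub>0 'a"

definition X :: "nat \<Rightarrow> 'a::zero_neq_one multipoly" where
  "X i = Poly_Mapping.single (Poly_Mapping.single i 1) 1"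

definition Cst :: "'a::zero \<Rightarrow> 'a multipoly" where
  "Cst a = Poly_Mapping.single 0 a"

definition M_coeff :: "nat \<Rightarrow> nat list \<Rightarrow> int" where
  "M_coeff n p =
     Poly_Mapping.lookup
       (((\<Prod>i<length p. 1 + X i) - (\<Prod>i<length p. X i)) ^ n)
       (Poly_Mapping.nth p)"

definition falling :: "nat \<Rightarrow> nat \<Rightarrow> 'a::comm_ring_1 \<Rightarrow> 'a" where
  "falling d p x = (\<Prod>j<p. x - 1 - of_nat (j * d))"

text \<open>A sum over an infinite set is $0$ by convention, so sums over all tuples are taken over
  the tuples with nonzero coefficient; these are finitely many.\<close>

lemma finite_factorization_count_support:
  fixes G :: "'n::finite cmat_group"
  shows "finite {r. length r = k \<and> factorization_count G c r \<noteq> 0}"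
proof (rule finite_subset)
  show "finite {r. set r \<subseteq> {..CARD('n)} \<and> length r = k}"
    by (rule finite_lists_length_eq) simp
  show "{r. length r = k \<and> factorization_count G c r \<noteq> 0}
          \<subseteq> {r. set r \<subseteq> {..CARD('n)} \<and> length r = k}"
  proof (intro subsetI CollectI conjI)
    fix r x
    assume r: "r \<in> {r. length r = k \<and> factorization_count G c r \<noteq> 0}"
    then show "length r = k" by simp
    assume "x \<in> set r"
    then obtain i where i: "i < length r" "x = r ! i"
      by (auto simp: in_set_conv_nth)
    from r have "factorization_count G c r \<noteq> 0" by simp
    then obtain u where "\<forall>i < length r. vec.dim (fix_space (u ! i) :: (complex^'n) set) = r ! i"
      unfolding factorization_count_def by (metis (mono_tags, lifting) card_eq_0_iff empty_Collect_eq)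
    with i have "x = vec.dim (fix_space (u ! i) :: (complex^'n) set)" by simp
    then show "x \<in> {..CARD('n)}"
      by (simp add: dim_subset_UNIV_cart_gen)
  qed
qed

lemma finite_M_coeff_support: "finite {p. length p = k \<and> M_coeff n p \<noteq> 0}"
proof (rule finite_subset)
  let ?P = "((\<Prod>i<k. 1 + X i) - (\<Prod>i<k. X i)) ^ n :: int multipoly"
  show "finite ((\<lambda>m. map (Poly_Mapping.lookup m) [0..<k]) ` Poly_Mapping.keys ?P)"
    by simp
  show "{p. length p = k \<and> M_coeff n p \<noteq> 0}
          \<subseteq> (\<lambda>m. map (Poly_Mapping.lookup m) [0..<k]) ` Poly_Mapping.keys ?P"
  proof clarify
    fix p :: "nat list"
    assume "M_coeff n p \<noteq> 0" and k: "k = length p"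
    then have "Poly_Mapping.nth p
        \<in> Poly_Mapping.keys (((\<Prod>i<length p. 1 + X i) - (\<Prod>i<length p. X i)) ^ n :: int multipoly)"
      by (simp add: M_coeff_def in_keys_iff)
    moreover have "p = map (Poly_Mapping.lookup (Poly_Mapping.nth p)) [0..<length p]"
      by (auto intro!: nth_equalityI simp: nth_default_nth)
    ultimately show "p \<in> (\<lambda>m. map (Poly_Mapping.lookup m) [0..<length p]) `
        Poly_Mapping.keys (((\<Prod>i<length p. 1 + X i) - (\<Prod>i<length p. X i)) ^ n :: int multipoly)"
      by blast
  qed
qed

end

theory Submission
  imports Defs
begin

text \<open>
  At \<open>x = 1 + d j\<close> the weight \<open>x ^ dim fix u\<close> counts the \<open>u\<close>-fixed vectors all of whose entries
  lie in a set of \<open>1 + d j\<close> complex numbers that contains \<open>0\<close> and is stable under \<open>d\<close>-th roots of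
  unity. Summing over the nonzero entries of \<open>u\<close> turns the weighted factorizations in \<open>G(d,1,n)\<close>
  into the difference of two such sums over \<open>S\<^sub>n\<close>, in which a permutation is weighted by the number
  of colorings that it fixes, with \<open>j + 1\<close> and with \<open>j\<close> colors: a coloring with a zero entry
  makes the product of the nonzero entries equidistributed, and one without zero entries forces it
  to be \<open>1\<close>, which is excluded for a Coxeter element.

  In \<open>S\<^sub>n\<close>, the indicator of the \<open>n\<close>-cycles is an alternating combination of Young symmetrizers of
  hook shape. They are eigenfunctions of convolution with every class function, so the sum over
  \<open>k\<close>-fold products factors into \<open>k\<close> eigenvalues. This gives the generating function at all points
  \<open>x\<^sub>i = 1 + d j\<^sub>i\<close>, and Newton interpolation there yields the coefficients \<open>M\<close>.
\<close>

section \<open>Newton interpolation and the coefficients \<open>M\<close>\<close>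

text \<open>Why hooks: by the Murnaghan-Nakayama rule only hook-shaped irreducible characters are
  nonzero on an \<open>n\<close>-cycle, and the symmetrizers isolate these pieces without any
  representation theory. For the number of invariant colorings with \<open>y\<close> colors, a hook
  of leg length \<open>l\<close> has eigenvalue \<open>n! * (y + n - 1 - l choose n)\<close>, the
  product of \<open>y + c\<close> over its contents \<open>c\<close>. Passing from
  \<open>y = j + 1\<close> to \<open>y = j\<close> amounts to replacing \<open>l\<close> by
  \<open>l + 1\<close>, so Pascal's rule turns the difference of the two sums into an alternating
  sum, with coefficients \<open>n choose t\<close>, of products of
  \<open>j_i + n - t choose n\<close>. The \<open>p_i\<close>-th difference of such a binomial at 0
  is \<open>n - t choose n - p_i\<close>, and what remains is the explicit sum for \<open>M\<close>.
  One obstacle shapes the descent to permutations: the indicator of a single \<open>c\<close> is not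
  a function of the permutation and of the product of the nonzero entries, whereas the indicator of
  its conjugacy class is. The class is therefore treated as a whole, and its size, instead of being
  computed, is read off from a case in which the count is trivial.\<close>

lemma prod_sum_lists:
  fixes f :: "nat \<Rightarrow> 'b \<Rightarrow> 'c::comm_ring_1"
  assumes "finite B"
  shows "(\<Prod>i<k. \<Sum>j\<in>B. f i j) = (\<Sum>p | set p \<subseteq> B \<and> length p = k. \<Prod>i<k. f i (p ! i))"
proof (induction k)
  case 0
  have "{p. set p \<subseteq> B \<and> p = []} = {[]}" by auto
  then show ?case by simp
next
  case (Suc k)
  have bij: "bij_betw (\<lambda>(p, b). p @ [b]) ({p. set p \<subseteq> B \<and> length p = k} \<times> B)
      {p. set p \<subseteq> B \<and> length p = Suc k}"
  proof (rule bij_betwI[where g = "\<lambda>p. (butlast p, last p)"])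
    show "(\<lambda>p. (butlast p, last p)) \<in> {p. set p \<subseteq> B \<and> length p = Suc k} \<rightarrow>
        {p. set p \<subseteq> B \<and> length p = k} \<times> B"
      by (auto dest: in_set_butlastD simp: subset_iff)
         (metis last_in_set length_0_conv nat.distinct(1))
  qed (auto simp: length_Suc_conv_rev)
  have "(\<Prod>i<Suc k. \<Sum>j\<in>B. f i j) =
      (\<Sum>p | set p \<subseteq> B \<and> length p = k. \<Prod>i<k. f i (p ! i)) * (\<Sum>j\<in>B. f k j)"
    using Suc.IH by simp
  also have "\<dots> = (\<Sum>(p, b) \<in> {p. set p \<subseteq> B \<and> length p = k} \<times> B. (\<Prod>i<k. f i (p ! i)) * f k b)"
    by (simp add: sum_product sum.cartesian_product)
  also have "\<dots> = (\<Sum>(p, b) \<in> {p. set p \<subseteq> B \<and> length p = k} \<times> B.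
      \<Prod>i<Suc k. f i ((p @ [b]) ! i))"
    by (intro sum.cong refl) (auto simp: nth_append)
  also have "\<dots> = (\<Sum>p | set p \<subseteq> B \<and> length p = Suc k. \<Prod>i<Suc k. f i (p ! i))"
    using sum.reindex_bij_betw[OF bij, of "\<lambda>p. \<Prod>i<Suc k. f i (p ! i)"]
    by (simp add: case_prod_unfold)
  finally show ?case .
qed

text \<open>The \<open>p\<close>-th forward difference of \<open>g\<close> at 0.\<close>

definition newton_coeff :: "nat \<Rightarrow> (nat \<Rightarrow> rat) \<Rightarrow> rat" where
  "newton_coeff p g = (\<Sum>j\<le>p. (-1) ^ (p + j) * of_nat (p choose j) * g j)"

text \<open>Binomials beyond \<open>p\<close> vanish. A range that does not depend on
  \<open>p\<close> lets products of differences expand over one common box of tuples.\<close>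

lemma newton_coeff_eq_sum:
  assumes "p \<le> n"
  shows "newton_coeff p g = (\<Sum>j\<le>n. (-1) ^ (p + j) * of_nat (p choose j) * g j)"
  unfolding newton_coeff_def
  by (rule sum.mono_neutral_left) (use assms in auto)

lemma newton_coeff_Suc:
  "newton_coeff (Suc p) g = newton_coeff p (\<lambda>j. g (Suc j)) - newton_coeff p g"
proof -
  have "newton_coeff (Suc p) g = (-1) ^ Suc p * g 0 +
      (\<Sum>j\<le>p. (-1) ^ (p + j) * of_nat (Suc p choose Suc j) * g (Suc j))"
    unfolding newton_coeff_def by (subst sum.atMost_Suc_shift) simp
  also have "\<dots> = newton_coeff p (\<lambda>j. g (Suc j)) +
      ((-1) ^ Suc p * g 0 + (\<Sum>j\<le>p. (-1) ^ (p + j) * of_nat (p choose Suc j) * g (Suc j)))"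
    by (simp add: newton_coeff_def algebra_simps sum.distrib)
  also have "(-1) ^ Suc p * g 0 + (\<Sum>j\<le>p. (-1) ^ (p + j) * of_nat (p choose Suc j) * g (Suc j))
      = - (\<Sum>j\<le>Suc p. (-1) ^ (p + j) * of_nat (p choose j) * g j)"
    by (subst sum.atMost_Suc_shift) (simp add: sum_negf)
  also have "(\<Sum>j\<le>Suc p. (-1) ^ (p + j) * of_nat (p choose j) * g j) = newton_coeff p g"
    by (rule newton_coeff_eq_sum[symmetric]) simp
  finally show ?thesis by simp
qed

text \<open>By Pascal's rule each difference lowers the bottom index by one. The offset
  \<open>b\<close> is general because \<open>newton_coeff_Suc\<close> shifts the argument; with
  \<open>b = n - t\<close> the right side is the binomial that occurs in
  \<open>M_coeff_eq\<close>.\<close>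

lemma newton_coeff_binomial:
  "p \<le> n \<Longrightarrow> newton_coeff p (\<lambda>j. of_nat ((j + b) choose n)) = of_nat (b choose (n - p))"
proof (induction p arbitrary: b)
  case 0
  then show ?case by (simp add: newton_coeff_def)
next
  case (Suc p)
  have "n - p = Suc (n - Suc p)" using Suc.prems by simp
  then have "Suc b choose (n - p) = (b choose (n - p)) + (b choose (n - Suc p))" by simp
  moreover have "newton_coeff p (\<lambda>j. of_nat ((Suc j + b) choose n)) = of_nat (Suc b choose (n - p))"
    using Suc.IH[of "Suc b"] Suc.prems by simp
  ultimately show ?case
    using Suc.IH[of b] Suc.prems by (simp add: newton_coeff_Suc)
qed

text \<open>The Leibniz rule for differences: the factor is affine, so only its value at
  \<open>p\<close> and its slope \<open>d\<close> enter. At \<open>p = 0\<close> the truncated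
  \<open>p - 1\<close> is harmless, its coefficient being 0.\<close>

lemma newton_coeff_affine_mult:
  "newton_coeff p (\<lambda>j. (1 + of_nat (d * j)) * g j) =
     (1 + of_nat (d * p)) * newton_coeff p g + of_nat (d * p) * newton_coeff (p - 1) g"
proof (cases p)
  case 0
  then show ?thesis by (simp add: newton_coeff_def)
next
  case (Suc q)
  then have q: "q \<le> p" by simp
  have summand: "(-1) ^ (p + j) * of_nat (p choose j) * ((1 + of_nat (d * j)) * g j) =
      (1 + of_nat (d * p)) * ((-1) ^ (p + j) * of_nat (p choose j) * g j)
      + of_nat (d * p) * ((-1) ^ (q + j) * of_nat (q choose j) * g j)" if "j \<le> p" for j
  proof -
    have "(p - j) * (p choose j) = p * (q choose j)"
      using binomial_absorb_comp[of p j] Suc by simp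
    then have *: "(of_nat p - of_nat j) * (of_nat (p choose j) :: rat) = of_nat p * of_nat (q choose j)"
      using that by (metis of_nat_diff of_nat_mult)
    have "(-1) ^ (p + j) * of_nat (p choose j) * ((1 + of_nat (d * j)) * g j) =
      (1 + of_nat (d * p)) * ((-1) ^ (p + j) * of_nat (p choose j) * g j)
      - of_nat d * (-1) ^ (p + j) * g j * ((of_nat p - of_nat j) * of_nat (p choose j))"
      by (simp add: algebra_simps)
    also have "\<dots> = (1 + of_nat (d * p)) * ((-1) ^ (p + j) * of_nat (p choose j) * g j)
      + of_nat (d * p) * ((-1) ^ (q + j) * of_nat (q choose j) * g j)"
      unfolding * by (simp add: Suc algebra_simps)
    finally show ?thesis .
  qed
  have "newton_coeff p (\<lambda>j. (1 + of_nat (d * j)) * g j) =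
      (\<Sum>j\<le>p. (1 + of_nat (d * p)) * ((-1) ^ (p + j) * of_nat (p choose j) * g j)
      + of_nat (d * p) * ((-1) ^ (q + j) * of_nat (q choose j) * g j))"
    unfolding newton_coeff_def by (rule sum.cong) (use summand in auto)
  also have "\<dots> = (1 + of_nat (d * p)) * newton_coeff p g + of_nat (d * p) * newton_coeff q g"
    unfolding newton_coeff_eq_sum[of q p g, OF q] newton_coeff_def[of p] sum.distrib sum_distrib_left
    by (rule refl)
  finally show ?thesis using Suc by simp
qed

lemma newton_coeff_affine_power_eq_0:
  "r < p \<Longrightarrow> newton_coeff p (\<lambda>j. (1 + of_nat (d * j)) ^ r) = 0"
proof (induction r arbitrary: p)
  case 0
  then obtain q where "p = Suc q" by (cases p) auto
  then show ?case by (simp add: newton_coeff_Suc)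
next
  case (Suc r)
  have "newton_coeff p (\<lambda>j. (1 + of_nat (d * j)) ^ r) = 0"
    "newton_coeff (p - 1) (\<lambda>j. (1 + of_nat (d * j)) ^ r) = 0"
    using Suc by auto
  then show ?case
    using newton_coeff_affine_mult[of p d "\<lambda>j. (1 + of_nat (d * j)) ^ r"] by simp
qed

section \<open>Newton interpolation in the polynomial ring\<close>

lemma Cst_add: "Cst (a + b) = Cst a + Cst b"
  by (simp add: Cst_def single_add)

lemma Cst_mult: "Cst (a * b) = Cst a * Cst b"
  for a b :: "'a::comm_semiring_1"
  by (simp add: Cst_def mult_single)

lemma Cst_of_nat: "of_nat m = Cst (of_nat m)"
  by (simp add: Cst_def)

lemma Cst_of_int: "of_int m = Cst (of_int m)"
  by (simp add: Cst_def)

lemma Cst_0 [simp]: "Cst 0 = 0" and Cst_1 [simp]: "Cst 1 = 1"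
  by (simp_all add: Cst_def)

lemma Cst_sum: "Cst (sum f A) = (\<Sum>a\<in>A. Cst (f a))"
  by (induction A rule: infinite_finite_induct) (simp_all add: Cst_add)

lemma Cst_prod: "Cst (prod f A) = (\<Prod>a\<in>A. Cst (f a))"
  for f :: "_ \<Rightarrow> 'a::comm_semiring_1"
  by (induction A rule: infinite_finite_induct) (simp_all add: Cst_mult)

text \<open>Newton's basis polynomials for the nodes \<open>1 + d * j\<close>; the constant makes
  the value at such a node equal to \<open>j choose p\<close>.\<close>

definition newton_basis :: "nat \<Rightarrow> nat \<Rightarrow> rat multipoly \<Rightarrow> rat multipoly" where
  "newton_basis d p x = Cst (1 / (of_nat d ^ p * fact p)) * falling d p x"

text \<open>Mirrors \<open>newton_coeff_affine_mult\<close>: multiplication by \<open>x\<close>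
  raises the index of the basis just as the affine factor draws on the difference with the next
  lower index. The two together drive the induction on the exponent in
  \<open>power_eq_newton_sum\<close>.\<close>

lemma mult_newton_basis:
  assumes "d > 0"
  shows "x * newton_basis d p x =
    Cst (1 + of_nat (d * p)) * newton_basis d p x + Cst (of_nat (d * Suc p)) * newton_basis d (Suc p) x"
proof -
  have eq: "of_nat (d * Suc p) * (1 / (of_nat d ^ Suc p * fact (Suc p))) = (1 / (of_nat d ^ p * fact p) :: rat)"
    using assms by (simp add: divide_simps del: of_nat_Suc) (simp add: algebra_simps)
  have "Cst (of_nat (d * Suc p)) * newton_basis d (Suc p) x =
      Cst (1 / (of_nat d ^ p * fact p)) * (falling d p x * (x - 1 - of_nat (p * d)))"
    unfolding newton_basis_def mult.assoc[symmetric] Cst_mult[symmetric] eq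
    by (simp add: falling_def mult.assoc)
  also have "\<dots> = (x - Cst (1 + of_nat (d * p))) * newton_basis d p x"
    by (simp add: newton_basis_def Cst_add Cst_of_nat[symmetric] algebra_simps del: of_nat_mult)
  finally show ?thesis by (simp add: algebra_simps)
qed

lemma power_eq_newton_sum:
  assumes d: "d > 0" and "r \<le> m"
  shows "x ^ r = (\<Sum>p\<le>m. Cst (newton_coeff p (\<lambda>j. (1 + of_nat (d * j)) ^ r)) * newton_basis d p x)"
  using \<open>r \<le> m\<close>
proof (induction r)
  case 0
  have "newton_coeff p (\<lambda>j. (1 + of_nat (d * j)) ^ 0) = of_bool (p = 0)" for p
    by (cases p) (simp_all add: newton_coeff_Suc, simp add: newton_coeff_def)
  then have "(\<Sum>p\<le>m. Cst (newton_coeff p (\<lambda>j. (1 + of_nat (d * j)) ^ 0)) * newton_basis d p x) =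
      (\<Sum>p\<le>m. if p = 0 then newton_basis d p x else 0)"
    by (intro sum.cong) simp_all
  also have "\<dots> = 1" by (simp add: newton_basis_def falling_def)
  finally show ?case by simp
next
  case (Suc r)
  define c where "c p = newton_coeff p (\<lambda>j. (1 + of_nat (d * j)) ^ r)" for p
  define B where "B p = newton_basis d p x" for p
  obtain l where m: "m = Suc l" using Suc.prems by (cases m) auto
  \<comment> \<open>The degree \<open>r\<close> is below \<open>m\<close>, so the top difference
    vanishes and the shift from \<open>p\<close> to \<open>p + 1\<close> does not leave the range
    \<open>{..m}\<close>.\<close>
  have cm: "c m = 0"
    unfolding c_def using Suc.prems by (intro newton_coeff_affine_power_eq_0) simp
  have rec: "newton_coeff p (\<lambda>j. (1 + of_nat (d * j)) ^ Suc r) =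
      (1 + of_nat (d * p)) * c p + of_nat (d * p) * c (p - 1)" for p
    using newton_coeff_affine_mult[of p d "\<lambda>j. (1 + of_nat (d * j)) ^ r"] by (simp add: c_def)
  have "x ^ Suc r = (\<Sum>p\<le>m. Cst (c p) * (x * B p))"
    using Suc by (simp add: c_def B_def sum_distrib_left algebra_simps)
  also have "\<dots> = (\<Sum>p\<le>m. Cst ((1 + of_nat (d * p)) * c p) * B p) +
      (\<Sum>p\<le>m. Cst (of_nat (d * Suc p) * c p) * B (Suc p))"
    unfolding B_def mult_newton_basis[OF d] Cst_mult distrib_left sum.distrib
    by (simp only: mult_ac)
  also have "(\<Sum>p\<le>m. Cst (of_nat (d * Suc p) * c p) * B (Suc p)) =
      (\<Sum>p\<le>l. Cst (of_nat (d * Suc p) * c p) * B (Suc p))"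
    using cm by (simp add: m)
  also have "\<dots> = (\<Sum>p\<le>m. Cst (of_nat (d * p) * c (p - 1)) * B p)"
    unfolding m by (subst sum.atMost_Suc_shift) simp
  finally show ?case
    unfolding rec B_def[symmetric] by (simp only: Cst_add distrib_right sum.distrib)
qed

text \<open>Equal lengths matter: \<open>Poly_Mapping.nth\<close> pads with zeros and would identify
  lists that differ only by trailing zeros.\<close>

lemma lookup_monomial:
  assumes "length p = k" "length q = k"
  shows "Poly_Mapping.lookup (\<Prod>i<k. X i ^ (p ! i) :: 'a::comm_ring_1 multipoly) (Poly_Mapping.nth q) =
     of_bool (p = q)"
proof -
  have pw: "(X i ^ e :: 'a multipoly) = Poly_Mapping.single (Poly_Mapping.single i e) 1" for i e
    by (induction e) (simp_all add: X_def mult_single single_add[symmetric])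
  have "(\<Prod>i<m. X i ^ (p ! i) :: 'a multipoly) =
      Poly_Mapping.single (\<Sum>i<m. Poly_Mapping.single i (p ! i)) 1" for m
    by (induction m) (simp_all add: pw mult_single)
  moreover have "(\<Sum>i<k. Poly_Mapping.single i (p ! i)) = Poly_Mapping.nth q \<longleftrightarrow> p = q"
  proof -
    have "(\<Sum>i<k. Poly_Mapping.single i (p ! i)) = Poly_Mapping.nth p"
      by (rule poly_mapping_eqI)
         (auto simp: lookup_sum lookup_single when_def nth_default_def assms)
    moreover have "Poly_Mapping.nth p = Poly_Mapping.nth q \<longleftrightarrow> p = q"
    proof
      assume eq: "Poly_Mapping.nth p = Poly_Mapping.nth q"
      show "p = q"
      proof (rule nth_equalityI)
        fix i assume "i < length p"
        then show "p ! i = q ! i"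
          using arg_cong[OF eq, of "\<lambda>m. Poly_Mapping.lookup m i"] assms
          by (simp add: nth_default_def)
      qed (use assms in simp)
    qed simp
    ultimately show ?thesis by simp
  qed
  ultimately show ?thesis by (simp add: lookup_single when_def)
qed

lemma lookup_Cst_mult:
  "Poly_Mapping.lookup (Cst a * f) m = a * Poly_Mapping.lookup f m"
  for a :: "'a::comm_semiring_1"
  by (simp add: Cst_def map.rep_eq when_def flip: mult_map_scale_conv_mult)

text \<open>Expand the power by the binomial theorem and read off each variable separately. The
  binomial \<open>n - t choose p_i - t\<close> is written as \<open>n - t choose n - p_i\<close>,
  which is correctly 0 for \<open>p_i < t\<close> in spite of truncated subtraction. For
  \<open>p_i > n\<close> truncation would give 1 instead of 0, whence the case distinction.\<close>

lemma M_coeff_eq: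
  assumes len: "length p = k"
  shows "M_coeff n p = (if set p \<subseteq> {..n} then
    (\<Sum>t\<le>n. (-1) ^ t * int (n choose t) * (\<Prod>i<k. int ((n - t) choose (n - p ! i)))) else 0)"
proof -
  let ?L = "{q. set q \<subseteq> {..n} \<and> length q = k}"
  have fin: "finite ?L" by (rule finite_lists_length_eq) simp
  have pw: "(1 + x) ^ (n - t) * x ^ t = (\<Sum>j\<le>n. of_nat ((n - t) choose (n - j)) * x ^ j)"
    if "t \<le> n" for t and x :: "int multipoly"
  proof -
    have "(1 + x) ^ (n - t) * x ^ t = (\<Sum>j\<le>n - t. of_nat ((n - t) choose j) * x ^ (j + t))"
      using binomial_ring[of x 1 "n - t"]
      by (simp add: add.commute sum_distrib_right power_add mult.assoc)
    also have "\<dots> = (\<Sum>j\<in>{t..n}. of_nat ((n - t) choose (n - j)) * x ^ j)"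
    proof (rule sum.reindex_bij_witness[where i = "\<lambda>j. j - t" and j = "\<lambda>j. j + t"])
      fix j assume "j \<in> {..n - t}"
      then have "(n - t) choose (n - (j + t)) = (n - t) choose j"
        using binomial_symmetric[of j "n - t"] that by (simp add: add.commute)
      then show "of_nat ((n - t) choose (n - (j + t))) * x ^ (j + t) =
          of_nat ((n - t) choose j) * x ^ (j + t)" by simp
    qed (use that in auto)
    \<comment> \<open>For \<open>j < t\<close> the binomial is 0 because
      \<open>n - j > n - t\<close>; the range no longer depends on \<open>t\<close>.\<close>
    also have "\<dots> = (\<Sum>j\<le>n. of_nat ((n - t) choose (n - j)) * x ^ j)"
      by (rule sum.mono_neutral_left) (use that in auto)
    finally show ?thesis .
  qed
  have "((\<Prod>i<k. 1 + X i) - (\<Prod>i<k. X i)) ^ n =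
      (\<Sum>t\<le>n. of_nat (n choose t) * (- (\<Prod>i<k. X i)) ^ t * (\<Prod>i<k. 1 + X i) ^ (n - t) :: int multipoly)"
    using binomial_ring[of "- (\<Prod>i<k. X i)" "\<Prod>i<k. 1 + X i" n] by simp
  also have "\<dots> = (\<Sum>t\<le>n. Cst ((-1) ^ t * int (n choose t)) * (\<Prod>i<k. (1 + X i) ^ (n - t) * X i ^ t))"
  proof (intro sum.cong refl)
    fix t
    have "Cst ((-1) ^ t * int (n choose t)) = (-1) ^ t * of_nat (n choose t)"
      using Cst_of_int[of "(-1) ^ t * int (n choose t)", where 'a = int] by simp
    then show "of_nat (n choose t) * (- (\<Prod>i<k. X i)) ^ t * (\<Prod>i<k. 1 + X i) ^ (n - t) =
        Cst ((-1) ^ t * int (n choose t)) * (\<Prod>i<k. (1 + X i) ^ (n - t) * X i ^ t)"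
      by (simp add: power_minus[of "\<Prod>i<k. X i"] prod.distrib prod_power_distrib mult_ac)
  qed
  also have "\<dots> = (\<Sum>t\<le>n. Cst ((-1) ^ t * int (n choose t)) *
      (\<Sum>q\<in>?L. Cst (\<Prod>i<k. int ((n - t) choose (n - q ! i))) * (\<Prod>i<k. X i ^ (q ! i))))"
    by (intro sum.cong refl) (simp add: pw prod_sum_lists prod.distrib Cst_prod Cst_of_nat)
  also have "\<dots> = (\<Sum>t\<le>n. \<Sum>q\<in>?L. Cst ((-1) ^ t * int (n choose t) *
      (\<Prod>i<k. int ((n - t) choose (n - q ! i)))) * (\<Prod>i<k. X i ^ (q ! i)))"
    by (simp add: sum_distrib_left Cst_mult mult.assoc)
  finally have "M_coeff n p = (\<Sum>t\<le>n. \<Sum>q\<in>?L. ((-1) ^ t * int (n choose t) *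
      (\<Prod>i<k. int ((n - t) choose (n - q ! i)))) * of_bool (q = p))"
    using lookup_monomial[OF _ len, where 'a = int]
    by (simp add: M_coeff_def len lookup_sum lookup_Cst_mult)
  also have "\<dots> = (\<Sum>t\<le>n. \<Sum>q\<in>?L. if q = p then ((-1) ^ t * int (n choose t) *
      (\<Prod>i<k. int ((n - t) choose (n - p ! i)))) else 0)"
    by (intro sum.cong refl) auto
  also have "\<dots> = (if set p \<subseteq> {..n} then
    (\<Sum>t\<le>n. (-1) ^ t * int (n choose t) * (\<Prod>i<k. int ((n - t) choose (n - p ! i)))) else 0)"
    using fin len by (simp add: sum.delta)
  finally show ?thesis .
qed

section \<open>Hook-shaped Young symmetrizers\<close>

text \<open>The sum of \<open>w j\<^sub>1 u\<^sub>1 * \<dots> * w j\<^sub>k u\<^sub>k * F (u\<^sub>1 \<dots> u\<^sub>k)\<close> over all words of length \<open>k\<close> in \<open>A\<close>. The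
  recursion is arranged so that eigenvalues of the one-letter operators can be split off.\<close>

fun word_sum :: "'a set \<Rightarrow> ('a \<Rightarrow> 'a \<Rightarrow> 'a) \<Rightarrow> 'a \<Rightarrow> ('b \<Rightarrow> 'a \<Rightarrow> rat) \<Rightarrow> 'b list \<Rightarrow> ('a \<Rightarrow> rat) \<Rightarrow> rat"
where
  "word_sum A m e w [] F = F e"
| "word_sum A m e w (j # js) F = (\<Sum>u\<in>A. w j u * word_sum A m e w js (\<lambda>g. F (m u g)))"

lemma word_sum_cong:
  assumes "e \<in> A" and "\<And>a b. a \<in> A \<Longrightarrow> b \<in> A \<Longrightarrow> m a b \<in> A"
    and "\<And>g. g \<in> A \<Longrightarrow> F g = F' g"
  shows "word_sum A m e w js F = word_sum A m e w js F'"
  using assms(3)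
proof (induction js arbitrary: F F')
  case Nil
  then show ?case using assms(1) by simp
next
  case (Cons j js)
  have "word_sum A m e w js (\<lambda>g. F (m u g)) = word_sum A m e w js (\<lambda>g. F' (m u g))" if "u \<in> A" for u
    using that assms(2) by (intro Cons.IH Cons.prems) auto
  then show ?case by simp
qed

lemma word_sum_linear:
  "word_sum A m e w js (\<lambda>g. \<Sum>i\<in>I. c i * F i g) = (\<Sum>i\<in>I. c i * word_sum A m e w js (F i))"
proof (induction js arbitrary: F)
  case (Cons j js)
  then show ?case
    by (simp add: sum_distrib_left sum.swap[of _ I] mult.left_commute)
qed simp

lemma word_sum_scale:
  "word_sum A m e w js (\<lambda>g. c * F g) = c * word_sum A m e w js F"
  using word_sum_linear[of A m e w js "\<lambda>_. c" "\<lambda>_. F" "{()}"] by simp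

text \<open>By linearity the sum over the first letter can be moved inside, where it acts on
  \<open>F\<close> as an operator on functions; there it is multiplication by the
  eigenvalue.\<close>

lemma word_sum_eigenfunction:
  assumes "e \<in> A" and "\<And>a b. a \<in> A \<Longrightarrow> b \<in> A \<Longrightarrow> m a b \<in> A"
    and eig: "\<And>j h. h \<in> A \<Longrightarrow> (\<Sum>u\<in>A. w j u * F (m u h)) = ev j * F h"
  shows "word_sum A m e w js F = (\<Prod>j\<leftarrow>js. ev j) * F e"
proof (induction js)
  case (Cons j js)
  have "word_sum A m e w (j # js) F = word_sum A m e w js (\<lambda>g. \<Sum>u\<in>A. w j u * F (m u g))"
    by (simp add: word_sum_linear)
  also have "\<dots> = word_sum A m e w js (\<lambda>g. ev j * F g)"
    by (rule word_sum_cong) (use assms in auto)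
  finally show ?case using Cons.IH by (simp add: word_sum_scale)
qed simp

text \<open>For a permutation \<open>\<tau>\<close> this is \<open>y\<close> to the number of cycles
  of \<open>\<tau>\<close>. Counting colorings instead of cycles allows the sums over permutations
  and over colorings to be exchanged.\<close>

definition invariant_colorings :: "nat \<Rightarrow> ('n \<Rightarrow> 'n) \<Rightarrow> nat" where
  "invariant_colorings y \<tau> = card {f. (\<forall>x. f x < y) \<and> f \<circ> \<tau> = f}"

text \<open>Composition with \<open>a\<close> carries the colorings fixed by
  \<open>a \<circ> b\<close> to those fixed by \<open>b \<circ> a\<close>, and composition with
  \<open>b\<close> carries them back. This is the form of conjugation invariance that
  \<open>hook_kernel_eigenfunction\<close> asks of a weight.\<close>

lemma invariant_colorings_commute:
  assumes "a permutes UNIV" "b permutes UNIV"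
  shows "invariant_colorings y (a \<circ> b) = invariant_colorings y (b \<circ> a)"
  unfolding invariant_colorings_def
proof (rule bij_betw_same_card, rule bij_betwI[where f = "\<lambda>f. f \<circ> a" and g = "\<lambda>f. f \<circ> b"])
  show "(\<lambda>f. f \<circ> a) \<in> {f. (\<forall>x. f x < y) \<and> f \<circ> (a \<circ> b) = f} \<rightarrow> {f. (\<forall>x. f x < y) \<and> f \<circ> (b \<circ> a) = f}"
    by (auto simp: fun_eq_iff)
  show "(\<lambda>f. f \<circ> b) \<in> {f. (\<forall>x. f x < y) \<and> f \<circ> (b \<circ> a) = f} \<rightarrow> {f. (\<forall>x. f x < y) \<and> f \<circ> (a \<circ> b) = f}"
    by (auto simp: fun_eq_iff)
qed (auto simp: fun_eq_iff)

text \<open>The name \<open>inv\<close> is taken by the group inverse.\<close>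

abbreviation perm_inv :: "('n \<Rightarrow> 'n) \<Rightarrow> 'n \<Rightarrow> 'n" where
  "perm_inv p \<equiv> inv_into UNIV p"

text \<open>The Young symmetrizer of a hook whose column is \<open>insert r S\<close> and whose row is \<open>- S\<close>, as a
  function on permutations.\<close>

definition hook_kernel :: "'n::finite \<Rightarrow> 'n set \<Rightarrow> ('n \<Rightarrow> 'n) \<Rightarrow> rat" where
  "hook_kernel r S h =
     (\<Sum>p | p permutes insert r S. \<Sum>q | q permutes - S. if h = p \<circ> q then of_int (sign p) else 0)"

lemma permutes_UNIV: "p permutes S \<Longrightarrow> p permutes UNIV"
  by (rule permutes_subset) auto

lemma permutes_finite_UNIV_iff:
  fixes p :: "'n::finite \<Rightarrow> 'n"
  shows "p permutes S \<longleftrightarrow> p permutes UNIV \<and> (\<forall>x. x \<notin> S \<longrightarrow> p x = x)"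
  by (metis Diff_iff UNIV_I permutes_UNIV permutes_not_in permutes_superset)

lemma sign_compose_permutes:
  fixes p q :: "'n::finite \<Rightarrow> 'n"
  assumes "p permutes S" "q permutes T"
  shows "sign (p \<circ> q) = sign p * sign q"
  using permutes_imp_permutation[OF finite assms(1)] permutes_imp_permutation[OF finite assms(2)]
  by (rule sign_compose)

text \<open>The row factor is forced to be \<open>perm_inv p \<circ> \<sigma>\<close>, and this
  permutes only the row exactly when \<open>p\<close> agrees with \<open>\<sigma>\<close> on
  \<open>S\<close>. In this form the kernel can be compared with a term of a determinant.\<close>

lemma hook_kernel_eq:
  fixes \<sigma> :: "'n::finite \<Rightarrow> 'n"
  assumes "r \<notin> S" and \<sigma>: "\<sigma> permutes UNIV"
  shows "hook_kernel r S \<sigma> =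
    (\<Sum>p | p permutes insert r S. if \<forall>x\<in>S. p x = \<sigma> x then of_int (sign p) else 0)"
  unfolding hook_kernel_def
proof (intro sum.cong refl)
  fix p assume "p \<in> {p. p permutes insert r S}"
  then have p: "p permutes UNIV" by (auto intro: permutes_UNIV)
  have eq: "\<sigma> = p \<circ> q \<longleftrightarrow> q = perm_inv p \<circ> \<sigma>" for q
    using permutes_inv_o[OF p] by (metis comp_assoc id_comp)
  have "(\<Sum>q | q permutes - S. if \<sigma> = p \<circ> q then of_int (sign p) else 0) =
      (if perm_inv p \<circ> \<sigma> permutes - S then rat_of_int (sign p) else 0)"
    unfolding eq by (simp add: finite_permutations)
  also have "perm_inv p \<circ> \<sigma> permutes - S \<longleftrightarrow> (\<forall>x\<in>S. p x = \<sigma> x)"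
    using permutes_compose[OF \<sigma> permutes_inv[OF p]] permutes_inv_eq[OF p]
    by (subst permutes_finite_UNIV_iff) auto
  finally show "(\<Sum>q | q permutes - S. if \<sigma> = p \<circ> q then of_int (sign p) else 0) =
      (if \<forall>x\<in>S. p x = \<sigma> x then rat_of_int (sign p) else 0)" .
qed

text \<open>Once the values on \<open>S\<close> are known, only one point of
  \<open>insert r S\<close> is left as the image of \<open>r\<close>.\<close>

lemma hook_factorization_unique:
  fixes p :: "'n::finite \<Rightarrow> 'n"
  assumes r: "r \<notin> S" and p: "p permutes insert r S" "p' permutes insert r S"
    and eq: "\<forall>x\<in>S. p x = p' x"
  shows "p = p'"
proof
  fix x
  have inj: "inj p" "inj p'" using p by (auto intro: permutes_inj)
  have "p r = p' r"
  proof -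
    have "p ` insert r S = insert r S" "p' ` insert r S = insert r S"
      using p by (simp_all only: permutes_image)
    moreover have "p ` S = p' ` S" using eq by auto
    moreover have "p r \<notin> p ` S" "p' r \<notin> p' ` S"
      using r by (simp_all add: inj_image_mem_iff[OF inj(1)] inj_image_mem_iff[OF inj(2)])
    ultimately show ?thesis by (metis image_insert insert_ident insertE insertI1)
  qed
  then show "p x = p' x"
    using eq p by (cases "x \<in> insert r S") (auto simp: permutes_def)
qed

lemma hook_kernel_factorization:
  fixes p0 :: "'n::finite \<Rightarrow> 'n"
  assumes r: "r \<notin> S" and p0: "p0 permutes insert r S" and q0: "q0 permutes - S"
  shows "hook_kernel r S (p0 \<circ> q0) = of_int (sign p0)"
proof -
  have perm: "p0 \<circ> q0 permutes UNIV"
    using p0 q0 by (intro permutes_compose) (auto intro: permutes_UNIV)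
  have q0S: "q0 x = x" if "x \<in> S" for x using q0 that by (simp add: permutes_not_in)
  have "hook_kernel r S (p0 \<circ> q0) =
      (\<Sum>p | p permutes insert r S. if p = p0 then of_int (sign p) else 0)"
    unfolding hook_kernel_eq[OF r perm]
    using hook_factorization_unique[OF r _ p0] by (intro sum.cong refl) (auto simp: q0S)
  then show ?thesis using p0 by (simp add: finite_permutations)
qed

text \<open>The combinatorial lemma behind Young symmetrizers, for hooks: if no two entries of the
  column \<open>insert r S\<close> have their preimages in the row \<open>- S\<close>, then
  \<open>h\<close> splits into a column and a row permutation. The assumption forces
  \<open>h\<close> to map \<open>S\<close> into the column, by counting.\<close>

lemma hook_factorization_exists:
  fixes h :: "'n::finite \<Rightarrow> 'n"
  assumes r: "r \<notin> S" and h: "h permutes UNIV"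
    and uniq: "\<And>i j. i \<in> insert r S \<Longrightarrow> j \<in> insert r S \<Longrightarrow> perm_inv h i \<notin> S \<Longrightarrow> perm_inv h j \<notin> S \<Longrightarrow> i = j"
  obtains p q where "p permutes insert r S" "q permutes - S" "h = p \<circ> q"
proof -
  have inj: "inj h" using h by (rule permutes_inj)
  have hinv: "h (perm_inv h x) = x" "perm_inv h (h x) = x" for x
    using h by (auto simp: permutes_inverses)
  have cardS: "card (h ` S) = card S" using inj by (simp add: card_image inj_on_subset)
  define U where "U = {i \<in> insert r S. perm_inv h i \<notin> S}"
  have split: "insert r S = U \<union> (h ` S \<inter> insert r S)"
  proof (intro equalityI subsetI)
    fix x assume "x \<in> insert r S"
    moreover have "x \<in> h ` S" if "perm_inv h x \<in> S"
      using imageI[OF that, of h] by (simp add: hinv)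
    ultimately show "x \<in> U \<union> (h ` S \<inter> insert r S)" unfolding U_def by blast
  qed (auto simp: U_def)
  have "card U \<le> 1"
    using uniq unfolding U_def by (simp add: card_le_Suc0_iff_eq)
  moreover have "card (insert r S) = Suc (card S)" using r by simp
  moreover have "card (insert r S) \<le> card U + card (h ` S \<inter> insert r S)"
    by (subst split) (rule card_Un_le)
  ultimately have "card (h ` S) \<le> card (h ` S \<inter> insert r S)" using cardS by simp
  then have hS: "h ` S \<subseteq> insert r S"
    by (metis Int_lower1 Int_lower2 card_subset_eq card_mono finite order_antisym)
  \<comment> \<open>The column has one point more than the image of \<open>S\<close>; this spare
    point becomes the image of \<open>r\<close> under \<open>p\<close>.\<close>
  then obtain i0 where i0: "i0 \<in> insert r S" "i0 \<notin> h ` S"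
    using cardS \<open>card (insert r S) = Suc (card S)\<close> by (metis n_not_Suc_n subsetI subset_antisym)
  define p where "p x = (if x \<in> S then h x else if x = r then i0 else x)" for x
  have p: "p permutes insert r S"
  proof (rule inj_imp_permutes)
    show "inj_on p (insert r S)"
    proof (rule inj_onI)
      fix x y assume "x \<in> insert r S" "y \<in> insert r S" "p x = p y"
      then show "x = y"
        using i0(2) by (cases "x \<in> S"; cases "y \<in> S") (auto simp: p_def inj_eq[OF inj])
    qed
  qed (use hS i0 in \<open>auto simp: p_def\<close>)
  have "perm_inv p \<circ> h permutes UNIV"
    using p h by (intro permutes_compose permutes_inv) (auto intro: permutes_UNIV)
  moreover have "perm_inv p (h x) = x" if "x \<in> S" for x
    using that permutes_inv_eq[OF p] by (simp add: p_def)
  ultimately have "perm_inv p \<circ> h permutes - S"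
    by (subst permutes_finite_UNIV_iff) auto
  moreover have "h = p \<circ> (perm_inv p \<circ> h)"
    using permutes_inv_o[OF p] by (simp add: o_assoc)
  ultimately show ?thesis using p that by blast
qed

lemma sum_permutations_translate:
  fixes f :: "('a \<Rightarrow> 'a) \<Rightarrow> ('a \<Rightarrow> 'a) \<Rightarrow> 'b::comm_monoid_add"
  assumes "t permutes A" "s permutes B"
  shows "(\<Sum>p | p permutes A. \<Sum>q | q permutes B. f p q) =
    (\<Sum>p | p permutes A. \<Sum>q | q permutes B. f (t \<circ> p) (q \<circ> s))"
  using setum_permutations_compose_left[OF assms(1), of "\<lambda>p. \<Sum>q | q permutes B. f p q"]
    sum_permutations_compose_right[OF assms(2), of "f (t \<circ> p)" for p] by simp

text \<open>Substituting \<open>u = p \<circ> q \<circ> perm_inv h\<close> turns the left side into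
  a signed sum over column and row permutations. If two column entries have their preimages under
  \<open>h\<close> in the row, both sides vanish; otherwise \<open>h\<close> factors as
  \<open>p0 \<circ> q0\<close>, and translating by the factors produces the kernel value
  \<open>sign p0\<close>.\<close>

lemma hook_kernel_eigenfunction:
  fixes h :: "'n::finite \<Rightarrow> 'n" and w :: "('n \<Rightarrow> 'n) \<Rightarrow> rat"
  assumes r: "r \<notin> S" and h: "h permutes UNIV"
    and comm: "\<And>a b. a permutes UNIV \<Longrightarrow> b permutes UNIV \<Longrightarrow> w (a \<circ> b) = w (b \<circ> a)"
  shows "(\<Sum>u | u permutes UNIV. w u * hook_kernel r S (u \<circ> h)) =
    (\<Sum>p | p permutes insert r S. \<Sum>q | q permutes - S. of_int (sign p) * w (p \<circ> q)) * hook_kernel r S h"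
    (is "?L = ?e * _")
proof -
  have hinv: "h \<circ> perm_inv h = id" "perm_inv h \<circ> h = id" using permutes_inv_o[OF h] by auto
  have "?L = (\<Sum>p | p permutes insert r S. \<Sum>q | q permutes - S. \<Sum>u | u permutes UNIV.
      if u = p \<circ> q \<circ> perm_inv h then of_int (sign p) * w u else 0)"
  proof -
    have *: "u \<circ> h = p \<circ> q \<longleftrightarrow> u = p \<circ> q \<circ> perm_inv h" for u p q
      by (metis comp_assoc comp_id hinv)
    have "?L = (\<Sum>u | u permutes UNIV. \<Sum>p | p permutes insert r S. \<Sum>q | q permutes - S.
        if u = p \<circ> q \<circ> perm_inv h then of_int (sign p) * w u else 0)"
      unfolding hook_kernel_def sum_distrib_left *
      by (intro sum.cong refl) auto
    also have "\<dots> = (\<Sum>p | p permutes insert r S. \<Sum>u | u permutes UNIV. \<Sum>q | q permutes - S.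
        if u = p \<circ> q \<circ> perm_inv h then of_int (sign p) * w u else 0)"
      by (rule sum.swap)
    also have "\<dots> = (\<Sum>p | p permutes insert r S. \<Sum>q | q permutes - S. \<Sum>u | u permutes UNIV.
        if u = p \<circ> q \<circ> perm_inv h then of_int (sign p) * w u else 0)"
      by (rule sum.cong[OF refl], rule sum.swap)
    finally show ?thesis .
  qed
  also have "\<dots> = (\<Sum>p | p permutes insert r S. \<Sum>q | q permutes - S. of_int (sign p) * w (p \<circ> q \<circ> perm_inv h))"
  proof (intro sum.cong refl)
    fix p q assume "p \<in> {p. p permutes insert r S}" "q \<in> {q. q permutes - S}"
    then have "p \<circ> q \<circ> perm_inv h permutes UNIV"
      using h by (auto intro!: permutes_compose permutes_inv intro: permutes_UNIV)
    then show "(\<Sum>u | u permutes UNIV. if u = p \<circ> q \<circ> perm_inv h then of_int (sign p) * w u else 0) =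
        of_int (sign p) * w (p \<circ> q \<circ> perm_inv h)"
      by (simp add: finite_permutations)
  qed
  finally have L: "?L = (\<Sum>p | p permutes insert r S. \<Sum>q | q permutes - S.
      of_int (sign p) * w (p \<circ> q \<circ> perm_inv h))" .
  show ?thesis
  proof (cases "\<exists>i j. i \<in> insert r S \<and> j \<in> insert r S \<and> perm_inv h i \<notin> S \<and> perm_inv h j \<notin> S \<and> i \<noteq> j")
    case True
    then obtain i j where ij: "i \<in> insert r S" "j \<in> insert r S" "perm_inv h i \<notin> S" "perm_inv h j \<notin> S" "i \<noteq> j"
      by blast
    txt \<open>The substitution \<open>p \<mapsto> t \<circ> p\<close>, \<open>q \<mapsto> q \<circ> s\<close> preserves \<open>w\<close> and reverses the sign.\<close>
    define t where "t = Transposition.transpose i j"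
    define s where "s = Transposition.transpose (perm_inv h i) (perm_inv h j)"
    have t: "t permutes insert r S" unfolding t_def using ij by (intro permutes_swap_id) auto
    have s: "s permutes - S" unfolding s_def using ij by (intro permutes_swap_id) auto
    have st: "s \<circ> (perm_inv h \<circ> t) = perm_inv h"
      by (rule ext) (auto simp: s_def t_def Transposition.transpose_def inj_eq[OF permutes_inj[OF permutes_inv[OF h]]])
    have "?L = (\<Sum>p | p permutes insert r S. \<Sum>q | q permutes - S.
        of_int (sign (t \<circ> p)) * w (t \<circ> p \<circ> (q \<circ> s) \<circ> perm_inv h))"
      unfolding L
      by (rule sum_permutations_translate[OF t s])
    also have "\<dots> = (\<Sum>p | p permutes insert r S. \<Sum>q | q permutes - S.
        - (of_int (sign p) * w (p \<circ> q \<circ> perm_inv h)))"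
    proof (intro sum.cong refl)
      fix p q assume "p \<in> {p. p permutes insert r S}" "q \<in> {q. q permutes - S}"
      then have pq: "p permutes insert r S" "q permutes - S" by auto
      have "sign (t \<circ> p) = - sign p"
        using sign_compose_permutes[OF t pq(1)] ij by (simp add: t_def sign_swap_id)
      moreover have "p \<circ> (q \<circ> s) \<circ> perm_inv h permutes UNIV"
        using pq s h by (intro permutes_compose permutes_inv) (auto intro: permutes_UNIV)
      then have "w (t \<circ> (p \<circ> (q \<circ> s) \<circ> perm_inv h)) = w (p \<circ> (q \<circ> s) \<circ> perm_inv h \<circ> t)"
        using t by (intro comm) (auto intro: permutes_UNIV)
      then have "w (t \<circ> p \<circ> (q \<circ> s) \<circ> perm_inv h) = w (p \<circ> q \<circ> (s \<circ> (perm_inv h \<circ> t)))"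
        by (simp only: comp_assoc)
      ultimately show "of_int (sign (t \<circ> p)) * w (t \<circ> p \<circ> (q \<circ> s) \<circ> perm_inv h) =
          - (of_int (sign p) * w (p \<circ> q \<circ> perm_inv h))"
        unfolding st by simp
    qed
    also have "\<dots> = - ?L" unfolding L by (simp add: sum_negf)
    finally have "?L = 0" by simp
    moreover have "hook_kernel r S h = 0"
    proof -
      have False if pq: "p permutes insert r S" "q permutes - S" "h = p \<circ> q" for p q
      proof -
        \<comment> \<open>A factorization would map \<open>S\<close> into the column while missing
          both \<open>i\<close> and \<open>j\<close>, which leaves only \<open>card S - 1\<close>
          places.\<close>
        have hS: "h ` S \<subseteq> insert r S"
          using permutes_in_image[OF pq(1)] permutes_not_in[OF pq(2)] by (auto simp: pq(3))
        have "h ` S \<subseteq> insert r S - {i, j}"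
          using hS ij(3,4) permutes_inverses(2)[OF h] by auto
        then have "card (h ` S) \<le> card (insert r S - {i, j})" by (intro card_mono) auto
        also have "\<dots> < card S"
        proof -
          have sub: "{i, j} \<subseteq> insert r S" using ij by simp
          then have "card {i, j} \<le> card (insert r S)" by (intro card_mono) auto
          then show ?thesis using ij(5) r sub by (simp add: card_Diff_subset)
        qed
        also have "card S = card (h ` S)"
          using permutes_inj[OF h] by (simp add: card_image inj_on_subset)
        finally show False by simp
      qed
      then have "(if h = p \<circ> q then rat_of_int (sign p) else 0) = 0"
        if "p permutes insert r S" "q permutes - S" for p q
        using that by auto
      then show ?thesis unfolding hook_kernel_def by simp
    qed
    ultimately show ?thesis by simp
  next
    case False
    then obtain p0 q0 where p0: "p0 permutes insert r S" and q0: "q0 permutes - S" and hpq: "h = p0 \<circ> q0"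
      using hook_factorization_exists[OF r h] by metis
    have p0U: "perm_inv p0 permutes UNIV" and q0U: "perm_inv q0 permutes UNIV"
      using p0 q0 by (auto intro: permutes_UNIV permutes_inv)
    have invh: "perm_inv h = perm_inv q0 \<circ> perm_inv p0"
      unfolding hpq using p0 q0 by (intro o_inv_distrib permutes_bij)
    \<comment> \<open>Because \<open>w (a \<circ> b) = w (b \<circ> a)\<close>, the factor
      \<open>perm_inv p0\<close> can travel from the left end to the right end, where it completes
      \<open>perm_inv q0\<close> to \<open>perm_inv h\<close>.\<close>
    have "?e = (\<Sum>p | p permutes insert r S. \<Sum>q | q permutes - S.
        of_int (sign (perm_inv p0 \<circ> p)) * w (perm_inv p0 \<circ> p \<circ> (q \<circ> perm_inv q0)))"
      by (rule sum_permutations_translate[OF permutes_inv[OF p0] permutes_inv[OF q0]])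
    also have "\<dots> = (\<Sum>p | p permutes insert r S. \<Sum>q | q permutes - S.
        of_int (sign p0) * (of_int (sign p) * w (p \<circ> q \<circ> perm_inv h)))"
    proof (intro sum.cong refl)
      fix p q assume "p \<in> {p. p permutes insert r S}" "q \<in> {q. q permutes - S}"
      then have pq: "p permutes insert r S" "q permutes - S" by auto
      have "sign (perm_inv p0 \<circ> p) = sign p0 * sign p"
        using sign_compose_permutes[OF permutes_inv[OF p0] pq(1)]
          sign_inverse[OF permutes_imp_permutation[OF _ p0]] by simp
      moreover have "p \<circ> (q \<circ> perm_inv q0) permutes UNIV"
        using pq q0U by (intro permutes_compose) (auto intro: permutes_UNIV)
      then have "w (perm_inv p0 \<circ> (p \<circ> (q \<circ> perm_inv q0))) = w (p \<circ> (q \<circ> perm_inv q0) \<circ> perm_inv p0)"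
        by (intro comm p0U)
      then have "w (perm_inv p0 \<circ> p \<circ> (q \<circ> perm_inv q0)) = w (p \<circ> q \<circ> perm_inv h)"
        by (simp only: comp_assoc invh)
      ultimately show "of_int (sign (perm_inv p0 \<circ> p)) * w (perm_inv p0 \<circ> p \<circ> (q \<circ> perm_inv q0)) =
          of_int (sign p0) * (of_int (sign p) * w (p \<circ> q \<circ> perm_inv h))" by simp
    qed
    also have "\<dots> = of_int (sign p0) * ?L" unfolding L by (simp add: sum_distrib_left)
    finally have e: "?e = of_int (sign p0) * ?L" .
    have "rat_of_int (sign p0) * of_int (sign p0) = 1"
      by (simp flip: of_int_mult)
    moreover have "?e * of_int (sign p0) = (of_int (sign p0) * of_int (sign p0)) * ?L"
      unfolding e by (simp only: mult_ac)
    moreover have "hook_kernel r S h = of_int (sign p0)"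
      unfolding hpq by (rule hook_kernel_factorization[OF r p0 q0])
    ultimately show ?thesis by simp
  qed
qed

section \<open>Hook eigenvalues of the coloring counts\<close>

lemma invariant_colorings_hook:
  fixes p q :: "'n::finite \<Rightarrow> 'n"
  assumes r: "r \<notin> S" and p: "p permutes insert r S" and q: "q permutes - S"
  shows "f \<circ> (p \<circ> q) = f \<longleftrightarrow> f \<circ> p = f \<and> f \<circ> q = (f :: 'n \<Rightarrow> nat)"
proof
  assume "f \<circ> (p \<circ> q) = f"
  then have f: "f (p (q x)) = f x" for x by (metis comp_apply)
  have pS: "f (p x) = f x" if "x \<in> S" for x
    using f[of x] that permutes_not_in[OF q] by simp
  \<comment> \<open>Invariance under \<open>p\<close> is known on \<open>S\<close>, where
    \<open>q\<close> is trivial. As \<open>p\<close> permutes the column, comparing the sums of the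
    colors settles the one remaining point \<open>r\<close>.\<close>
  have "(\<Sum>x\<in>insert r S. f (p x)) = (\<Sum>x\<in>insert r S. f x)"
    using sum.permute[OF p, of f] by (simp add: o_def)
  then have "f (p r) = f r" using r pS by simp
  then have fp: "f (p x) = f x" for x
    using pS permutes_not_in[OF p] by (cases "x \<in> insert r S") auto
  moreover have "f (q x) = f x" for x using f[of x] fp[of "q x"] by simp
  ultimately show "f \<circ> p = f \<and> f \<circ> q = f" by auto
qed (auto simp: fun_eq_iff)

text \<open>The transposition of two points of \<open>A\<close> with the same color pairs terms of
  opposite sign; an injective coloring is fixed by the identity only.\<close>

lemma sum_sign_invariant:
  fixes f :: "'n::finite \<Rightarrow> nat"
  shows "(\<Sum>p | p permutes A. of_bool (f \<circ> p = f) * of_int (sign p)) = (of_bool (inj_on f A) :: rat)"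
proof (cases "inj_on f A")
  case True
  have "p = id" if p: "p permutes A" and "f \<circ> p = f" for p
  proof
    fix x
    have "f (p x) = f x" using that by (metis comp_apply)
    then show "p x = id x"
      using True p by (cases "x \<in> A") (auto simp: permutes_in_image permutes_not_in dest: inj_onD)
  qed
  then have "(\<Sum>p | p permutes A. of_bool (f \<circ> p = f) * of_int (sign p)) =
      (\<Sum>p | p permutes A. if p = id then 1 else 0 :: rat)"
    by (intro sum.cong refl) auto
  then show ?thesis using True by (simp add: finite_permutations permutes_id)
next
  case False
  then obtain i j where ij: "i \<in> A" "j \<in> A" "i \<noteq> j" "f i = f j" by (auto simp: inj_on_def)
  define t where "t = Transposition.transpose i j"
  have t: "t permutes A" unfolding t_def using ij by (intro permutes_swap_id)
  have ft: "f \<circ> t = f" using ij by (auto simp: t_def Transposition.transpose_def)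
  let ?L = "\<Sum>p | p permutes A. of_bool (f \<circ> p = f) * rat_of_int (sign p)"
  have "?L = (\<Sum>p | p permutes A. of_bool (f \<circ> (t \<circ> p) = f) * of_int (sign (t \<circ> p)))"
    by (rule setum_permutations_compose_left[OF t])
  also have "\<dots> = (\<Sum>p | p permutes A. - (of_bool (f \<circ> p = f) * of_int (sign p)))"
  proof (intro sum.cong refl)
    fix p assume "p \<in> {p. p permutes A}"
    then have "sign (t \<circ> p) = - sign p"
      using sign_compose_permutes[OF t] ij(3) by (simp add: t_def sign_swap_id)
    moreover have "f \<circ> (t \<circ> p) = f \<circ> p" by (simp add: o_assoc ft)
    ultimately show "of_bool (f \<circ> (t \<circ> p) = f) * of_int (sign (t \<circ> p)) =
        - (of_bool (f \<circ> p = f) * rat_of_int (sign p))" by simp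
  qed
  also have "\<dots> = - ?L" by (simp add: sum_negf)
  finally show ?thesis using False by simp
qed

lemma sum_PiE_insert:
  assumes "x \<notin> A" "finite A" "finite B"
  shows "(\<Sum>f\<in>PiE (insert x A) (\<lambda>_. B). F f) = (\<Sum>g\<in>PiE A (\<lambda>_. B). \<Sum>a\<in>B. F (g(x := a)))"
proof -
  have "(\<Sum>f\<in>PiE (insert x A) (\<lambda>_. B). F f) = (\<Sum>(a, g)\<in>B \<times> PiE A (\<lambda>_. B). F (g(x := a)))"
    unfolding PiE_insert_eq
    by (subst sum.reindex[OF inj_combinator[OF assms(1)]]) (simp add: case_prod_unfold o_def)
  then show ?thesis
    by (simp add: sum.cartesian_product[symmetric] sum.swap[of _ B])
qed

text \<open>Burnside's lemma: up to the factor \<open>fact (card T)\<close> this counts multisets of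
  \<open>card T\<close> colors. In the induction the new point \<open>t\<close> is either a fixed
  point with one of \<open>y\<close> colors or is sent to some \<open>b\<close> in \<open>T\<close>,
  whose color it must then share; hence the factor \<open>y + card T\<close>.\<close>

lemma sum_card_invariant_permutations:
  assumes "finite T"
  shows "(\<Sum>f\<in>PiE T (\<lambda>_. {..<y}). \<Sum>q | q permutes T. of_bool (\<forall>x\<in>T. f (q x) = f x)) =
    fact (card T) * ((y + card T - 1) choose card T)"
  using assms
proof (induction T rule: finite_induct)
  case empty
  have "{q :: 'a \<Rightarrow> 'a. q = id} = {id}" by auto
  then show ?case by simp
next
  case (insert t T)
  let ?m = "card T"
  have inner: "(\<Sum>a<y. \<Sum>q | q permutes insert t T. of_bool (\<forall>x\<in>insert t T. (g(t := a)) (q x) = (g(t := a)) x)) =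
      (y + ?m) * (\<Sum>q | q permutes T. of_bool (\<forall>x\<in>T. g (q x) = g x))"
    if g: "g \<in> PiE T (\<lambda>_. {..<y})" for g :: "'a \<Rightarrow> nat"
  proof -
    have cond: "(\<forall>x\<in>insert t T. (g(t := a)) ((Transposition.transpose t b \<circ> q) x) = (g(t := a)) x) \<longleftrightarrow>
        (b = t \<or> a = g b) \<and> (\<forall>x\<in>T. g (q x) = g x)"
      if q: "q permutes T" and b: "b \<in> insert t T" for a b q
    proof -
      have qt: "q t = t" using q insert.hyps by (simp add: permutes_not_in)
      have qT: "q x \<in> T" if "x \<in> T" for x using q that by (simp add: permutes_in_image)
      show ?thesis
      proof (cases "b = t")
        case True
        then show ?thesis using qt qT insert.hyps by auto
      next
        case False
        then have bT: "b \<in> T" using b by simp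
        have tr: "(g(t := g b)) (Transposition.transpose t b z) = (g(t := g b)) z" for z
          using False by (auto simp: Transposition.transpose_def)
        have at: "(g(t := a)) ((Transposition.transpose t b \<circ> q) t) = g b"
          using qt False by simp
        show ?thesis
        proof (cases "a = g b")
          case True
          then show ?thesis using False at tr qT insert.hyps by (auto simp: qt)
        next
          case aF: False
          then show ?thesis using False at by auto
        qed
      qed
    qed
    have "(\<Sum>a<y. \<Sum>q | q permutes insert t T. of_bool (\<forall>x\<in>insert t T. (g(t := a)) (q x) = (g(t := a)) x)) =
        (\<Sum>a<y. \<Sum>b\<in>insert t T. \<Sum>q | q permutes T.
          of_bool (b = t \<or> a = g b) * of_bool (\<forall>x\<in>T. g (q x) = g x) :: nat)"
      unfolding sum_over_permutations_insert[OF insert.hyps]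
      by (intro sum.cong refl) (simp only: cond mem_Collect_eq of_bool_conj)
    also have "\<dots> = (\<Sum>b\<in>insert t T. \<Sum>a<y. of_bool (b = t \<or> a = g b)) *
        (\<Sum>q | q permutes T. of_bool (\<forall>x\<in>T. g (q x) = g x))"
      by (subst sum.swap) (simp only: sum_distrib_left[symmetric] sum_distrib_right)
    also have "(\<Sum>b\<in>insert t T. \<Sum>a<y. of_bool (b = t \<or> a = g b)) = y + ?m"
    proof -
      have "(\<Sum>a<y. of_bool (b = t \<or> a = g b)) = (1::nat)" if "b \<in> T" for b
      proof -
        have "{..<y} \<inter> {a. a = g b} = {g b}" using g that by auto
        then show ?thesis using that insert.hyps by auto
      qed
      then show ?thesis using insert.hyps by simp
    qed
    finally show ?thesis .
  qed
  have "fact (card (insert t T)) * ((y + card (insert t T) - 1) choose card (insert t T)) =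
      fact ?m * (Suc ?m * ((y + ?m) choose Suc ?m))"
    using insert.hyps by (simp add: mult_ac del: mult_Suc)
  also have "Suc ?m * ((y + ?m) choose Suc ?m) = (y + ?m) * ((y + ?m - 1) choose ?m)"
    by (cases "y + ?m") (simp_all add: binomial_absorption del: binomial_Suc_Suc mult_Suc)
  finally have binom: "fact (card (insert t T)) * ((y + card (insert t T) - 1) choose card (insert t T)) =
      (y + ?m) * (fact ?m * ((y + ?m - 1) choose ?m))"
    by (simp only: mult_ac)
  have "(\<Sum>f\<in>PiE (insert t T) (\<lambda>_. {..<y}). \<Sum>q | q permutes insert t T.
        of_bool (\<forall>x\<in>insert t T. f (q x) = f x)) =
      (\<Sum>g\<in>PiE T (\<lambda>_. {..<y}). \<Sum>a<y. \<Sum>q | q permutes insert t T.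
        of_bool (\<forall>x\<in>insert t T. (g(t := a)) (q x) = (g(t := a)) x))"
    by (rule sum_PiE_insert) (use insert.hyps in auto)
  also have "\<dots> = (\<Sum>g\<in>PiE T (\<lambda>_. {..<y}). (y + ?m) *
      (\<Sum>q | q permutes T. of_bool (\<forall>x\<in>T. g (q x) = g x)))"
    by (intro sum.cong refl inner)
  also have "\<dots> = (y + ?m) * (fact ?m * ((y + ?m - 1) choose ?m))"
    unfolding sum_distrib_left[symmetric] insert.IH ..
  finally show ?case unfolding binom .
qed

text \<open>Each point added to the column must avoid the \<open>card S + 1\<close> distinct colors
  already on \<open>insert r S\<close>, which contributes the next lower factor of the falling
  product \<open>fact k * (N choose k)\<close>.\<close>

lemma sum_card_hook_permutations:
  assumes "finite S" "finite T" "r \<in> T" "S \<inter> T = {}"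
  shows "(\<Sum>f\<in>PiE (S \<union> T) (\<lambda>_. {..<y}). of_bool (inj_on f (insert r S)) *
      (\<Sum>q | q permutes T. of_bool (\<forall>x\<in>T. f (q x) = f x))) =
    fact (card S + card T) * ((y + card T - 1) choose (card S + card T))"
  using assms(1,4)
proof (induction S rule: finite_induct)
  case empty
  then show ?case using sum_card_invariant_permutations[OF assms(2)] by simp
next
  case (insert s S)
  let ?N = "y + card T - 1" and ?k = "card S + card T"
  have s: "s \<notin> S \<union> T" "s \<noteq> r" "r \<notin> S" using insert assms(3) by auto
  have inner: "(\<Sum>a<y. of_bool (inj_on (g(s := a)) (insert r (insert s S))) *
        (\<Sum>q | q permutes T. of_bool (\<forall>x\<in>T. (g(s := a)) (q x) = (g(s := a)) x))) =
      (y - Suc (card S)) * (of_bool (inj_on g (insert r S)) *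
        (\<Sum>q | q permutes T. of_bool (\<forall>x\<in>T. g (q x) = g x)))"
    if g: "g \<in> PiE (S \<union> T) (\<lambda>_. {..<y})" for g :: "'a \<Rightarrow> nat"
  proof -
    have "(\<forall>x\<in>T. (g(s := a)) (q x) = (g(s := a)) x) \<longleftrightarrow> (\<forall>x\<in>T. g (q x) = g x)"
      if "q permutes T" for a q
      using s permutes_in_image[OF that] by auto
    then have qs: "(\<Sum>q | q permutes T. of_bool (\<forall>x\<in>T. (g(s := a)) (q x) = (g(s := a)) x)) =
        (\<Sum>q | q permutes T. of_bool (\<forall>x\<in>T. g (q x) = g x) :: nat)" for a
      by (intro sum.cong refl) (simp only: mem_Collect_eq)
    have inj: "inj_on (g(s := a)) (insert r (insert s S)) \<longleftrightarrow>
        inj_on g (insert r S) \<and> a \<notin> g ` insert r S" for a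
    proof -
      have "inj_on (g(s := a)) (insert s (insert r S)) \<longleftrightarrow>
          inj_on (g(s := a)) (insert r S) \<and> (g(s := a)) s \<notin> (g(s := a)) ` (insert r S)"
        using s by (subst inj_on_insert) auto
      also have "inj_on (g(s := a)) (insert r S) \<longleftrightarrow> inj_on g (insert r S)"
        using s by (intro inj_on_cong) auto
      also have "(g(s := a)) ` (insert r S) = g ` insert r S"
        using s by (intro image_cong) auto
      finally show ?thesis by (simp only: insert_commute fun_upd_same)
    qed
    have "(\<Sum>a<y. of_bool (inj_on (g(s := a)) (insert r (insert s S))) *
        (\<Sum>q | q permutes T. of_bool (\<forall>x\<in>T. (g(s := a)) (q x) = (g(s := a)) x))) =
      (\<Sum>a<y. of_bool (a \<notin> g ` insert r S)) * (of_bool (inj_on g (insert r S)) *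
        (\<Sum>q | q permutes T. of_bool (\<forall>x\<in>T. g (q x) = g x)) :: nat)"
      by (subst sum_distrib_right, intro sum.cong refl) (simp only: qs inj of_bool_conj mult_ac)
    also have "\<dots> = (y - Suc (card S)) * (of_bool (inj_on g (insert r S)) *
        (\<Sum>q | q permutes T. of_bool (\<forall>x\<in>T. g (q x) = g x)))"
    proof (cases "inj_on g (insert r S)")
      case True
      have "(\<Sum>a<y. of_bool (a \<notin> g ` insert r S)) = card ({..<y} \<inter> {a. a \<notin> g ` insert r S})"
        by (subst sum_of_bool_eq) simp_all
      also have "{..<y} \<inter> {a. a \<notin> g ` insert r S} = {..<y} - g ` insert r S" by auto
      also have "card \<dots> = y - card (g ` insert r S)"
        using g assms(3) insert.hyps by (subst card_Diff_subset) auto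
      also have "card (g ` insert r S) = Suc (card S)"
        using card_image[OF True] s insert.hyps by simp
      finally show ?thesis by simp
    qed simp
    finally show ?thesis .
  qed
  have "(\<Sum>f\<in>PiE (insert s S \<union> T) (\<lambda>_. {..<y}). of_bool (inj_on f (insert r (insert s S))) *
      (\<Sum>q | q permutes T. of_bool (\<forall>x\<in>T. f (q x) = f x))) =
    (y - Suc (card S)) * (fact ?k * (?N choose ?k))"
  proof -
    have "(\<Sum>f\<in>PiE (insert s (S \<union> T)) (\<lambda>_. {..<y}). of_bool (inj_on f (insert r (insert s S))) *
        (\<Sum>q | q permutes T. of_bool (\<forall>x\<in>T. f (q x) = f x))) =
      (\<Sum>g\<in>PiE (S \<union> T) (\<lambda>_. {..<y}). \<Sum>a<y. of_bool (inj_on (g(s := a)) (insert r (insert s S))) *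
        (\<Sum>q | q permutes T. of_bool (\<forall>x\<in>T. (g(s := a)) (q x) = (g(s := a)) x)))"
      by (rule sum_PiE_insert) (use s insert.hyps assms(2) in auto)
    also have "\<dots> = (\<Sum>g\<in>PiE (S \<union> T) (\<lambda>_. {..<y}). (y - Suc (card S)) *
        (of_bool (inj_on g (insert r S)) * (\<Sum>q | q permutes T. of_bool (\<forall>x\<in>T. g (q x) = g x))))"
      by (intro sum.cong refl inner)
    also have "\<dots> = (y - Suc (card S)) * (fact ?k * (?N choose ?k))"
      using insert.IH insert.prems unfolding sum_distrib_left[symmetric] by simp
    finally show ?thesis by (simp only: Un_insert_left)
  qed
  \<comment> \<open>The truncated subtractions agree because \<open>r \<in> T\<close> gives
    \<open>card T \<ge> 1\<close>.\<close>
  also have "y - Suc (card S) = ?N - ?k" using assms(2,3) by (cases "card T") auto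
  also have "(?N - ?k) * (fact ?k * (?N choose ?k)) = fact (Suc ?k) * (?N choose Suc ?k)"
  proof -
    have "(?N - ?k) * (?N choose ?k) = Suc ?k * (?N choose Suc ?k)"
      using binomial_absorb_comp[of ?N ?k] binomial_absorption[of ?k ?N] by (simp only:)
    then have "fact ?k * ((?N - ?k) * (?N choose ?k)) = fact ?k * (Suc ?k * (?N choose Suc ?k))"
      by (simp only:)
    then show ?thesis by (simp only: fact_Suc of_nat_id mult_ac)
  qed
  finally show ?case using insert.hyps by simp
qed

text \<open>With the coloring summed last, the column contributes injectivity and the row
  contributes its color-preserving permutations. The result is the content polynomial of the hook,
  the product of \<open>y + c\<close> for \<open>c\<close> from \<open>- card S\<close> to
  \<open>CARD('n) - 1 - card S\<close>.\<close>

lemma hook_eigenvalue: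
  fixes S :: "'n::finite set"
  assumes r: "r \<notin> S"
  shows "(\<Sum>p | p permutes insert r S. \<Sum>q | q permutes - S.
      of_int (sign p) * rat_of_nat (invariant_colorings y (p \<circ> q))) =
    fact CARD('n) * of_nat ((y + CARD('n) - 1 - card S) choose CARD('n))"
proof -
  let ?F = "PiE UNIV (\<lambda>_. {..<y}) :: ('n \<Rightarrow> nat) set"
  have F: "?F = {f. \<forall>x. f x < y}" by auto
  have finF: "finite ?F" by (rule finite_PiE) auto
  have ic: "rat_of_nat (invariant_colorings y (p \<circ> q)) =
      (\<Sum>f\<in>?F. of_bool (f \<circ> p = f) * of_bool (f \<circ> q = f))"
    if "p permutes insert r S" "q permutes - S" for p q
  proof -
    have "(\<Sum>f\<in>?F. of_bool (f \<circ> p = f) * of_bool (f \<circ> q = f) :: rat) =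
        (\<Sum>f\<in>?F. of_bool (f \<circ> (p \<circ> q) = f))"
      using invariant_colorings_hook[OF r that] by (intro sum.cong refl) simp
    also have "\<dots> = of_nat (card (?F \<inter> {f. f \<circ> (p \<circ> q) = f}))"
      by (subst sum_of_bool_eq) (simp_all add: finF)
    also have "?F \<inter> {f. f \<circ> (p \<circ> q) = f} = {f. (\<forall>x. f x < y) \<and> f \<circ> (p \<circ> q) = f}"
      unfolding F by auto
    finally show ?thesis unfolding invariant_colorings_def by (rule sym)
  qed
  have "(\<Sum>p | p permutes insert r S. \<Sum>q | q permutes - S.
      of_int (sign p) * rat_of_nat (invariant_colorings y (p \<circ> q))) =
    (\<Sum>p | p permutes insert r S. \<Sum>q | q permutes - S. \<Sum>f\<in>?F.
      (of_bool (f \<circ> p = f) * of_int (sign p)) * of_bool (f \<circ> q = f))"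
    by (intro sum.cong refl) (simp add: ic sum_distrib_left mult_ac)
  also have "\<dots> = (\<Sum>f\<in>?F. (\<Sum>p | p permutes insert r S. of_bool (f \<circ> p = f) * of_int (sign p)) *
      (\<Sum>q | q permutes - S. of_bool (f \<circ> q = f)))"
    unfolding sum_product
    by (rule trans[OF sum.cong[OF refl sum.swap] sum.swap])
  also have "\<dots> = of_nat (\<Sum>f\<in>PiE (S \<union> - S) (\<lambda>_. {..<y}). of_bool (inj_on f (insert r S)) *
      (\<Sum>q | q permutes - S. of_bool (\<forall>x\<in>- S. f (q x) = f x)))"
  proof -
    have "f \<circ> q = f \<longleftrightarrow> (\<forall>x\<in>- S. f (q x) = f x)" if "q permutes - S" for q and f :: "'n \<Rightarrow> nat"
      using permutes_not_in[OF that] by (auto simp: fun_eq_iff)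
    then show ?thesis unfolding sum_sign_invariant by simp
  qed
  also have "\<dots> = of_nat (fact (card S + card (- S)) * ((y + card (- S) - 1) choose (card S + card (- S))))"
    using r by (subst sum_card_hook_permutations) auto
  also have "card S + card (- S) = CARD('n)"
    by (simp add: Compl_eq_Diff_UNIV card_Diff_subset card_mono)
  also have "y + card (- S) - 1 = y + CARD('n) - 1 - card S"
    by (simp add: Compl_eq_Diff_UNIV card_Diff_subset card_mono)
  finally show ?thesis by (simp only: of_nat_mult of_nat_fact)
qed

section \<open>Full cycles detected by a determinant\<close>

definition is_full_cycle :: "'n \<Rightarrow> ('n \<Rightarrow> 'n) \<Rightarrow> bool" where
  "is_full_cycle r \<sigma> \<longleftrightarrow> (\<forall>x. \<exists>k. (\<sigma> ^^ k) x = r)"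

text \<open>The Laplacian of the graph with edges from \<open>x\<close> to
  \<open>\<sigma> x\<close>, the row of the root \<open>r\<close> being replaced by
  \<open>v\<close>. As in the matrix-tree theorem, its determinant tells whether every point leads
  to \<open>r\<close>.\<close>

definition cycle_matrix :: "('n \<Rightarrow> 'n) \<Rightarrow> 'n \<Rightarrow> rat ^ 'n \<Rightarrow> rat ^ 'n ^ 'n::finite" where
  "cycle_matrix \<sigma> r v = (\<chi> x. if x = r then v else axis x 1 - axis (\<sigma> x) 1)"

text \<open>With \<open>axis r 1\<close> in row \<open>r\<close> only the identity contributes. For
  \<open>y \<noteq> r\<close>, replacing \<open>axis y 1\<close> there by
  \<open>axis (\<sigma> y) 1\<close> subtracts row \<open>y\<close>, so every unit vector gives
  determinant 1, and the all-ones row is the sum of the unit vectors.\<close>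

lemma det_cycle_matrix_full_cycle:
  fixes \<sigma> :: "'n::finite \<Rightarrow> 'n"
  assumes \<sigma>: "\<sigma> permutes UNIV" and full: "is_full_cycle r \<sigma>"
  shows "det (cycle_matrix \<sigma> r (\<chi> x. 1)) = of_nat CARD('n)"
proof -
  have det_r: "det (cycle_matrix \<sigma> r (axis r 1)) = 1"
  proof -
    have summand: "of_int (sign p) * (\<Prod>x\<in>UNIV. cycle_matrix \<sigma> r (axis r 1) $ x $ p x) = of_bool (p = id)"
      if p: "p permutes UNIV" for p
    proof (cases "p = id")
      case True
      have nofix: "\<sigma> x \<noteq> x" if "x \<noteq> r" for x
      proof
        assume "\<sigma> x = x"
        then have "(\<sigma> ^^ k) x = x" for k by (induction k) auto
        then show False using full that by (metis is_full_cycle_def)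
      qed
      have "cycle_matrix \<sigma> r (axis r 1) $ x $ x = 1" for x
        using nofix[of x] by (cases "x = r") (auto simp: cycle_matrix_def axis_def)
      then show ?thesis using True by simp
    next
      case False
      have "\<exists>x. cycle_matrix \<sigma> r (axis r 1) $ x $ p x = 0"
      proof (rule ccontr)
        assume "\<nexists>x. cycle_matrix \<sigma> r (axis r 1) $ x $ p x = 0"
        then have nz: "cycle_matrix \<sigma> r (axis r 1) $ x $ p x \<noteq> 0" for x by blast
        have pr: "p r = r" using nz[of r] by (auto simp: cycle_matrix_def axis_def split: if_splits)
        have px: "p x = x \<or> p x = \<sigma> x" if "x \<noteq> r" for x
          using nz[of x] that by (auto simp: cycle_matrix_def axis_def split: if_splits)
        \<comment> \<open>Backwards along the path to \<open>r\<close>: if \<open>p\<close> fixes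
          \<open>\<sigma> x\<close>, then by injectivity \<open>p x = \<sigma> x\<close> is possible
          only when \<open>\<sigma> x = x\<close>.\<close>
        have "(\<sigma> ^^ k) x = r \<Longrightarrow> p x = x" for k x
        proof (induction k arbitrary: x)
          case (Suc k)
          then have "p (\<sigma> x) = \<sigma> x" by (simp add: funpow_swap1)
          then show ?case
            using px[of x] pr permutes_inj[OF p] by (metis injD)
        qed (use pr in simp)
        then have "p = id" using full by (metis is_full_cycle_def eq_id_iff)
        then show False using False by simp
      qed
      then have "(\<Prod>x\<in>UNIV. cycle_matrix \<sigma> r (axis r 1) $ x $ p x) = 0" by (auto intro: prod_zero)
      then show ?thesis using False by simp
    qed
    have "det (cycle_matrix \<sigma> r (axis r 1)) = (\<Sum>p | p permutes (UNIV :: 'n set). of_bool (p = id))"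
      unfolding det_def by (intro sum.cong refl) (simp add: summand)
    also have "\<dots> = (\<Sum>p | p permutes (UNIV :: 'n set). if p = id then 1 else 0)"
      by (intro sum.cong refl) simp
    also have "\<dots> = 1" by (simp add: finite_permutations permutes_id)
    finally show ?thesis .
  qed
  have step: "det (cycle_matrix \<sigma> r (axis y 1)) = det (cycle_matrix \<sigma> r (axis (\<sigma> y) 1))" if "y \<noteq> r" for y
  proof -
    have "cycle_matrix \<sigma> r (axis y 1) =
        (\<chi> x. if x = r then (axis y 1 - axis (\<sigma> y) 1) + axis (\<sigma> y) 1 else axis x 1 - axis (\<sigma> x) 1)"
      unfolding cycle_matrix_def by (simp cong: if_cong)
    also have "det \<dots> = det (cycle_matrix \<sigma> r (axis y 1 - axis (\<sigma> y) 1)) +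
        det (cycle_matrix \<sigma> r (axis (\<sigma> y) 1))"
      unfolding cycle_matrix_def by (rule det_row_add)
    also have "det (cycle_matrix \<sigma> r (axis y 1 - axis (\<sigma> y) 1)) = 0"
      by (rule det_identical_rows[of y r]) (use that in \<open>simp_all add: cycle_matrix_def row_def\<close>)
    finally show ?thesis by simp
  qed
  have det_y: "det (cycle_matrix \<sigma> r (axis y 1)) = 1" for y
  proof -
    obtain k where "(\<sigma> ^^ k) y = r" using full by (auto simp: is_full_cycle_def)
    then show ?thesis
    proof (induction k arbitrary: y)
      case (Suc k)
      then show ?case using step[of y] det_r by (cases "y = r") (auto simp: funpow_swap1)
    qed (use det_r in simp)
  qed
  have "(\<chi> x. 1) = (\<Sum>y\<in>UNIV. axis y 1 :: rat ^ 'n)"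
    by (simp add: vec_eq_iff axis_def)
  then have "cycle_matrix \<sigma> r (\<chi> x. 1) =
      (\<chi> x. if x = r then (\<Sum>y\<in>UNIV. axis y 1) else axis x 1 - axis (\<sigma> x) 1)"
    unfolding cycle_matrix_def by (simp only:)
  also have "det \<dots> = (\<Sum>y\<in>UNIV. det (cycle_matrix \<sigma> r (axis y 1)))"
    unfolding cycle_matrix_def by (rule det_linear_row_sum) simp
  finally show ?thesis by (simp add: det_y)
qed

text \<open>Away from \<open>r\<close>, the map \<open>\<sigma>\<close> respects the set
  \<open>U\<close> of points that lead to \<open>r\<close>, so a vector constant on \<open>U\<close>
  and on its complement is annihilated by every row other than that of \<open>r\<close>.\<close>

lemma det_cycle_matrix_not_full_cycle:
  fixes \<sigma> :: "'n::finite \<Rightarrow> 'n"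
  assumes "\<not> is_full_cycle r \<sigma>"
  shows "det (cycle_matrix \<sigma> r (\<chi> x. 1)) = 0"
proof (rule ccontr)
  assume "det (cycle_matrix \<sigma> r (\<chi> x. 1)) \<noteq> 0"
  then have inv: "invertible (cycle_matrix \<sigma> r (\<chi> x. 1))" by (simp add: invertible_det_nz)
  define U where "U = {x. \<exists>k. (\<sigma> ^^ k) x = r}"
  \<comment> \<open>The two values are weighted so that the entries add up to 0, which takes care of
    the all-ones row.\<close>
  define v :: "rat ^ 'n" where "v = (\<chi> x. if x \<in> U then of_nat (card (- U)) else - of_nat (card U))"
  have rU: "r \<in> U" unfolding U_def by (auto intro: exI[of _ 0])
  have step: "\<sigma> x \<in> U \<longleftrightarrow> x \<in> U" if xr: "x \<noteq> r" for x
  proof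
    assume "\<sigma> x \<in> U"
    then obtain k where "(\<sigma> ^^ k) (\<sigma> x) = r" unfolding U_def by blast
    then have "(\<sigma> ^^ Suc k) x = r" by (simp add: funpow_swap1)
    then show "x \<in> U" unfolding U_def by blast
  next
    assume "x \<in> U"
    then obtain k where k: "(\<sigma> ^^ k) x = r" unfolding U_def by blast
    then obtain l where "k = Suc l" using xr by (cases k) auto
    then show "\<sigma> x \<in> U" using k unfolding U_def by (auto simp: funpow_swap1)
  qed
  have "cycle_matrix \<sigma> r (\<chi> x. 1) *v v = 0"
  proof (rule vec_eq_iff[THEN iffD2, rule_format])
    fix x
    show "(cycle_matrix \<sigma> r (\<chi> x. 1) *v v) $ x = 0 $ x"
    proof (cases "x = r")
      case True
      have "(\<Sum>y\<in>UNIV. v $ y) = (\<Sum>y\<in>U. v $ y) + (\<Sum>y\<in>- U. v $ y)"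
        using sum.union_disjoint[of U "- U" "\<lambda>y. v $ y"] by (simp add: Compl_partition)
      also have "\<dots> = 0" by (simp add: v_def)
      finally show ?thesis
        using True by (simp add: matrix_vector_mult_def cycle_matrix_def)
    next
      case False
      have "(cycle_matrix \<sigma> r (\<chi> x. 1) *v v) $ x = (\<Sum>y\<in>UNIV. (axis x 1 $ y - axis (\<sigma> x) 1 $ y) * v $ y)"
        using False by (simp add: matrix_vector_mult_def cycle_matrix_def)
      also have "\<dots> = (\<Sum>y\<in>UNIV. (if y = x then v $ y else 0) - (if y = \<sigma> x then v $ y else 0))"
        by (intro sum.cong refl) (auto simp: axis_def)
      also have "\<dots> = v $ x - v $ \<sigma> x" by (simp add: sum_subtractf)
      also have "\<dots> = 0" using step[OF False] by (simp add: v_def)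
      finally show ?thesis by simp
    qed
  qed
  then have "v = 0"
    using inv by (metis invertible_def matrix_vector_mul_assoc matrix_vector_mul_lid matrix_vector_mult_0_right)
  moreover have "v $ r \<noteq> 0"
  proof -
    have "- U \<noteq> {}" using assms unfolding U_def is_full_cycle_def by blast
    then show ?thesis using rU by (simp add: v_def card_eq_0_iff)
  qed
  ultimately show False by simp
qed

text \<open>Both sides are the determinant of the cycle matrix: expanding each of its rows
  \<open>axis x 1 - axis (\<sigma> x) 1\<close> selects the set \<open>S\<close> of rows in which the second term is taken.\<close>

lemma sum_hook_kernel:
  fixes \<sigma> :: "'n::finite \<Rightarrow> 'n"
  assumes \<sigma>: "\<sigma> permutes UNIV"
  shows "(\<Sum>S\<in>Pow (- {r}). (-1) ^ card S * hook_kernel r S \<sigma>) =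
    of_nat CARD('n) * of_bool (is_full_cycle r \<sigma>)"
proof -
  have "(\<Sum>S\<in>Pow (- {r}). (-1) ^ card S * hook_kernel r S \<sigma>) =
      (\<Sum>S\<in>Pow (- {r}). \<Sum>p | p permutes UNIV. of_int (sign p) *
        ((\<Prod>x\<in>S. - of_bool (p x = \<sigma> x)) * (\<Prod>x\<in>- {r} - S. of_bool (p x = x))))"
  proof (intro sum.cong refl)
    fix S assume "S \<in> Pow (- {r})"
    then have r: "r \<notin> S" by auto
    have "(-1) ^ card S * hook_kernel r S \<sigma> = (\<Sum>p | p permutes insert r S.
        of_int (sign p) * (\<Prod>x\<in>S. - of_bool (p x = \<sigma> x)))"
      unfolding hook_kernel_eq[OF r \<sigma>] sum_distrib_left
    proof (intro sum.cong refl)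
      fix p
      have "(\<Prod>x\<in>S. - of_bool (p x = \<sigma> x)) = (-1) ^ card S * (of_bool (\<forall>x\<in>S. p x = \<sigma> x) :: rat)"
      proof (cases "\<forall>x\<in>S. p x = \<sigma> x")
        case False
        then have "(\<Prod>x\<in>S. - of_bool (p x = \<sigma> x) :: rat) = 0" by (intro prod_zero) auto
        then show ?thesis using False by simp
      qed simp
      then show "(-1) ^ card S * (if \<forall>x\<in>S. p x = \<sigma> x then of_int (sign p) else 0) =
          of_int (sign p) * (\<Prod>x\<in>S. - of_bool (p x = \<sigma> x) :: rat)"
        by (simp only: of_bool_def) simp
    qed
    \<comment> \<open>The factors \<open>of_bool (p x = x)\<close> confine \<open>p\<close> to
      \<open>insert r S\<close> again, so that all \<open>S\<close> share one range of summation and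
      the product over rows can be reassembled.\<close>
    also have "\<dots> = (\<Sum>p | p permutes UNIV. of_int (sign p) *
        ((\<Prod>x\<in>S. - of_bool (p x = \<sigma> x)) * (\<Prod>x\<in>- {r} - S. of_bool (p x = x))))"
    proof (rule sum.mono_neutral_cong_left)
      show "finite {p :: 'n \<Rightarrow> 'n. p permutes UNIV}" by (simp add: finite_permutations)
      show "{p. p permutes insert r S} \<subseteq> {p. p permutes UNIV}" by (auto dest: permutes_UNIV)
      show "\<forall>p\<in>{p. p permutes UNIV} - {p. p permutes insert r S}. of_int (sign p) *
        ((\<Prod>x\<in>S. - of_bool (p x = \<sigma> x)) * (\<Prod>x\<in>- {r} - S. of_bool (p x = x))) = (0 :: rat)"
      proof
        fix p assume "p \<in> {p. p permutes UNIV} - {p. p permutes insert r S}"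
        then obtain x where "x \<notin> insert r S" "p x \<noteq> x"
          using permutes_finite_UNIV_iff[of p "insert r S"] by auto
        then have "(\<Prod>x\<in>- {r} - S. of_bool (p x = x) :: rat) = 0" by (intro prod_zero) auto
        then show "of_int (sign p) *
          ((\<Prod>x\<in>S. - of_bool (p x = \<sigma> x)) * (\<Prod>x\<in>- {r} - S. of_bool (p x = x))) = (0 :: rat)" by simp
      qed
      fix p assume "p \<in> {p. p permutes insert r S}"
      then have "(\<Prod>x\<in>- {r} - S. of_bool (p x = x) :: rat) = 1"
        by (intro prod.neutral) (auto simp: permutes_not_in)
      then show "of_int (sign p) * (\<Prod>x\<in>S. - of_bool (p x = \<sigma> x)) = of_int (sign p) *
          ((\<Prod>x\<in>S. - of_bool (p x = \<sigma> x)) * (\<Prod>x\<in>- {r} - S. of_bool (p x = x)) :: rat)" by simp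
    qed
    finally show "(-1) ^ card S * hook_kernel r S \<sigma> = (\<Sum>p | p permutes UNIV. of_int (sign p) *
        ((\<Prod>x\<in>S. - of_bool (p x = \<sigma> x)) * (\<Prod>x\<in>- {r} - S. of_bool (p x = x))))" .
  qed
  also have "\<dots> = (\<Sum>p | p permutes UNIV. of_int (sign p) *
      (\<Prod>x\<in>- {r}. - of_bool (p x = \<sigma> x) + of_bool (p x = x)))"
    by (subst sum.swap, intro sum.cong refl, subst prod_add, simp, simp only: sum_distrib_left)
  also have "\<dots> = det (cycle_matrix \<sigma> r (\<chi> x. 1))"
    unfolding det_def
  proof (intro sum.cong refl arg_cong2[where f = "(*)"])
    fix p
    have "(\<Prod>x\<in>UNIV. cycle_matrix \<sigma> r (\<chi> x. 1) $ x $ p x) =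
        cycle_matrix \<sigma> r (\<chi> x. 1) $ r $ p r * (\<Prod>x\<in>- {r}. cycle_matrix \<sigma> r (\<chi> x. 1) $ x $ p x)"
      by (subst prod.remove[of _ r]) (auto simp: Compl_eq_Diff_UNIV)
    also have "\<dots> = (\<Prod>x\<in>- {r}. - of_bool (p x = \<sigma> x) + of_bool (p x = x))"
      by (simp add: cycle_matrix_def) (intro prod.cong refl, auto simp: axis_def)
    finally show "(\<Prod>x\<in>- {r}. - of_bool (p x = \<sigma> x) + of_bool (p x = x)) =
        (\<Prod>x\<in>UNIV. cycle_matrix \<sigma> r (\<chi> x. 1) $ x $ p x)" by simp
  qed
  also have "\<dots> = of_nat CARD('n) * of_bool (is_full_cycle r \<sigma>)"
    using det_cycle_matrix_full_cycle[OF \<sigma>] det_cycle_matrix_not_full_cycle by (cases "is_full_cycle r \<sigma>") auto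
  finally show ?thesis .
qed

text \<open>Every hook kernel is 1 at \<open>id\<close>, so only the eigenvalues remain. The
  multiplicity \<open>n - 1 choose l\<close> counts the sets \<open>S\<close> of size
  \<open>l\<close>; it is also the dimension of the hook representation, in accordance with
  Frobenius' formula.\<close>

lemma word_sum_full_cycle:
  fixes r :: "'n::finite"
  defines "n \<equiv> CARD('n)"
  shows "of_nat n * word_sum {p. p permutes UNIV} (\<circ>) id (\<lambda>y \<tau>. of_nat (invariant_colorings y \<tau>)) ys
      (\<lambda>\<sigma>. of_bool (is_full_cycle r \<sigma>)) =
    (\<Sum>l<n. (-1) ^ l * of_nat ((n - 1) choose l) *
      (\<Prod>y\<leftarrow>ys. fact n * of_nat ((y + n - 1 - l) choose n)))"
proof -
  let ?W = "word_sum {p :: 'n \<Rightarrow> 'n. p permutes UNIV} (\<circ>) id (\<lambda>y \<tau>. of_nat (invariant_colorings y \<tau>)) ys"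
  have W: "?W (hook_kernel r S) = (\<Prod>y\<leftarrow>ys. fact n * of_nat ((y + n - 1 - card S) choose n))"
    if r: "r \<notin> S" for S
  proof -
    have "?W (hook_kernel r S) =
        (\<Prod>y\<leftarrow>ys. fact n * of_nat ((y + n - 1 - card S) choose n)) * hook_kernel r S id"
    proof (rule word_sum_eigenfunction)
      fix j and h :: "'n \<Rightarrow> 'n" assume "h \<in> {p. p permutes UNIV}"
      then show "(\<Sum>u | u permutes UNIV. of_nat (invariant_colorings j u) * hook_kernel r S (u \<circ> h)) =
          fact n * of_nat ((j + n - 1 - card S) choose n) * hook_kernel r S h"
        unfolding n_def hook_eigenvalue[OF r, of j, symmetric]
        by (intro hook_kernel_eigenfunction[OF r] arg_cong[where f = of_nat] invariant_colorings_commute) auto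
    qed (auto intro: permutes_compose)
    moreover have "hook_kernel r S id = 1"
      using hook_kernel_factorization[OF r permutes_id permutes_id] by simp
    ultimately show ?thesis by (simp only: mult_1_right)
  qed
  have "of_nat n * ?W (\<lambda>\<sigma>. of_bool (is_full_cycle r \<sigma>)) = ?W (\<lambda>\<sigma>. of_nat n * of_bool (is_full_cycle r \<sigma>))"
    by (rule word_sum_scale[symmetric])
  also have "\<dots> = ?W (\<lambda>\<sigma>. \<Sum>S\<in>Pow (- {r}). (-1) ^ card S * hook_kernel r S \<sigma>)"
    unfolding n_def by (rule word_sum_cong) (auto intro: permutes_compose simp: sum_hook_kernel)
  also have "\<dots> = (\<Sum>S\<in>Pow (- {r}). (-1) ^ card S * ?W (hook_kernel r S))"
    by (rule word_sum_linear)
  also have "\<dots> = (\<Sum>S\<in>Pow (- {r}). (-1) ^ card S *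
      (\<Prod>y\<leftarrow>ys. fact n * of_nat ((y + n - 1 - card S) choose n)))"
    by (intro sum.cong refl, subst W) auto
  also have "\<dots> = (\<Sum>l<n. \<Sum>S | S \<in> Pow (- {r}) \<and> card S = l. (-1) ^ card S *
      (\<Prod>y\<leftarrow>ys. fact n * of_nat ((y + n - 1 - card S) choose n)))"
  proof (rule sum.group[symmetric])
    have "card S < n" if "S \<subseteq> - {r}" for S
      unfolding n_def using that by (intro psubset_card_mono) auto
    then show "card ` Pow (- {r}) \<subseteq> {..<n}" by auto
  qed auto
  also have "\<dots> = (\<Sum>l<n. (-1) ^ l * of_nat ((n - 1) choose l) *
      (\<Prod>y\<leftarrow>ys. fact n * of_nat ((y + n - 1 - l) choose n)))"
  proof (intro sum.cong refl)
    fix l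
    have "card {S. S \<in> Pow (- {r}) \<and> card S = l} = (n - 1) choose l"
      using n_subsets[of "- {r}" l] by (simp add: n_def Compl_eq_Diff_UNIV card_Diff_subset)
    then show "(\<Sum>S | S \<in> Pow (- {r}) \<and> card S = l. (-1) ^ card S *
      (\<Prod>y\<leftarrow>ys. fact n * of_nat ((y + n - 1 - card S) choose n))) =
      (-1) ^ l * of_nat ((n - 1) choose l) * (\<Prod>y\<leftarrow>ys. fact n * rat_of_nat ((y + n - 1 - l) choose n))"
      by simp
  qed
  finally show ?thesis .
qed

section \<open>Monomial matrices\<close>

definition mono_mat :: "('n \<Rightarrow> 'n) \<Rightarrow> ('n \<Rightarrow> complex) \<Rightarrow> complex ^ 'n ^ 'n::finite" where
  "mono_mat \<sigma> t = (\<chi> i j. if i = \<sigma> j then t j else 0)"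

abbreviation root_vectors :: "nat \<Rightarrow> ('n \<Rightarrow> complex) set" where
  "root_vectors d \<equiv> {t. \<forall>j. t j ^ d = 1}"

lemma mono_mat_mult:
  "mono_mat \<sigma> t ** mono_mat \<tau> s = mono_mat (\<sigma> \<circ> \<tau>) (\<lambda>j. t (\<tau> j) * s j)"
proof -
  have "(mono_mat \<sigma> t ** mono_mat \<tau> s) $ i $ j = mono_mat (\<sigma> \<circ> \<tau>) (\<lambda>j. t (\<tau> j) * s j) $ i $ j" for i j
  proof -
    have "(mono_mat \<sigma> t ** mono_mat \<tau> s) $ i $ j =
        (\<Sum>k\<in>UNIV. (if i = \<sigma> k then t k else 0) * (if k = \<tau> j then s j else 0))"
      by (simp add: matrix_matrix_mult_def mono_mat_def)
    also have "\<dots> = (\<Sum>k\<in>UNIV. if k = \<tau> j then (if i = \<sigma> k then t k else 0) * s j else 0)"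
      by (intro sum.cong refl) simp
    finally show ?thesis by (simp add: mono_mat_def)
  qed
  then show ?thesis by (simp add: vec_eq_iff)
qed

lemma mono_mat_id: "mono_mat id (\<lambda>_. 1) = mat 1"
  by (simp add: mono_mat_def mat_def vec_eq_iff)

lemma mono_mat_vector:
  assumes "\<sigma> permutes UNIV"
  shows "(mono_mat \<sigma> t *v v) $ \<sigma> j = t j * v $ j"
proof -
  have "(mono_mat \<sigma> t *v v) $ \<sigma> j = (\<Sum>k\<in>UNIV. (if j = k then t k else 0) * v $ k)"
    by (simp add: matrix_vector_mult_def mono_mat_def inj_eq[OF permutes_inj[OF assms]])
  also have "\<dots> = (\<Sum>k\<in>UNIV. if k = j then t k * v $ k else 0)"
    by (intro sum.cong refl) simp
  finally show ?thesis by simp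
qed

lemma mono_mat_eigenvector_iff:
  assumes "\<sigma> permutes UNIV"
  shows "mono_mat \<sigma> t *v v = l *s v \<longleftrightarrow> (\<forall>j. t j * v $ j = l * v $ \<sigma> j)"
proof
  assume *: "mono_mat \<sigma> t *v v = l *s v"
  then show "\<forall>j. t j * v $ j = l * v $ \<sigma> j"
    using mono_mat_vector[OF assms, of t v] by simp
next
  assume *: "\<forall>j. t j * v $ j = l * v $ \<sigma> j"
  show "mono_mat \<sigma> t *v v = l *s v"
  proof (rule vec_eq_iff[THEN iffD2, rule_format])
    fix i
    obtain j where "i = \<sigma> j" using permutes_surj[OF assms] by (metis surjD)
    then show "(mono_mat \<sigma> t *v v) $ i = (l *s v) $ i"
      using * mono_mat_vector[OF assms, of t v] by simp
  qed
qed

lemma fix_space_mono_mat: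
  assumes "\<sigma> permutes UNIV"
  shows "v \<in> fix_space (mono_mat \<sigma> t) \<longleftrightarrow> (\<forall>j. v $ \<sigma> j = t j * v $ j)"
  using mono_mat_eigenvector_iff[OF assms, of t v 1] by (auto simp: fix_space_def)

lemma mono_mat_inject:
  assumes "mono_mat \<sigma> t = mono_mat \<tau> s" "\<And>j. t j \<noteq> 0" "\<And>j. s j \<noteq> 0"
  shows "\<sigma> = \<tau> \<and> t = s"
proof -
  have eq: "(if i = \<sigma> j then t j else 0) = (if i = \<tau> j then s j else 0)" for i j
    using arg_cong[OF assms(1), of "\<lambda>A. A $ i $ j"] by (simp add: mono_mat_def)
  have "\<sigma> j = \<tau> j \<and> t j = s j" for j
    using eq[of "\<sigma> j" j] assms(2,3) by (auto split: if_splits)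
  then show ?thesis by auto
qed

lemma root_nonzero: "(z::complex) ^ d = 1 \<Longrightarrow> d > 0 \<Longrightarrow> z \<noteq> 0"
  by (auto simp: zero_power)

lemma carrier_Gd1n_iff:
  assumes "d > 0"
  shows "A \<in> carrier (Gd1n d) \<longleftrightarrow> (\<exists>\<sigma> t. A = mono_mat \<sigma> t \<and> \<sigma> permutes UNIV \<and> t \<in> root_vectors d)"
proof
  assume "A \<in> carrier (Gd1n d)"
  then have row: "\<exists>!j. A $ i $ j \<noteq> 0" and col: "\<exists>!i. A $ i $ j \<noteq> 0"
    and root: "A $ i $ j \<noteq> 0 \<Longrightarrow> (A $ i $ j) ^ d = 1" for i j
    by (auto simp: Gd1n_def)
  define \<sigma> where "\<sigma> j = (THE i. A $ i $ j \<noteq> 0)" for j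
  have \<sigma>: "A $ i $ j \<noteq> 0 \<longleftrightarrow> \<sigma> j = i" for i j
    unfolding \<sigma>_def using the1_equality[OF col] theI'[OF col] by blast
  have "\<sigma> permutes UNIV"
    unfolding permutes_univ using row by (simp add: \<sigma>)
  moreover have "A = mono_mat \<sigma> (\<lambda>j. A $ \<sigma> j $ j)"
    using \<sigma> by (simp add: mono_mat_def vec_eq_iff) metis
  moreover have "(\<lambda>j. A $ \<sigma> j $ j) \<in> root_vectors d"
    using root \<sigma> by blast
  ultimately show "\<exists>\<sigma> t. A = mono_mat \<sigma> t \<and> \<sigma> permutes UNIV \<and> t \<in> root_vectors d" by blast
next
  assume "\<exists>\<sigma> t. A = mono_mat \<sigma> t \<and> \<sigma> permutes UNIV \<and> t \<in> root_vectors d"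
  then obtain \<sigma> t where A: "A = mono_mat \<sigma> t" "\<sigma> permutes UNIV" and t: "\<And>j. t j ^ d = 1" by blast
  have nz: "A $ i $ j \<noteq> 0 \<longleftrightarrow> \<sigma> j = i" for i j
    using A(1) root_nonzero[OF t assms] by (auto simp: mono_mat_def)
  have "\<exists>!j. A $ i $ j \<noteq> 0" for i unfolding nz using A(2) by (simp add: permutes_univ)
  moreover have "\<exists>!i. A $ i $ j \<noteq> 0" for j unfolding nz by simp
  moreover have "(A $ i $ j) ^ d = 1" if "A $ i $ j \<noteq> 0" for i j
    using that t unfolding nz by (auto simp: A(1) mono_mat_def)
  ultimately show "A \<in> carrier (Gd1n d)" by (simp add: Gd1n_def)
qed

lemma mono_mat_in_carrier:
  "d > 0 \<Longrightarrow> \<sigma> permutes UNIV \<Longrightarrow> t \<in> root_vectors d \<Longrightarrow> mono_mat \<sigma> t \<in> carrier (Gd1n d)"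
  using carrier_Gd1n_iff by blast

lemma finite_roots_of_unity: "d > 0 \<Longrightarrow> finite {z::complex. z ^ d = 1}"
  using finite_roots_unity[of d] by simp

lemma root_vectors_PiE: "root_vectors d = PiE (UNIV :: 'n::finite set) (\<lambda>_. {z. z ^ d = 1})"
  by auto

lemma finite_root_vectors: "d > 0 \<Longrightarrow> finite (root_vectors d :: ('n::finite \<Rightarrow> complex) set)"
  unfolding root_vectors_PiE by (intro finite_PiE) (auto intro: finite_roots_of_unity)

lemma card_root_vectors: "d > 0 \<Longrightarrow> card (root_vectors d :: ('n::finite \<Rightarrow> complex) set) = d ^ CARD('n)"
  unfolding root_vectors_PiE by (subst card_PiE) (simp_all add: card_complex_roots_unity Suc_le_eq)

lemma bij_betw_mono_mat:
  assumes "d > 0"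
  shows "bij_betw (\<lambda>(\<sigma>, t). mono_mat \<sigma> t) ({\<sigma> :: 'n::finite \<Rightarrow> 'n. \<sigma> permutes UNIV} \<times> root_vectors d)
    (carrier (Gd1n d))"
proof (rule bij_betw_imageI)
  show "inj_on (\<lambda>(\<sigma>, t). mono_mat \<sigma> t) ({\<sigma> :: 'n \<Rightarrow> 'n. \<sigma> permutes UNIV} \<times> root_vectors d)"
  proof (rule inj_onI, clarify)
    fix \<sigma> \<tau> :: "'n \<Rightarrow> 'n" and t s :: "'n \<Rightarrow> complex"
    assume "\<forall>j. t j ^ d = 1" "\<forall>j. s j ^ d = 1" "mono_mat \<sigma> t = mono_mat \<tau> s"
    then show "\<sigma> = \<tau> \<and> t = s"
      using root_nonzero[OF _ assms] by (intro mono_mat_inject) auto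
  qed
  show "(\<lambda>(\<sigma>, t). mono_mat \<sigma> t) ` ({\<sigma> :: 'n \<Rightarrow> 'n. \<sigma> permutes UNIV} \<times> root_vectors d) = carrier (Gd1n d)"
    by (auto simp: carrier_Gd1n_iff[OF assms]) (force simp: image_iff)
qed

lemma sum_carrier_Gd1n:
  assumes "d > 0"
  shows "(\<Sum>A\<in>carrier (Gd1n d :: 'n::finite cmat_group). F A) =
    (\<Sum>\<sigma> | \<sigma> permutes UNIV. \<Sum>t\<in>root_vectors d. F (mono_mat \<sigma> t))"
  using sum.reindex_bij_betw[OF bij_betw_mono_mat[OF assms], of F]
  by (simp add: sum.cartesian_product case_prod_unfold)

lemma order_Gd1n:
  assumes "d > 0"
  shows "order (Gd1n d :: 'n::finite cmat_group) = d ^ CARD('n) * fact CARD('n)"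
proof -
  have "order (Gd1n d :: 'n cmat_group) =
      card ({\<sigma> :: 'n \<Rightarrow> 'n. \<sigma> permutes UNIV} \<times> (root_vectors d :: ('n \<Rightarrow> complex) set))"
    unfolding order_def by (rule bij_betw_same_card[OF bij_betw_mono_mat[OF assms], symmetric])
  also have "\<dots> = fact CARD('n) * d ^ CARD('n)"
    unfolding card_cartesian_product card_root_vectors[OF assms] by (simp add: card_permutations)
  finally show ?thesis by simp
qed

definition perm_of :: "complex ^ 'n ^ 'n::finite \<Rightarrow> 'n \<Rightarrow> 'n" where
  "perm_of A j = (THE i. A $ i $ j \<noteq> 0)"

text \<open>A homomorphism from \<open>G(d,1,n)\<close> to the \<open>d\<close>-th roots of unity.
  Among the elements whose permutation is a full cycle it determines the conjugacy class.\<close>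

definition color_of :: "complex ^ 'n ^ 'n::finite \<Rightarrow> complex" where
  "color_of A = (\<Prod>j\<in>UNIV. A $ perm_of A j $ j)"

lemma perm_of_mono_mat:
  assumes "\<And>j. t j \<noteq> 0"
  shows "perm_of (mono_mat \<sigma> t) = \<sigma>"
proof
  fix j
  have "mono_mat \<sigma> t $ i $ j \<noteq> 0 \<longleftrightarrow> i = \<sigma> j" for i
    using assms by (simp add: mono_mat_def)
  then show "perm_of (mono_mat \<sigma> t) j = \<sigma> j" unfolding perm_of_def by simp
qed

lemma color_of_mono_mat:
  assumes "\<And>j. t j \<noteq> 0"
  shows "color_of (mono_mat \<sigma> t) = (\<Prod>j\<in>UNIV. t j)"
  unfolding color_of_def perm_of_mono_mat[of t, OF assms] by (simp add: mono_mat_def)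

lemma perm_color_mult:
  fixes A B :: "complex ^ 'n ^ 'n::finite"
  assumes d: "d > 0" and A: "A = mono_mat \<sigma> t" "\<sigma> permutes UNIV" "t \<in> root_vectors d"
    and B: "B \<in> carrier (Gd1n d)"
  shows "perm_of (A ** B) = \<sigma> \<circ> perm_of B" "color_of (A ** B) = (\<Prod>j\<in>UNIV. t j) * color_of B"
    "A ** B \<in> carrier (Gd1n d)"
proof -
  obtain \<tau> s where B: "B = mono_mat \<tau> s" "\<tau> permutes UNIV" "s \<in> root_vectors d"
    using B carrier_Gd1n_iff[OF d] by blast
  have nz: "t j \<noteq> 0" "s j \<noteq> 0" for j using A B root_nonzero[OF _ d] by auto
  show "perm_of (A ** B) = \<sigma> \<circ> perm_of B"
    by (simp add: A B mono_mat_mult perm_of_mono_mat nz)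
  have "(\<Prod>j\<in>UNIV. t (\<tau> j)) = (\<Prod>j\<in>UNIV. t j)"
    using prod.permute[OF B(2), of t] by (simp add: o_def)
  then show "color_of (A ** B) = (\<Prod>j\<in>UNIV. t j) * color_of B"
    by (simp add: A B mono_mat_mult color_of_mono_mat nz prod.distrib)
  show "A ** B \<in> carrier (Gd1n d)"
    unfolding A(1) B(1) mono_mat_mult using A B
    by (intro mono_mat_in_carrier[OF d] permutes_compose) (auto simp: power_mult_distrib)
qed

section \<open>Fixed vectors of monomial matrices\<close>

lemma funpow_fixed_vector:
  fixes v t :: "'n \<Rightarrow> complex"
  assumes "\<And>i. v (\<sigma> i) = t i * v i"
  shows "v ((\<sigma> ^^ k) i) = (\<Prod>m<k. t ((\<sigma> ^^ m) i)) * v i"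
  by (induction k) (simp_all add: assms)

lemma funpow_permutes_symmetric:
  fixes \<sigma> :: "'n::finite \<Rightarrow> 'n"
  assumes "\<sigma> permutes UNIV" "y = (\<sigma> ^^ k) x"
  obtains l where "x = (\<sigma> ^^ l) y"
proof -
  have "permutation \<sigma>" using assms(1) permutes_imp_permutation[OF finite] by blast
  then obtain n where n: "n > 0" "(\<sigma> ^^ n) x = x" by (rule permutation_self)
  have per: "(\<sigma> ^^ (n * m)) x = x" for m
    by (induction m) (simp_all add: funpow_add n)
  have "n * k = (n * k - k) + k" using n(1) by (simp add: mult_le_mono1 Suc_le_eq)
  then have "(\<sigma> ^^ (n * k - k)) y = (\<sigma> ^^ (n * k)) x"
    unfolding assms(2) by (metis comp_apply funpow_add)
  then show ?thesis using per that by metis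
qed

text \<open>Along an orbit of \<open>\<sigma>\<close> a fixed vector changes only by
  \<open>d\<close>-th roots of unity, so one value per orbit determines it. The representatives at
  which some fixed vector is nonzero form \<open>R\<close>; they index a basis of the fixed space
  with entries 0 or roots of unity. As \<open>K\<close> is stable under these roots, the fixed
  vectors over \<open>K\<close> correspond to arbitrary functions from \<open>R\<close> to
  \<open>K\<close>.\<close>

lemma monomial_fixed_vectors:
  fixes \<sigma> :: "'n::finite \<Rightarrow> 'n" and t :: "'n \<Rightarrow> complex"
  assumes d: "d > 0" and \<sigma>: "\<sigma> permutes UNIV" and t: "t \<in> root_vectors d"
    and K: "finite K" "0 \<in> K" "\<And>z k. z ^ d = 1 \<Longrightarrow> k \<in> K \<Longrightarrow> z * k \<in> K"
  shows "card {v. (\<forall>i. v i \<in> K) \<and> (\<forall>i. v (\<sigma> i) = t i * v i)} =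
    card K ^ vec.dim (fix_space (mono_mat \<sigma> t))"
proof -
  define F where "F v \<longleftrightarrow> (\<forall>i. v (\<sigma> i) = t i * v i)" for v :: "'n \<Rightarrow> complex"
  define orb where "orb x = {y. \<exists>k. y = (\<sigma> ^^ k) x}" for x
  \<comment> \<open>The choice depends only on the set \<open>orb x\<close>, so \<open>rep\<close>
    is constant on orbits.\<close>
  define rep where "rep x = (SOME y. y \<in> orb x)" for x
  have orb_eq: "orb y = orb x" if "y \<in> orb x" for x y
  proof -
    have *: "orb y \<subseteq> orb x" if "y \<in> orb x" for x y
      using that unfolding orb_def by (auto simp flip: funpow_add[THEN fun_cong, unfolded comp_apply])
    moreover have "x \<in> orb y"
      using that funpow_permutes_symmetric[OF \<sigma>] unfolding orb_def by blast
    ultimately show ?thesis using that by blast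
  qed
  have self: "x \<in> orb x" for x unfolding orb_def by (auto intro: exI[of _ 0])
  have rep_orb: "rep x \<in> orb x" for x unfolding rep_def using self by (rule someI)
  have rep_eq: "rep y = rep x" if "y \<in> orb x" for x y unfolding rep_def orb_eq[OF that] ..
  have rep_rep: "rep (rep x) = rep x" for x using rep_eq[OF rep_orb] .
  have rep_\<sigma>: "rep (\<sigma> x) = rep x" for x by (rule rep_eq) (auto simp: orb_def intro: exI[of _ 1])
  have from_rep: "\<exists>k. x = (\<sigma> ^^ k) (rep x)" for x
    using orb_eq[OF rep_orb, of x] self[of x] unfolding orb_def by blast
  have F_rep: "\<exists>T. T ^ d = 1 \<and> (\<forall>v. F v \<longrightarrow> v i = T * v (rep i))" for i
  proof -
    obtain k where k: "i = (\<sigma> ^^ k) (rep i)" using from_rep by blast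
    have "v i = (\<Prod>m<k. t ((\<sigma> ^^ m) (rep i))) * v (rep i)" if "F v" for v
      using funpow_fixed_vector[of v \<sigma> t k "rep i"] that k by (auto simp: F_def)
    moreover have "(\<Prod>m<k. t ((\<sigma> ^^ m) (rep i))) ^ d = 1"
      using t by (simp add: prod_power_distrib)
    ultimately show ?thesis by blast
  qed
  define R where "R = {x. rep x = x \<and> (\<exists>v. F v \<and> v x \<noteq> 0)}"
  define V where "V x = (SOME v. F v \<and> v x \<noteq> 0)" for x
  \<comment> \<open>\<open>V x\<close> is cut off outside the orbit of \<open>x\<close> and scaled
    to be 1 at \<open>x\<close>.\<close>
  define b where "b x i = (if rep i = x then V x i / V x x else 0)" for x i
  have V: "F (V x)" "V x x \<noteq> 0" if "x \<in> R" for x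
    using that someI_ex[of "\<lambda>v. F v \<and> v x \<noteq> 0"] unfolding R_def V_def by auto
  have Fb: "b x (\<sigma> i) = t i * b x i" if "x \<in> R" for x i
    using V(1)[OF that] by (simp add: b_def rep_\<sigma> F_def)
  have bx: "b x x = 1" if "x \<in> R" for x
    using V(2)[OF that] that by (simp add: b_def R_def)
  have b_root: "b (rep i) i ^ d = 1" if "rep i \<in> R" for i
  proof -
    obtain T where T: "T ^ d = 1" "\<And>v. F v \<Longrightarrow> v i = T * v (rep i)" using F_rep by blast
    have "b (rep i) i = T" using V(2)[OF that] T(2)[OF V(1)[OF that]] by (simp add: b_def)
    then show ?thesis using T(1) by simp
  qed
  have expand: "v i = (if rep i \<in> R then v (rep i) * b (rep i) i else 0)" if "F v" for v i
  proof -
    obtain T where T: "\<And>v. F v \<Longrightarrow> v i = T * v (rep i)" using F_rep by blast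
    show ?thesis
    proof (cases "rep i \<in> R")
      case True
      then show ?thesis using T[OF that] T[OF V(1)[OF True]] V(2)[OF True] by (simp add: b_def)
    next
      case False
      then have "v (rep i) = 0" using that by (auto simp: R_def rep_rep)
      then show ?thesis using T[OF that] False by simp
    qed
  qed
  have "card {v. (\<forall>i. v i \<in> K) \<and> F v} = card (PiE R (\<lambda>_. K))"
  proof (rule bij_betw_same_card, rule bij_betwI[where f = "\<lambda>v. restrict v R" and
        g = "\<lambda>g i. if rep i \<in> R then g (rep i) * b (rep i) i else 0"])
    show "(\<lambda>v. restrict v R) \<in> {v. (\<forall>i. v i \<in> K) \<and> F v} \<rightarrow> PiE R (\<lambda>_. K)" by auto
    show "(\<lambda>g i. if rep i \<in> R then g (rep i) * b (rep i) i else 0) \<in>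
        PiE R (\<lambda>_. K) \<rightarrow> {v. (\<forall>i. v i \<in> K) \<and> F v}"
      using K(2) K(3)[OF b_root] Fb by (auto simp: F_def rep_\<sigma> mult_ac PiE_iff)
    fix v assume "v \<in> {v. (\<forall>i. v i \<in> K) \<and> F v}"
    then have Fv: "F v" by simp
    show "(\<lambda>i. if rep i \<in> R then restrict v R (rep i) * b (rep i) i else 0) = v"
    proof
      fix i
      show "(if rep i \<in> R then restrict v R (rep i) * b (rep i) i else 0) = v i"
        using expand[OF Fv, of i] by (cases "rep i \<in> R") simp_all
    qed
  next
    fix g assume g: "g \<in> PiE R (\<lambda>_. K)"
    show "restrict (\<lambda>i. if rep i \<in> R then g (rep i) * b (rep i) i else 0) R = g"
    proof
      fix x
      have "rep x = x" if "x \<in> R" using that by (simp add: R_def)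
      then show "restrict (\<lambda>i. if rep i \<in> R then g (rep i) * b (rep i) i else 0) R x = g x"
        using PiE_arb[OF g, of x] bx[of x] by (cases "x \<in> R") simp_all
    qed
  qed
  also have "\<dots> = card K ^ card R" by (subst card_PiE) simp_all
  also have "card R = vec.dim (fix_space (mono_mat \<sigma> t))"
  proof (rule vec.dim_unique[symmetric])
    define B where "B x = (\<chi> i. b x i)" for x
    have B_other: "B x $ y = 0" if "y \<in> R" "x \<noteq> y" for x y
      using that by (auto simp: B_def b_def R_def)
    have B_self: "B x $ x = 1" if "x \<in> R" for x using bx[OF that] by (simp add: B_def)
    have inj: "inj_on B R"
    proof (rule inj_onI)
      fix x y assume "x \<in> R" "y \<in> R" "B x = B y"
      then show "x = y" using B_other[of x y] B_self[of x] B_other[of y x] by fastforce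
    qed
    show "B ` R \<subseteq> fix_space (mono_mat \<sigma> t)"
      using Fb by (auto simp: fix_space_mono_mat[OF \<sigma>] B_def)
    show "fix_space (mono_mat \<sigma> t) \<subseteq> vec.span (B ` R)"
    proof
      fix v assume "v \<in> fix_space (mono_mat \<sigma> t)"
      then have Fv: "F (\<lambda>i. v $ i)" by (simp add: fix_space_mono_mat[OF \<sigma>] F_def)
      have "v = (\<Sum>x\<in>R. (v $ x) *s B x)"
      proof (rule vec_eq_iff[THEN iffD2, rule_format])
        fix i
        have "(\<Sum>x\<in>R. (v $ x) *s B x) $ i = (\<Sum>x\<in>R. if x = rep i then v $ x * b x i else 0)"
          unfolding sum_component by (intro sum.cong refl) (auto simp: B_def b_def)
        also have "\<dots> = v $ i" using expand[OF Fv, of i] by simp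
        finally show "v $ i = (\<Sum>x\<in>R. (v $ x) *s B x) $ i" by simp
      qed
      moreover have "(\<Sum>x\<in>R. (v $ x) *s B x) \<in> vec.span (B ` R)"
        by (intro vec.span_sum vec.span_scale vec.span_base) auto
      ultimately show "v \<in> vec.span (B ` R)" by simp
    qed
    show "vec.independent (B ` R)"
    proof (subst vec.dependent_finite)
      show "\<not> (\<exists>u. (\<exists>v\<in>B ` R. u v \<noteq> 0) \<and> (\<Sum>v\<in>B ` R. u v *s v) = 0)"
      proof clarify
        fix u x assume x: "x \<in> R" "u (B x) \<noteq> 0" and "(\<Sum>v\<in>B ` R. u v *s v) = 0"
        then have "0 = (\<Sum>y\<in>R. u (B y) *s B y) $ x" by (simp add: sum.reindex[OF inj])
        also have "\<dots> = (\<Sum>y\<in>R. if y = x then u (B y) else 0)"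
          unfolding sum_component using B_other[OF x(1)] B_self[OF x(1)] by (intro sum.cong refl) auto
        also have "\<dots> = u (B x)" using x by simp
        finally show False using x by simp
      qed
    qed simp
    show "card (B ` R) = card R" by (rule card_image[OF inj])
  qed
  finally show ?thesis unfolding F_def .
qed

section \<open>From monomial matrices to permutations\<close>

definition root_mean :: "nat \<Rightarrow> (complex \<Rightarrow> rat) \<Rightarrow> rat" where
  "root_mean d \<psi> = (\<Sum>z | z ^ d = 1. \<psi> z) / of_nat d"

lemma root_mean_shift:
  assumes "d > 0" "(a :: complex) ^ d = 1"
  shows "root_mean d (\<lambda>z. \<psi> (a * z)) = root_mean d \<psi>"
proof -
  have "bij_betw (\<lambda>z. a * z) {z. z ^ d = 1} {z. z ^ d = 1}"
    using assms root_nonzero[OF assms(2,1)]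
    by (intro bij_betwI[where g = "\<lambda>z. z / a"]) (auto simp: power_mult_distrib power_divide)
  from sum.reindex_bij_betw[OF this, of \<psi>] show ?thesis by (simp add: root_mean_def)
qed

text \<open>Multiplying one entry of \<open>s\<close> inside \<open>Z\<close> by each root of unity
  in turn permutes the vectors and shifts the product, which is therefore equidistributed. An empty
  \<open>Z\<close> leaves the product at 1.\<close>

lemma sum_root_vectors_prod:
  fixes Z :: "'n::finite set"
  assumes d: "d > 0"
  shows "(\<Sum>s\<in>root_vectors d. \<psi> (\<Prod>i\<in>Z. s i)) =
    of_nat (d ^ CARD('n)) * (if Z = {} then \<psi> 1 else root_mean d \<psi>)"
proof (cases "Z = {}")
  case True
  then show ?thesis using card_root_vectors[OF d, where 'n = 'n] by simp
next
  case False
  then obtain z where z: "z \<in> Z" by blast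
  let ?S = "\<Sum>s\<in>(root_vectors d :: ('n \<Rightarrow> complex) set). \<psi> (\<Prod>i\<in>Z. s i)"
  have shift: "?S = (\<Sum>s\<in>root_vectors d. \<psi> ((\<Prod>i\<in>Z. s i) * a))" if a: "a ^ d = 1" for a
  proof -
    have a0: "a \<noteq> 0" using root_nonzero[OF a d] .
    have "bij_betw (\<lambda>s. s(z := s z * a)) (root_vectors d) (root_vectors d :: ('n \<Rightarrow> complex) set)"
      using a a0 by (intro bij_betwI[where g = "\<lambda>s. s(z := s z / a)"])
        (auto simp: power_mult_distrib power_divide fun_eq_iff)
    moreover have "(\<Prod>i\<in>Z. (s(z := s z * a)) i) = (\<Prod>i\<in>Z. s i) * a" for s
      using z by (simp add: prod.remove[of Z z] mult_ac)
    ultimately show ?thesis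
      using sum.reindex_bij_betw[of "\<lambda>s. s(z := s z * a)" "root_vectors d" "root_vectors d"
          "\<lambda>s. \<psi> (\<Prod>i\<in>Z. s i)"] by simp
  qed
  have "of_nat d * ?S = (\<Sum>a | a ^ d = (1::complex). ?S)"
    using d by (simp add: card_complex_roots_unity Suc_le_eq)
  also have "\<dots> = (\<Sum>a | a ^ d = 1. \<Sum>s\<in>root_vectors d. \<psi> ((\<Prod>i\<in>Z. s i) * a))"
    by (rule sum.cong[OF refl], rule shift) simp
  also have "\<dots> = (\<Sum>s\<in>(root_vectors d :: ('n \<Rightarrow> complex) set). \<Sum>a | a ^ d = 1. \<psi> ((\<Prod>i\<in>Z. s i) * a))"
    by (rule sum.swap)
  also have "\<dots> = (\<Sum>s\<in>(root_vectors d :: ('n \<Rightarrow> complex) set). of_nat d * root_mean d \<psi>)"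
  proof (intro sum.cong refl)
    fix s :: "'n \<Rightarrow> complex" assume "s \<in> root_vectors d"
    then have "(\<Prod>i\<in>Z. s i) ^ d = 1" by (simp add: prod_power_distrib)
    from root_mean_shift[OF d this, of \<psi>]
    show "(\<Sum>a | a ^ d = 1. \<psi> ((\<Prod>i\<in>Z. s i) * a)) = of_nat d * root_mean d \<psi>"
      using d by (simp add: root_mean_def field_simps)
  qed
  also have "\<dots> = of_nat d * (of_nat (d ^ CARD('n)) * root_mean d \<psi>)"
    using card_root_vectors[OF d, where 'n = 'n] by simp
  finally show ?thesis using d False by simp
qed

text \<open>A vector with entries in this set is determined by its entrywise absolute values and, where
  these do not vanish, by its entrywise phases.\<close>

definition color_set :: "nat \<Rightarrow> nat \<Rightarrow> complex set" where
  "color_set d j = {of_nat a * z | a z. a \<le> j \<and> z ^ d = 1}"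

lemma norm_root_of_unity:
  assumes "(z::complex) ^ d = 1" "d > 0"
  shows "norm z = 1"
  using assms power_eq_imp_eq_base[of "norm z" d 1] by (simp flip: norm_power)

lemma color_set_props:
  assumes d: "d > 0"
  shows "finite (color_set d j)" "0 \<in> color_set d j"
    "\<And>z k. z ^ d = 1 \<Longrightarrow> k \<in> color_set d j \<Longrightarrow> z * k \<in> color_set d j"
    "card (color_set d j) = 1 + d * j"
proof -
  let ?E = "{z::complex. z ^ d = 1}"
  have finE: "finite ?E" using finite_roots_of_unity[OF d] .
  have img: "color_set d j = (\<lambda>(a, z). of_nat a * z) ` ({..j} \<times> ?E)"
    by (auto simp: color_set_def)
  then show "finite (color_set d j)" using finE by simp
  show zero: "0 \<in> color_set d j"
    unfolding color_set_def by (auto intro!: exI[of _ "0::nat"] exI[of _ "1::complex"])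
  show "z * k \<in> color_set d j" if z: "z ^ d = 1" and k: "k \<in> color_set d j" for z k
  proof -
    obtain a w where "k = of_nat a * w" "a \<le> j" "w ^ d = 1" using k unfolding color_set_def by blast
    then have "z * k = of_nat a * (z * w)" "(z * w) ^ d = 1" using z by (simp_all add: power_mult_distrib)
    then show ?thesis using \<open>a \<le> j\<close> unfolding color_set_def by blast
  qed
  have norm1: "norm z = 1" if "z ^ d = 1" for z :: complex
    using norm_root_of_unity[OF that d] .
  \<comment> \<open>The element 0 arises with every phase, so it is split off; on the rest, modulus
    and phase are determined.\<close>
  have eq: "color_set d j = insert 0 ((\<lambda>(a, z). of_nat a * z) ` ({1..j} \<times> ?E))"
  proof
    show "color_set d j \<subseteq> insert 0 ((\<lambda>(a, z). of_nat a * z) ` ({1..j} \<times> ?E))"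
    proof
      fix k assume "k \<in> color_set d j"
      then obtain a z where k: "k = of_nat a * z" "a \<le> j" "z ^ d = 1" unfolding color_set_def by blast
      show "k \<in> insert 0 ((\<lambda>(a, z). of_nat a * z) ` ({1..j} \<times> ?E))"
        using k by (cases "a = 0") (auto intro!: image_eqI[of _ _ "(a, z)"])
    qed
    show "insert 0 ((\<lambda>(a, z). of_nat a * z) ` ({1..j} \<times> ?E)) \<subseteq> color_set d j"
    proof -
      have "(\<lambda>(a, z). of_nat a * z) ` ({1..j} \<times> ?E) \<subseteq> color_set d j"
        unfolding img by (rule image_mono) auto
      then show ?thesis using zero by blast
    qed
  qed
  have "inj_on (\<lambda>(a, z). of_nat a * z :: complex) ({1..j} \<times> ?E)"
  proof (rule inj_onI, clarify)
    fix a b :: nat and z w :: complex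
    assume *: "a \<in> {1..j}" "z ^ d = 1" "w ^ d = 1" "of_nat a * z = of_nat b * w"
    then have "norm (of_nat a * z) = norm (of_nat b * w)" by simp
    then have "a = b" using norm1[OF *(2)] norm1[OF *(3)] by (simp add: norm_mult)
    then show "a = b \<and> z = w" using * by simp
  qed
  then have "card ((\<lambda>(a, z). of_nat a * z :: complex) ` ({1..j} \<times> ?E)) = j * d"
    using d by (simp add: card_image card_cartesian_product card_complex_roots_unity Suc_le_eq)
  moreover have "0 \<notin> (\<lambda>(a, z). of_nat a * z :: complex) ` ({1..j} \<times> ?E)"
    using root_nonzero[OF _ d] by auto
  ultimately show "card (color_set d j) = 1 + d * j"
    unfolding eq using finE by simp
qed

text \<open>Here \<open>m\<close> records the moduli of \<open>v\<close>, which are constant along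
  \<open>\<sigma>\<close>, and \<open>s\<close> records its phases. Where \<open>v\<close> is
  nonzero, the phases force \<open>t i = s (\<sigma> i) / s i\<close>. Where \<open>v\<close>
  vanishes there is no phase and \<open>t i\<close> is free, so \<open>s i\<close> stores
  \<open>t i\<close> itself and no information is lost.\<close>

lemma bij_betw_colored_fixed_vectors:
  fixes \<sigma> :: "'n::finite \<Rightarrow> 'n"
  assumes d: "d > 0"
  shows "bij_betw (\<lambda>(m, s). (\<lambda>i. if m i = 0 then s i else s (\<sigma> i) / s i, \<lambda>i. of_nat (m i) * s i))
    ({m. (\<forall>i. m i < Suc j) \<and> m \<circ> \<sigma> = m} \<times> root_vectors d)
    {(t, v). t \<in> root_vectors d \<and> (\<forall>i. v i \<in> color_set d j) \<and> (\<forall>i. v (\<sigma> i) = t i * v i)}"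
  (is "bij_betw ?f ?A ?B")
proof (rule bij_betwI[where g = "\<lambda>(t, v). (\<lambda>i. nat \<lfloor>norm (v i)\<rfloor>, \<lambda>i. if v i = 0 then t i else v i / of_real (norm (v i)))"])
  have nz: "z \<noteq> 0" if "z ^ d = 1" for z :: complex using root_nonzero[OF that d] .
  have norm1: "norm z = 1" if "z ^ d = 1" for z :: complex using norm_root_of_unity[OF that d] .
  let ?g = "\<lambda>(t, v). (\<lambda>i. nat \<lfloor>norm (v i)\<rfloor>, \<lambda>i. if v i = 0 then t i else v i / of_real (norm (v i)))"
  show "?f \<in> ?A \<rightarrow> ?B"
  proof
    fix x assume x: "x \<in> ?A"
    obtain m s where xms: "x = (m, s)" by (cases x)
    have m: "\<forall>i. m i < Suc j" "m \<circ> \<sigma> = m" and s: "\<forall>i. s i ^ d = 1" using x by (auto simp: xms)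
    have m\<sigma>: "m (\<sigma> i) = m i" for i using m(2) by (metis comp_apply)
    have "(if m i = 0 then s i else s (\<sigma> i) / s i) ^ d = 1" for i
      using s by (simp add: power_divide)
    moreover have "of_nat (m i) * s i \<in> color_set d j" for i
      using m(1) s unfolding color_set_def by (blast intro: less_Suc_eq_le[THEN iffD1])
    moreover have "of_nat (m (\<sigma> i)) * s (\<sigma> i) =
        (if m i = 0 then s i else s (\<sigma> i) / s i) * (of_nat (m i) * s i)" for i
      using nz s by (simp add: m\<sigma>)
    ultimately show "?f x \<in> ?B" by (simp add: xms)
  qed
  have norm_color: "\<exists>a\<le>j. norm k = of_nat a \<and> (k \<noteq> 0 \<longrightarrow> (k / of_real (norm k)) ^ d = 1)"
    if "k \<in> color_set d j" for k
  proof -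
    obtain a z where k: "k = of_nat a * z" "a \<le> j" "z ^ d = 1"
      using \<open>k \<in> color_set d j\<close> unfolding color_set_def by blast
    have "norm k = of_nat a" using norm1[OF k(3)] by (simp add: k(1) norm_mult)
    moreover from this have "k / of_real (norm k) = z" if "k \<noteq> 0" using that k(1) by simp
    ultimately show ?thesis using k by auto
  qed
  show "?g \<in> ?B \<rightarrow> ?A"
  proof
    fix y assume y: "y \<in> ?B"
    obtain t v where ytv: "y = (t, v)" by (cases y)
    have t: "\<forall>i. t i ^ d = 1" and v: "\<forall>i. v i \<in> color_set d j" and fixed: "\<forall>i. v (\<sigma> i) = t i * v i"
      using y by (auto simp: ytv)
    have "nat \<lfloor>norm (v i)\<rfloor> < Suc j" for i
      using norm_color[of "v i"] v by auto
    moreover have "norm (v (\<sigma> i)) = norm (v i)" for i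
      using fixed norm1[of "t i"] t by (simp add: norm_mult)
    moreover have "(if v i = 0 then t i else v i / of_real (norm (v i))) ^ d = 1" for i
      using t norm_color[of "v i"] v by auto
    ultimately show "?g y \<in> ?A" by (simp add: ytv fun_eq_iff)
  qed
  show "?g (?f x) = x" if "x \<in> ?A" for x
  proof -
    obtain m s where x: "x = (m, s)" by (cases x)
    have s: "s i \<noteq> 0" "norm (s i) = 1" for i using that nz norm1 by (auto simp: x)
    then show ?thesis by (auto simp: x fun_eq_iff norm_mult)
  qed
  show "?f (?g y) = y" if "y \<in> ?B" for y
  proof -
    obtain t v where y: "y = (t, v)" by (cases y)
    have t: "t i ^ d = 1" and v: "v i \<in> color_set d j" and fixed: "v (\<sigma> i) = t i * v i" for i
      using that by (auto simp: y)
    have N: "real (nat \<lfloor>norm (v i)\<rfloor>) = norm (v i)" for i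
    proof -
      obtain a where "norm (v i) = real a" using norm_color[OF v[of i]] by blast
      then show ?thesis by simp
    qed
    have N0: "nat \<lfloor>norm (v i)\<rfloor> = 0 \<longleftrightarrow> v i = 0" for i
      using N[of i] by (metis norm_eq_zero of_nat_eq_0_iff)
    have N': "complex_of_nat (nat \<lfloor>norm (v i)\<rfloor>) = complex_of_real (norm (v i))" for i
      using N[of i] by (metis of_real_of_nat_eq)
    have "(if nat \<lfloor>norm (v i)\<rfloor> = 0 then if v i = 0 then t i else v i / of_real (norm (v i))
        else (if v (\<sigma> i) = 0 then t (\<sigma> i) else v (\<sigma> i) / of_real (norm (v (\<sigma> i)))) /
          (if v i = 0 then t i else v i / of_real (norm (v i)))) = t i" for i
      unfolding N0 by (simp add: fixed norm_mult norm1[OF t] nz[OF t])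
    moreover have "of_nat (nat \<lfloor>norm (v i)\<rfloor>) * (if v i = 0 then t i else v i / of_real (norm (v i))) = v i" for i
      unfolding N' by simp
    ultimately show ?thesis unfolding y prod.case by (simp only:)
  qed
qed

text \<open>After the change of variables only the zeros of \<open>m\<close> contribute to the
  product of the entries. If there are any, \<open>\<psi>\<close> is averaged; if there are none,
  the product is 1 and \<open>m - 1\<close> is an invariant coloring with \<open>j\<close>
  colors.\<close>

lemma weight_sum:
  fixes \<sigma> :: "'n::finite \<Rightarrow> 'n"
  assumes d: "d > 0" and \<sigma>: "\<sigma> permutes UNIV"
  shows "(\<Sum>t\<in>root_vectors d. (1 + of_nat (d * j)) ^ vec.dim (fix_space (mono_mat \<sigma> t)) * \<psi> (\<Prod>i\<in>UNIV. t i)) =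
    of_nat (d ^ CARD('n)) * (of_nat (invariant_colorings (Suc j) \<sigma>) * root_mean d \<psi> +
      of_nat (invariant_colorings j \<sigma>) * (\<psi> 1 - root_mean d \<psi>))"
proof -
  let ?V = "PiE (UNIV :: 'n set) (\<lambda>_. color_set d j)"
  let ?M = "{m. (\<forall>i. m i < Suc j) \<and> m \<circ> \<sigma> = m}"
  note K = color_set_props[OF d, where j = j]
  have finV: "finite ?V" using K(1) by (intro finite_PiE) auto
  have finM: "finite ?M"
    by (rule finite_subset[of _ "PiE UNIV (\<lambda>_. {..<Suc j})"]) (auto intro: finite_PiE)
  have w: "(1 + of_nat (d * j)) ^ vec.dim (fix_space (mono_mat \<sigma> t)) =
      (rat_of_nat (card {v. (\<forall>i. v i \<in> color_set d j) \<and> (\<forall>i. v (\<sigma> i) = t i * v i)}))"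
    if "t \<in> root_vectors d" for t
    using monomial_fixed_vectors[OF d \<sigma> that K(1-3)] K(4) by simp
  have "(\<Sum>t\<in>root_vectors d. (1 + of_nat (d * j)) ^ vec.dim (fix_space (mono_mat \<sigma> t)) * \<psi> (\<Prod>i\<in>UNIV. t i)) =
      (\<Sum>t\<in>root_vectors d. \<Sum>v | (\<forall>i. v i \<in> color_set d j) \<and> (\<forall>i. v (\<sigma> i) = t i * v i). \<psi> (\<Prod>i\<in>UNIV. t i))"
    by (intro sum.cong refl) (simp only: w sum_constant)
  also have "\<dots> = (\<Sum>(t, v)\<in>{(t, v). t \<in> root_vectors d \<and> (\<forall>i. v i \<in> color_set d j) \<and> (\<forall>i. v (\<sigma> i) = t i * v i)}.
      \<psi> (\<Prod>i\<in>UNIV. t i))"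
  proof (subst sum.Sigma)
    show "finite (root_vectors d :: ('n \<Rightarrow> complex) set)" by (rule finite_root_vectors[OF d])
    show "\<forall>t\<in>root_vectors d. finite {v. (\<forall>i. v i \<in> color_set d j) \<and> (\<forall>i. v (\<sigma> i) = t i * v i)}"
      by (auto intro: finite_subset[OF _ finV])
  qed (rule sum.cong, auto)
  also have "\<dots> = (\<Sum>(m, s)\<in>?M \<times> root_vectors d. \<psi> (\<Prod>i\<in>UNIV. if m i = 0 then s i else s (\<sigma> i) / s i))"
    using sum.reindex_bij_betw[OF bij_betw_colored_fixed_vectors[OF d, where j = j and \<sigma> = \<sigma>],
        of "\<lambda>(t, v). \<psi> (\<Prod>i\<in>UNIV. t i)"]
    by (simp add: case_prod_unfold)
  also have "\<dots> = (\<Sum>m\<in>?M. \<Sum>s\<in>root_vectors d. \<psi> (\<Prod>i | m i = 0. s i))"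
  proof (subst sum.cartesian_product[symmetric], intro sum.cong refl arg_cong[where f = \<psi>])
    fix m and s :: "'n \<Rightarrow> complex" assume "m \<in> ?M" and s: "s \<in> root_vectors d"
    then have m: "m (\<sigma> i) = m i" for i by (auto simp: fun_eq_iff)
    have nz: "s i \<noteq> 0" for i using s root_nonzero[OF _ d] by auto
    \<comment> \<open>Since \<open>\<sigma>\<close> permutes the support of \<open>m\<close>, the
      quotients \<open>s (\<sigma> i) / s i\<close> over it cancel to 1.\<close>
    have "bij_betw \<sigma> {i. m i \<noteq> 0} {i. m i \<noteq> 0}"
    proof (rule bij_betw_imageI)
      show "inj_on \<sigma> {i. m i \<noteq> 0}" using permutes_inj[OF \<sigma>] by (rule inj_on_subset) simp
      show "\<sigma> ` {i. m i \<noteq> 0} = {i. m i \<noteq> 0}"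
        using m permutes_surj[OF \<sigma>] by (auto simp: image_iff) (metis surjD m)
    qed
    from prod.reindex_bij_betw[OF this, of s]
    have "(\<Prod>i | m i \<noteq> 0. s (\<sigma> i) / s i) = 1"
      using nz by (simp add: prod_dividef)
    moreover have "(\<Prod>i\<in>UNIV. if m i = 0 then s i else s (\<sigma> i) / s i) =
        (\<Prod>i | m i = 0. s i) * (\<Prod>i | m i \<noteq> 0. s (\<sigma> i) / s i)"
    proof -
      have "- {i. m i = 0} = {i. m i \<noteq> 0}" by auto
      then show ?thesis
        using prod.If_cases[of UNIV "\<lambda>i. m i = 0" s "\<lambda>i. s (\<sigma> i) / s i"] by (simp only: Int_UNIV_left finite)
    qed
    ultimately show "(\<Prod>i\<in>UNIV. if m i = 0 then s i else s (\<sigma> i) / s i) = (\<Prod>i | m i = 0. s i)" by simp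
  qed
  also have "\<dots> = (\<Sum>m\<in>?M. of_nat (d ^ CARD('n)) *
      (root_mean d \<psi> + of_bool (\<forall>i. m i \<noteq> 0) * (\<psi> 1 - root_mean d \<psi>)))"
    unfolding sum_root_vectors_prod[OF d] by (intro sum.cong refl) auto
  also have "\<dots> = of_nat (d ^ CARD('n)) * (of_nat (card ?M) * root_mean d \<psi> +
      of_nat (card (?M \<inter> {m. \<forall>i. m i \<noteq> 0})) * (\<psi> 1 - root_mean d \<psi>))"
    using finM by (simp add: sum_distrib_left[symmetric] sum.distrib sum_distrib_right[symmetric] sum_of_bool_eq)
  also have "card ?M = invariant_colorings (Suc j) \<sigma>" by (simp add: invariant_colorings_def)
  also have "card (?M \<inter> {m. \<forall>i. m i \<noteq> 0}) = invariant_colorings j \<sigma>"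
    unfolding invariant_colorings_def
  proof (rule bij_betw_same_card, rule bij_betwI[where f = "\<lambda>m i. m i - 1" and g = "\<lambda>m i. Suc (m i)"])
    show "(\<lambda>m i. m i - 1) \<in> ?M \<inter> {m. \<forall>i. m i \<noteq> 0} \<rightarrow> {f. (\<forall>x. f x < j) \<and> f \<circ> \<sigma> = f}"
    proof
      fix m assume "m \<in> ?M \<inter> {m. \<forall>i. m i \<noteq> 0}"
      then have m: "m i < Suc j" "m (\<sigma> i) = m i" "m i \<noteq> 0" for i by (auto simp: fun_eq_iff)
      have "m i - 1 < j" for i using m(1,3)[of i] by linarith
      then show "(\<lambda>i. m i - 1) \<in> {f. (\<forall>x. f x < j) \<and> f \<circ> \<sigma> = f}" by (simp add: fun_eq_iff m(2))
    qed
    show "(\<lambda>m i. Suc (m i)) \<in> {f. (\<forall>x. f x < j) \<and> f \<circ> \<sigma> = f} \<rightarrow> ?M \<inter> {m. \<forall>i. m i \<noteq> 0}"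
      by (auto simp: fun_eq_iff)
  qed (simp_all add: fun_eq_iff)
  finally show ?thesis .
qed

abbreviation fix_weight :: "nat \<Rightarrow> nat \<Rightarrow> complex ^ 'n ^ 'n::finite \<Rightarrow> rat" where
  "fix_weight d j A \<equiv> (1 + of_nat (d * j)) ^ vec.dim (fix_space A)"

text \<open>A letter acts on the mean of \<open>\<psi>\<close> through colorings with
  \<open>j + 1\<close> colors and on the deviation \<open>\<psi> 1 - root_mean d \<psi>\<close>
  through colorings with \<open>j\<close> colors, and the two parts never mix. \<open>D\<close> and
  \<open>\<psi>\<close> are general in the induction because the first letter translates
  both.\<close>

lemma word_sum_pushforward:
  fixes D :: "('n::finite \<Rightarrow> 'n) \<Rightarrow> rat"
  assumes d: "d > 0"
  shows "word_sum (carrier (Gd1n d)) (**) (mat 1) (fix_weight d) js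
      (\<lambda>A. D (perm_of A) * \<psi> (color_of A)) =
    of_nat (d ^ (CARD('n) * length js)) *
    (word_sum {p. p permutes UNIV} (\<circ>) id (\<lambda>y \<tau>. of_nat (invariant_colorings y \<tau>)) (map Suc js) D * root_mean d \<psi> +
     word_sum {p. p permutes UNIV} (\<circ>) id (\<lambda>y \<tau>. of_nat (invariant_colorings y \<tau>)) js D * (\<psi> 1 - root_mean d \<psi>))"
proof (induction js arbitrary: D \<psi>)
  case Nil
  have one: "perm_of (mat 1 :: complex ^ 'n ^ 'n) = id" "color_of (mat 1 :: complex ^ 'n ^ 'n) = 1"
    using perm_of_mono_mat[of "\<lambda>_. 1" id] color_of_mono_mat[of "\<lambda>_. 1" id] by (simp_all add: mono_mat_id)
  have split: "a * b = a * m + a * (b - m)" for a b m :: rat by (simp add: algebra_simps)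
  show ?case
    unfolding list.map word_sum.simps one list.size mult_0_right power_0 of_nat_1 mult_1 by (rule split)
next
  case (Cons j js)
  let ?WG = "word_sum (carrier (Gd1n d :: 'n cmat_group)) (**) (mat 1) (fix_weight d) js"
  let ?WS = "word_sum {p :: 'n \<Rightarrow> 'n. p permutes UNIV} (\<circ>) id (\<lambda>y \<tau>. of_nat (invariant_colorings y \<tau>))"
  let ?k = "of_nat (d ^ (CARD('n) * length js)) :: rat" and ?\<mu> = "root_mean d \<psi>"
  define a where "a \<sigma> = ?WS (map Suc js) (\<lambda>\<tau>. D (\<sigma> \<circ> \<tau>))" for \<sigma>
  define b where "b \<sigma> = ?WS js (\<lambda>\<tau>. D (\<sigma> \<circ> \<tau>))" for \<sigma>
  have one: "mat 1 \<in> carrier (Gd1n d :: 'n cmat_group)"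
    using mono_mat_in_carrier[OF d permutes_id, of "\<lambda>_. 1"] by (simp add: mono_mat_id)
  have step: "?WG (\<lambda>B. D (perm_of (mono_mat \<sigma> t ** B)) * \<psi> (color_of (mono_mat \<sigma> t ** B))) =
      ?k * (a \<sigma> * ?\<mu> + b \<sigma> * (\<psi> (\<Prod>i\<in>UNIV. t i) - ?\<mu>))"
    if \<sigma>: "\<sigma> permutes UNIV" and t: "t \<in> root_vectors d" for \<sigma> t
  proof -
    have eq: "?WG (\<lambda>B. D (perm_of (mono_mat \<sigma> t ** B)) * \<psi> (color_of (mono_mat \<sigma> t ** B))) =
        ?WG (\<lambda>B. D (\<sigma> \<circ> perm_of B) * \<psi> ((\<Prod>i\<in>UNIV. t i) * color_of B))"
    proof (rule word_sum_cong[OF one])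
      fix A B assume A: "A \<in> carrier (Gd1n d :: 'n cmat_group)" and B: "B \<in> carrier (Gd1n d :: 'n cmat_group)"
      then show "A ** B \<in> carrier (Gd1n d)"
        using carrier_Gd1n_iff[OF d, of A] perm_color_mult(3)[OF d _ _ _ B] by blast
    qed (simp add: perm_color_mult(1,2)[OF d refl \<sigma> t])
    have root: "(\<Prod>i\<in>UNIV. t i) ^ d = 1" using t by (simp add: prod_power_distrib)
    show ?thesis
      unfolding eq Cons.IH[of "\<lambda>\<tau>. D (\<sigma> \<circ> \<tau>)" "\<lambda>z. \<psi> ((\<Prod>i\<in>UNIV. t i) * z)"]
        root_mean_shift[OF d root] mult_1_right a_def b_def ..
  qed
  have const: "root_mean d (\<lambda>_. 1) = 1"
    using d by (simp add: root_mean_def card_complex_roots_unity Suc_le_eq)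
  have "word_sum (carrier (Gd1n d)) (**) (mat 1) (fix_weight d) (j # js) (\<lambda>A. D (perm_of A) * \<psi> (color_of A)) =
      (\<Sum>\<sigma> | \<sigma> permutes UNIV. \<Sum>t\<in>root_vectors d. fix_weight d j (mono_mat \<sigma> t) *
        (?k * (a \<sigma> * ?\<mu> + b \<sigma> * (\<psi> (\<Prod>i\<in>UNIV. t i) - ?\<mu>))))"
    unfolding word_sum.simps sum_carrier_Gd1n[OF d]
    by (intro sum.cong refl arg_cong2[where f = "(*)"] step) simp_all
  \<comment> \<open>Each summand is affine in the value of \<open>\<psi>\<close>;
    \<open>weight_sum\<close> handles its constant part with the function 1 and its linear part with
    \<open>\<psi>\<close> itself.\<close>
  also have "\<dots> = (\<Sum>\<sigma> | \<sigma> permutes UNIV.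
      ?k * (a \<sigma> * ?\<mu> - b \<sigma> * ?\<mu>) *
        (\<Sum>t\<in>root_vectors d. fix_weight d j (mono_mat \<sigma> t) * 1) +
      ?k * b \<sigma> *
        (\<Sum>t\<in>root_vectors d. fix_weight d j (mono_mat \<sigma> t) * \<psi> (\<Prod>i\<in>UNIV. t i)))"
    unfolding sum_distrib_left sum.distrib[symmetric]
    by (intro sum.cong refl) (simp add: algebra_simps)
  also have "\<dots> = (\<Sum>\<sigma> | \<sigma> permutes UNIV. of_nat (d ^ CARD('n)) * ?k *
      (of_nat (invariant_colorings (Suc j) \<sigma>) * a \<sigma> * ?\<mu> +
       of_nat (invariant_colorings j \<sigma>) * b \<sigma> * (\<psi> 1 - ?\<mu>)))"
  proof (intro sum.cong refl)
    fix \<sigma> :: "'n \<Rightarrow> 'n" assume "\<sigma> \<in> {\<sigma>. \<sigma> permutes UNIV}"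
    then have \<sigma>: "\<sigma> permutes UNIV" by simp
    show "?k * (a \<sigma> * ?\<mu> - b \<sigma> * ?\<mu>) *
        (\<Sum>t\<in>root_vectors d. fix_weight d j (mono_mat \<sigma> t) * 1) +
      ?k * b \<sigma> *
        (\<Sum>t\<in>root_vectors d. fix_weight d j (mono_mat \<sigma> t) * \<psi> (\<Prod>i\<in>UNIV. t i)) =
      of_nat (d ^ CARD('n)) * ?k *
      (of_nat (invariant_colorings (Suc j) \<sigma>) * a \<sigma> * ?\<mu> +
       of_nat (invariant_colorings j \<sigma>) * b \<sigma> * (\<psi> 1 - ?\<mu>))"
      unfolding weight_sum[OF d \<sigma>, of j "\<lambda>_. 1"] weight_sum[OF d \<sigma>, of j \<psi>] const
      by (simp add: algebra_simps)
  qed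
  also have "\<dots> = of_nat (d ^ CARD('n)) * ?k *
      ((\<Sum>\<sigma> | \<sigma> permutes UNIV. of_nat (invariant_colorings (Suc j) \<sigma>) * a \<sigma>) * ?\<mu> +
       (\<Sum>\<sigma> | \<sigma> permutes UNIV. of_nat (invariant_colorings j \<sigma>) * b \<sigma>) * (\<psi> 1 - ?\<mu>))"
    unfolding sum_distrib_left[symmetric] sum.distrib sum_distrib_right[symmetric] ..
  also have "of_nat (d ^ CARD('n)) * ?k = of_nat (d ^ (CARD('n) * length (j # js)))"
    by (simp add: power_add)
  finally show ?case unfolding list.map word_sum.simps a_def b_def .
qed

section \<open>Coxeter elements\<close>

lemma Gd1n_simps [simp]: "monoid.mult (Gd1n d) = (**)" "one (Gd1n d) = mat 1"
  by (simp_all add: Gd1n_def)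

lemma group_Gd1n:
  assumes d: "d > 0"
  shows "group (Gd1n d :: 'n::finite cmat_group)"
proof (rule groupI)
  fix A B :: "complex ^ 'n ^ 'n"
  assume A: "A \<in> carrier (Gd1n d)" and B: "B \<in> carrier (Gd1n d)"
  then show "A \<otimes>\<^bsub>Gd1n d\<^esub> B \<in> carrier (Gd1n d)"
    using carrier_Gd1n_iff[OF d, of A] perm_color_mult(3)[OF d _ _ _ B] by auto
next
  show "\<one>\<^bsub>Gd1n d\<^esub> \<in> carrier (Gd1n d :: 'n cmat_group)"
    using mono_mat_in_carrier[OF d permutes_id, of "\<lambda>_. 1"] by (simp add: mono_mat_id)
next
  fix A :: "complex ^ 'n ^ 'n" assume "A \<in> carrier (Gd1n d)"
  then obtain \<sigma> t where A: "A = mono_mat \<sigma> t" and \<sigma>: "\<sigma> permutes UNIV" and t: "t \<in> root_vectors d"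
    using carrier_Gd1n_iff[OF d] by blast
  define s where "s i = 1 / t (perm_inv \<sigma> i)" for i
  have "s \<in> root_vectors d" using t by (simp add: s_def power_divide)
  then have "mono_mat (perm_inv \<sigma>) s \<in> carrier (Gd1n d)"
    by (rule mono_mat_in_carrier[OF d permutes_inv[OF \<sigma>]])
  moreover have "(\<lambda>j. s (\<sigma> j) * t j) = (\<lambda>_. 1)"
    using t root_nonzero[OF _ d] by (auto simp: s_def permutes_inverses[OF \<sigma>])
  then have "mono_mat (perm_inv \<sigma>) s ** A = mat 1"
    unfolding A mono_mat_mult permutes_inv_o(2)[OF \<sigma>] by (simp only: mono_mat_id)
  ultimately show "\<exists>y\<in>carrier (Gd1n d). y \<otimes>\<^bsub>Gd1n d\<^esub> A = \<one>\<^bsub>Gd1n d\<^esub>" by auto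
qed (simp_all add: matrix_mul_assoc)

section \<open>Full cycles and their conjugacy\<close>

lemma funpow_return:
  fixes \<sigma> :: "'n::finite \<Rightarrow> 'n"
  assumes \<sigma>: "\<sigma> permutes UNIV"
  obtains s where "0 < s" "s \<le> CARD('n)" "(\<sigma> ^^ s) x = x"
proof -
  have "\<not> inj_on (\<lambda>k. (\<sigma> ^^ k) x) {..CARD('n)}"
  proof
    assume "inj_on (\<lambda>k. (\<sigma> ^^ k) x) {..CARD('n)}"
    then have "card {..CARD('n)} \<le> CARD('n)" by (rule card_inj_on_le) auto
    then show False by simp
  qed
  then obtain a b where ab: "a < b" "b \<le> CARD('n)" "(\<sigma> ^^ a) x = (\<sigma> ^^ b) x"
    by (auto simp: inj_on_def) (metis nat_neq_iff)
  have "(\<sigma> ^^ a) ((\<sigma> ^^ (b - a)) x) = (\<sigma> ^^ (a + (b - a))) x" by (simp add: funpow_add)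
  also have "\<dots> = (\<sigma> ^^ a) x" using ab by simp
  finally have "(\<sigma> ^^ (b - a)) x = x"
    using inj_fn[OF permutes_inj[OF \<sigma>], of a] by (simp add: inj_eq)
  then show ?thesis using ab that[of "b - a"] by simp
qed

lemma full_cycle_enumeration:
  fixes \<sigma> :: "'n::finite \<Rightarrow> 'n"
  assumes \<sigma>: "\<sigma> permutes UNIV" and full: "is_full_cycle r \<sigma>"
  shows "bij_betw (\<lambda>k. (\<sigma> ^^ k) r) {..<CARD('n)} UNIV" "(\<sigma> ^^ CARD('n)) r = r"
proof -
  obtain s where s: "0 < s" "s \<le> CARD('n)" "(\<sigma> ^^ s) r = r" using funpow_return[OF \<sigma>] by blast
  have surj: "(\<lambda>k. (\<sigma> ^^ k) r) ` {..<s} = UNIV"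
  proof -
    have "x \<in> (\<lambda>k. (\<sigma> ^^ k) r) ` {..<s}" for x
    proof -
      obtain k where "r = (\<sigma> ^^ k) x" using full by (metis is_full_cycle_def)
      then obtain l where "x = (\<sigma> ^^ l) r" using funpow_permutes_symmetric[OF \<sigma>] by blast
      then have "x = (\<sigma> ^^ (l mod s)) r" using funpow_mod_eq[OF s(3)] by simp
      then show ?thesis using s(1) by auto
    qed
    then show ?thesis by auto
  qed
  have "CARD('n) \<le> s" using card_image_le[of "{..<s}" "\<lambda>k. (\<sigma> ^^ k) r"] by (simp add: surj)
  then have "s = CARD('n)" using s by simp
  then show "bij_betw (\<lambda>k. (\<sigma> ^^ k) r) {..<CARD('n)} UNIV" "(\<sigma> ^^ CARD('n)) r = r"
    using surj s by (auto simp: bij_betw_def intro!: eq_card_imp_inj_on)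
qed

lemma prod_full_cycle:
  fixes \<sigma> :: "'n::finite \<Rightarrow> 'n" and t :: "'n \<Rightarrow> complex"
  assumes "\<sigma> permutes UNIV" "is_full_cycle r \<sigma>"
  shows "(\<Prod>m<CARD('n). t ((\<sigma> ^^ m) r)) = (\<Prod>i\<in>UNIV. t i)"
  using prod.reindex_bij_betw[OF full_cycle_enumeration(1)[OF assms], of t] by simp

text \<open>Walk along both cycles from \<open>r\<close>: \<open>\<pi>\<close> matches the points
  reached after \<open>k\<close> steps, and \<open>u\<close> is the ratio of the entries accumulated
  so far.\<close>

lemma full_cycles_conjugate:
  fixes \<sigma> \<sigma>' :: "'n::finite \<Rightarrow> 'n"
  assumes d: "d > 0"
    and \<sigma>: "\<sigma> permutes UNIV" "is_full_cycle r \<sigma>" and t: "t \<in> root_vectors d"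
    and \<sigma>': "\<sigma>' permutes UNIV" "is_full_cycle r \<sigma>'" and t': "t' \<in> root_vectors d"
    and prod: "(\<Prod>i\<in>UNIV. t i) = (\<Prod>i\<in>UNIV. t' i)"
  shows "\<exists>h\<in>carrier (Gd1n d). h ** mono_mat \<sigma> t = mono_mat \<sigma>' t' ** h"
proof -
  let ?n = "CARD('n)"
  note enum = full_cycle_enumeration[OF \<sigma>] and enum' = full_cycle_enumeration[OF \<sigma>']
  define idx where "idx = inv_into {..<?n} (\<lambda>k. (\<sigma> ^^ k) r)"
  define T where "T k = (\<Prod>m<k. t ((\<sigma> ^^ m) r))" for k
  define T' where "T' k = (\<Prod>m<k. t' ((\<sigma>' ^^ m) r))" for k
  define \<pi> where "\<pi> x = (\<sigma>' ^^ idx x) r" for x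
  define u where "u x = T' (idx x) / T (idx x)" for x
  have nz: "t i \<noteq> 0" "t' i \<noteq> 0" for i using t t' root_nonzero[OF _ d] by auto
  have Tnz: "T k \<noteq> 0" "T' k \<noteq> 0" for k by (simp_all add: T_def T'_def nz)
  have Tn: "T ?n = T' ?n" unfolding T_def T'_def prod_full_cycle[OF \<sigma>] prod_full_cycle[OF \<sigma>'] by (rule prod)
  have idx: "idx ((\<sigma> ^^ k) r) = k" if "k < ?n" for k
    unfolding idx_def using bij_betw_inv_into_left[OF enum(1)] that by simp
  have onto: "\<exists>k<?n. x = (\<sigma> ^^ k) r" for x
  proof -
    have "x \<in> (\<lambda>k. (\<sigma> ^^ k) r) ` {..<?n}" using enum(1) by (simp add: bij_betw_def)
    then show ?thesis by auto
  qed
  have "bij \<pi>"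
  proof -
    have "bij_betw idx UNIV {..<?n}" unfolding idx_def by (rule bij_betw_inv_into[OF enum(1)])
    from bij_betw_trans[OF this enum'(1)] show ?thesis by (simp add: \<pi>_def[abs_def] o_def)
  qed
  then have \<pi>: "\<pi> permutes UNIV" by (simp add: permutes_univ bij_iff)
  have u: "u \<in> root_vectors d"
    using t t' by (simp add: u_def T_def T'_def power_divide prod_power_distrib)
  have step: "\<pi> (\<sigma> x) = \<sigma>' (\<pi> x) \<and> u (\<sigma> x) * t x = t' (\<pi> x) * u x" for x
  proof -
    obtain k where k: "k < ?n" "x = (\<sigma> ^^ k) r" using onto by blast
    have ix: "idx x = k" using idx[OF k(1)] k(2) by simp
    have \<sigma>x: "\<sigma> x = (\<sigma> ^^ Suc k) r" by (simp add: k(2))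
    have TS: "T (Suc k) = T k * t x" "T' (Suc k) = T' k * t' (\<pi> x)"
      by (simp_all add: T_def T'_def k(2) \<pi>_def idx[OF k(1)])
    show ?thesis
    proof (cases "Suc k < ?n")
      case True
      then have "idx (\<sigma> x) = Suc k" unfolding \<sigma>x by (rule idx)
      then show ?thesis using Tnz[of k] nz by (simp add: \<pi>_def u_def ix TS[unfolded \<pi>_def ix])
    next
      \<comment> \<open>The step that closes the cycle; only here must the total products
        agree.\<close>
      case False
      then have n: "?n = Suc k" using k(1) by simp
      have "\<sigma> x = (\<sigma> ^^ 0) r" unfolding \<sigma>x n[symmetric] enum(2) by simp
      then have "idx (\<sigma> x) = 0" using idx[of 0] by simp
      moreover have "\<sigma>' (\<pi> x) = r" using enum'(2) unfolding n by (simp add: \<pi>_def ix)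
      moreover have "T k * t x = T' k * t' (\<pi> x)" using Tn unfolding n TS .
      ultimately show ?thesis using Tnz[of k] by (simp add: \<pi>_def[of "\<sigma> x"] u_def T_def[of 0] T'_def[of 0] ix field_simps)
    qed
  qed
  have "mono_mat \<pi> u ** mono_mat \<sigma> t = mono_mat \<sigma>' t' ** mono_mat \<pi> u"
  proof -
    have "\<pi> \<circ> \<sigma> = \<sigma>' \<circ> \<pi>" "(\<lambda>j. u (\<sigma> j) * t j) = (\<lambda>j. t' (\<pi> j) * u j)" using step by auto
    then show ?thesis unfolding mono_mat_mult by (simp only:)
  qed
  then show ?thesis using mono_mat_in_carrier[OF d \<pi> u] by blast
qed

lemma dim_fix_space_conjugate:
  fixes A h :: "complex ^ 'n ^ 'n::finite"
  assumes "h ** k = mat 1" "k ** h = mat 1"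
  shows "vec.dim (fix_space (h ** A ** k)) = vec.dim (fix_space A)"
proof -
  have inv: "h *v (k *v v) = v" "k *v (h *v v) = v" for v :: "complex ^ 'n"
    using assms by (simp_all add: matrix_vector_mul_assoc)
  have "fix_space (h ** A ** k) = (*v) h ` fix_space A"
  proof
    show "fix_space (h ** A ** k) \<subseteq> (*v) h ` fix_space A"
    proof
      fix v assume "v \<in> fix_space (h ** A ** k)"
      then have "h *v (A *v (k *v v)) = v" by (simp add: fix_space_def matrix_vector_mul_assoc matrix_mul_assoc)
      then have "A *v (k *v v) = k *v v" by (metis inv(2))
      then have "k *v v \<in> fix_space A" by (simp add: fix_space_def)
      then show "v \<in> (*v) h ` fix_space A" by (metis image_eqI inv(1))
    qed
    show "(*v) h ` fix_space A \<subseteq> fix_space (h ** A ** k)"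
      by (auto simp: fix_space_def matrix_vector_mul_assoc[symmetric] inv)
  qed
  moreover have "inj_on ((*v) h) (vec.span (fix_space A))" by (metis inj_onI inv(2))
  ultimately show ?thesis using vec.dim_image_eq[OF matrix_vector_mul_linear_gen] by metis
qed

text \<open>Conjugating every letter by \<open>h\<close> permutes the words, keeps their weights and
  conjugates their product.\<close>

lemma word_sum_conjugate:
  fixes G (structure)
  assumes "group G" and h: "h \<in> carrier G"
    and w: "\<And>j u. u \<in> carrier G \<Longrightarrow> w j (h \<otimes> u \<otimes> inv h) = w j u"
  shows "word_sum (carrier G) (\<otimes>) \<one> w js (\<lambda>g. F (h \<otimes> g \<otimes> inv h)) = word_sum (carrier G) (\<otimes>) \<one> w js F"
proof -
  interpret group G by fact
  have cancel: "inv h \<otimes> (h \<otimes> x) = x" "h \<otimes> (inv h \<otimes> x) = x" if "x \<in> carrier G" for x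
    using h that by (simp_all flip: m_assoc)
  have bij: "bij_betw (\<lambda>u. h \<otimes> u \<otimes> inv h) (carrier G) (carrier G)"
    by (rule bij_betwI[where g = "\<lambda>u. inv h \<otimes> u \<otimes> h"]) (use h in \<open>auto simp: m_assoc cancel\<close>)
  show ?thesis
  proof (induction js arbitrary: F)
    case Nil
    then show ?case using h by simp
  next
    case (Cons j js)
    have "word_sum (carrier G) (\<otimes>) \<one> w js (\<lambda>g. F (h \<otimes> (u \<otimes> g) \<otimes> inv h)) =
        word_sum (carrier G) (\<otimes>) \<one> w js (\<lambda>g. F (h \<otimes> u \<otimes> inv h \<otimes> g))" if u: "u \<in> carrier G" for u
    proof -
      have "word_sum (carrier G) (\<otimes>) \<one> w js (\<lambda>g. F (h \<otimes> (u \<otimes> g) \<otimes> inv h)) =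
          word_sum (carrier G) (\<otimes>) \<one> w js (\<lambda>g. F (h \<otimes> u \<otimes> inv h \<otimes> (h \<otimes> g \<otimes> inv h)))"
      proof (rule word_sum_cong)
        fix g assume g: "g \<in> carrier G"
        show "F (h \<otimes> (u \<otimes> g) \<otimes> inv h) = F (h \<otimes> u \<otimes> inv h \<otimes> (h \<otimes> g \<otimes> inv h))"
          using h u g by (simp add: m_assoc cancel)
      qed auto
      then show ?thesis using Cons.IH[of "\<lambda>x. F (h \<otimes> u \<otimes> inv h \<otimes> x)"] by simp
    qed
    then have "word_sum (carrier G) (\<otimes>) \<one> w (j # js) (\<lambda>g. F (h \<otimes> g \<otimes> inv h)) =
        (\<Sum>u\<in>carrier G. w j (h \<otimes> u \<otimes> inv h) * word_sum (carrier G) (\<otimes>) \<one> w js (\<lambda>g. F (h \<otimes> u \<otimes> inv h \<otimes> g)))"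
      by (simp add: w)
    also have "\<dots> = (\<Sum>u\<in>carrier G. w j u * word_sum (carrier G) (\<otimes>) \<one> w js (\<lambda>g. F (u \<otimes> g)))"
      by (rule sum.reindex_bij_betw[OF bij])
    finally show ?case by simp
  qed
qed

section \<open>Reflections and regular vectors\<close>

lemma card_vectors_with_relation:
  fixes i j :: "'n::finite" and K :: "complex set"
  assumes "0 \<in> K" "\<And>k. k \<in> K \<Longrightarrow> z * k \<in> K" "i \<noteq> j \<or> z = 0"
  shows "card {v. (\<forall>k. v k \<in> K) \<and> v i = z * v j} = card K ^ (CARD('n) - 1)"
proof -
  have "card {v. (\<forall>k. v k \<in> K) \<and> v i = z * v j} = card (PiE (- {i}) (\<lambda>_. K))"
  proof (rule bij_betw_same_card, rule bij_betwI[where f = "\<lambda>v. restrict v (- {i})" and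
        g = "\<lambda>g. g(i := z * g j)"])
    show "(\<lambda>v. restrict v (- {i})) \<in> {v. (\<forall>k. v k \<in> K) \<and> v i = z * v j} \<rightarrow> PiE (- {i}) (\<lambda>_. K)"
      by auto
    show "(\<lambda>g. g(i := z * g j)) \<in> PiE (- {i}) (\<lambda>_. K) \<rightarrow> {v. (\<forall>k. v k \<in> K) \<and> v i = z * v j}"
      using assms by (auto simp: PiE_iff)
  next
    fix v assume "v \<in> {v. (\<forall>k. v k \<in> K) \<and> v i = z * v j}"
    then show "(restrict v (- {i}))(i := z * restrict v (- {i}) j) = v"
      using assms(3) by (cases "z = 0") (auto simp: fun_eq_iff)
  next
    fix g assume "g \<in> PiE (- {i}) (\<lambda>_. K)"
    then show "restrict (g(i := z * g j)) (- {i}) = g"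
      by (auto simp: fun_eq_iff PiE_iff extensional_def)
  qed
  also have "\<dots> = card K ^ (CARD('n) - 1)"
    by (subst card_PiE) (simp_all add: Compl_eq_Diff_UNIV card_Diff_subset)
  finally show ?thesis .
qed

text \<open>The dimension is found by counting: over \<open>K\<close>, consisting of 0 and the
  \<open>d\<close>-th roots of unity, the fixed vectors are cut out by one relation, so there are
  \<open>card K ^ (CARD('n) - 1)\<close> of them. The case \<open>z = 0\<close> covers the diagonal
  reflections, the other case the transposition-like ones.\<close>

lemma reflectionI:
  fixes \<sigma> :: "'n::finite \<Rightarrow> 'n"
  assumes d: "d > 0" and \<sigma>: "\<sigma> permutes UNIV" and t: "t \<in> root_vectors d"
    and rel: "\<And>v. (\<forall>k. v (\<sigma> k) = t k * v k) \<longleftrightarrow> v i = z * v j"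
    and z: "z = 0 \<or> z ^ d = 1 \<and> i \<noteq> j"
  shows "mono_mat \<sigma> t \<in> reflections (Gd1n d)"
proof -
  let ?K = "{z::complex. z = 0 \<or> z ^ d = 1}"
  have K: "?K = insert 0 {z. z ^ d = 1}" by auto
  have finK: "finite ?K" unfolding K using finite_roots_of_unity[OF d] by simp
  have "card {0, 1 :: complex} \<le> card ?K" using finK by (intro card_mono) auto
  then have cardK: "1 < card ?K" by simp
  have "card ?K ^ vec.dim (fix_space (mono_mat \<sigma> t)) =
      card {v. (\<forall>i. v i \<in> ?K) \<and> (\<forall>i. v (\<sigma> i) = t i * v i)}"
    by (rule monomial_fixed_vectors[OF d \<sigma> t finK, symmetric]) (auto simp: power_mult_distrib)
  also have "\<dots> = card {v. (\<forall>k. v k \<in> ?K) \<and> v i = z * v j}" unfolding rel ..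
  also have "\<dots> = card ?K ^ (CARD('n) - 1)"
    using z by (intro card_vectors_with_relation) (auto simp: power_mult_distrib)
  finally have "vec.dim (fix_space (mono_mat \<sigma> t)) = CARD('n) - 1"
    using cardK by (simp only: power_inject_exp)
  then show ?thesis
    unfolding reflections_def using mono_mat_in_carrier[OF d \<sigma> t] by simp
qed

text \<open>Two families of reflecting hyperplanes are exhibited: \<open>v $ i = 0\<close>, from a
  diagonal matrix with one root of unity other than 1, which exists as \<open>d \<ge> 2\<close>; and
  \<open>v $ i = z * v $ j\<close>, from a transposition with entries \<open>z\<close> and
  \<open>1 / z\<close>.\<close>

lemma regular_vector:
  fixes v :: "complex ^ 'n::finite"
  assumes d: "d \<ge> 2" and reg: "\<forall>t\<in>reflections (Gd1n d). v \<notin> fix_space t"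
  shows "v $ i \<noteq> 0" and "z ^ d = 1 \<Longrightarrow> v $ i = z * v $ j \<Longrightarrow> i = j"
proof -
  have d0: "d > 0" using d by simp
  show "v $ i \<noteq> 0"
  proof
    assume vi: "v $ i = 0"
    have "card {z::complex. z ^ d = 1} \<noteq> card {1::complex}"
      using card_complex_roots_unity[of d] d by simp
    then obtain w :: complex where w: "w ^ d = 1" "w \<noteq> 1"
      by (metis (mono_tags, lifting) Collect_cong power_one singleton_conv)
    define t where "t k = (if k = i then w else 1)" for k
    have t: "t \<in> root_vectors d" using w by (simp add: t_def)
    have "mono_mat id t \<in> reflections (Gd1n d)"
    proof (rule reflectionI[OF d0 permutes_id t, of i 0 i])
      show "(\<forall>k. u (id k) = t k * u k) \<longleftrightarrow> u i = 0 * u i" for u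
        using w(2) by (auto simp: t_def)
    qed simp
    moreover have "v \<in> fix_space (mono_mat id t)"
      using vi by (simp add: fix_space_mono_mat[OF permutes_id] t_def)
    ultimately show False using reg by blast
  qed
  show "i = j" if z: "z ^ d = 1" and vij: "v $ i = z * v $ j"
  proof (rule ccontr)
    assume ij: "i \<noteq> j"
    have z0: "z \<noteq> 0" using root_nonzero[OF z d0] .
    define t where "t k = (if k = i then 1 / z else if k = j then z else 1)" for k
    define \<sigma> where "\<sigma> = Transposition.transpose i j"
    have \<sigma>: "\<sigma> permutes UNIV" unfolding \<sigma>_def by (intro permutes_swap_id) auto
    have t: "t \<in> root_vectors d" using z by (simp add: t_def power_divide)
    have rel: "(\<forall>k. u (\<sigma> k) = t k * u k) \<longleftrightarrow> u i = z * u j" for u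
    proof
      assume "\<forall>k. u (\<sigma> k) = t k * u k"
      then have "u (\<sigma> j) = t j * u j" by blast
      then show "u i = z * u j" using ij by (simp add: \<sigma>_def t_def)
    next
      assume "u i = z * u j"
      then show "\<forall>k. u (\<sigma> k) = t k * u k"
        using ij z0 by (auto simp: \<sigma>_def t_def Transposition.transpose_def)
    qed
    have "mono_mat \<sigma> t \<in> reflections (Gd1n d)"
      using z ij by (intro reflectionI[OF d0 \<sigma> t rel]) simp
    moreover have "v \<in> fix_space (mono_mat \<sigma> t)"
      using vij rel[of "\<lambda>k. v $ k"] by (simp add: fix_space_mono_mat[OF \<sigma>])
    ultimately show False using reg by blast
  qed
qed

text \<open>An instance of Steinberg's theorem on stabilizers. It makes the order of a regular
  element visible in its eigenvalue.\<close>

lemma regular_vector_stabilizer: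
  fixes v :: "complex ^ 'n::finite"
  assumes d: "d \<ge> 2" and reg: "\<forall>t\<in>reflections (Gd1n d). v \<notin> fix_space t"
    and A: "A \<in> carrier (Gd1n d)" "A *v v = v"
  shows "A = mat 1"
proof -
  have d0: "d > 0" using d by simp
  obtain \<sigma> t where At: "A = mono_mat \<sigma> t" and \<sigma>: "\<sigma> permutes UNIV" and t: "t \<in> root_vectors d"
    using A carrier_Gd1n_iff[OF d0] by blast
  have eq: "v $ \<sigma> j = t j * v $ j" for j
    using A(2) fix_space_mono_mat[OF \<sigma>, of v t] by (simp add: fix_space_def At)
  have "\<sigma> j = j" for j using regular_vector(2)[OF d reg, of "t j" "\<sigma> j" j] t eq by simp
  moreover from this have "t j = 1" for j
    using eq[of j] regular_vector(1)[OF d reg, of j] by simp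
  ultimately have "\<sigma> = id" "t = (\<lambda>_. 1)" by auto
  then show ?thesis unfolding At by (simp only: mono_mat_id)
qed

lemma eigenvalue_funpow:
  fixes v :: "complex ^ 'n"
  assumes "\<And>j. t j * v $ j = l * v $ \<sigma> j"
  shows "(\<Prod>m<k. t ((\<sigma> ^^ m) j)) * v $ j = l ^ k * v $ (\<sigma> ^^ k) j"
proof (induction k)
  case (Suc k)
  have "(\<Prod>m<Suc k. t ((\<sigma> ^^ m) j)) * v $ j = t ((\<sigma> ^^ k) j) * (l ^ k * v $ (\<sigma> ^^ k) j)"
    using Suc.IH by (simp add: mult_ac)
  also have "\<dots> = l ^ k * (l * v $ \<sigma> ((\<sigma> ^^ k) j))" using assms[of "(\<sigma> ^^ k) j"] by (simp add: mult_ac)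
  finally show ?case by simp
qed simp

text \<open>Following the eigenvector equation round a closed walk of length \<open>s\<close>
  equates \<open>l ^ s\<close> with a product of entries, a \<open>d\<close>-th root of unity,
  because the coordinate \<open>v $ j\<close> is nonzero and cancels.\<close>

lemma regular_eigenvalue_power:
  fixes v :: "complex ^ 'n::finite"
  assumes d: "d \<ge> 2" and reg: "regular_eigenpair (Gd1n d) (mono_mat \<sigma> t) l v"
    and \<sigma>: "\<sigma> permutes UNIV" and t: "t \<in> root_vectors d" and s: "(\<sigma> ^^ s) j = j"
  shows "l ^ (s * d) = 1"
proof -
  have v: "\<forall>t\<in>reflections (Gd1n d). v \<notin> fix_space t" and eig: "mono_mat \<sigma> t *v v = l *s v"
    using reg by (auto simp: regular_eigenpair_def)
  have e: "t j * v $ j = l * v $ \<sigma> j" for j using eig mono_mat_eigenvector_iff[OF \<sigma>] by blast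
  have "(\<Prod>m<s. t ((\<sigma> ^^ m) j)) = l ^ s"
    using eigenvalue_funpow[of t v l \<sigma>, OF e, where k = s and j = j] regular_vector(1)[OF d v, of j] by (simp add: s)
  then have "l ^ (s * d) = (\<Prod>m<s. t ((\<sigma> ^^ m) j)) ^ d" by (simp add: power_mult)
  also have "\<dots> = 1" using t by (simp add: prod_power_distrib)
  finally show ?thesis .
qed

lemma regular_integer_le:
  assumes d: "d \<ge> 2" and m: "regular_integer (Gd1n d :: 'n::finite cmat_group) m"
  shows "m \<le> d * CARD('n)"
proof -
  obtain w l and v :: "complex ^ 'n" where w: "w \<in> carrier (Gd1n d)" and reg: "regular_eigenpair (Gd1n d) w l v"
    and prim: "primitive_root_of_unity m l" using m unfolding regular_integer_def by blast
  obtain \<sigma> t where wt: "w = mono_mat \<sigma> t" and \<sigma>: "\<sigma> permutes UNIV" and t: "t \<in> root_vectors d"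
    using w carrier_Gd1n_iff[of d w] d by auto
  obtain s where s: "0 < s" "s \<le> CARD('n)" "(\<sigma> ^^ s) undefined = undefined"
    using funpow_return[OF \<sigma>] by blast
  have "l ^ (s * d) = 1" by (rule regular_eigenvalue_power[OF d reg[unfolded wt] \<sigma> t s(3)])
  moreover have "0 < s * d" using s d by simp
  ultimately have "m \<le> s * d" using prim unfolding primitive_root_of_unity_def by (metis not_le)
  also have "\<dots> \<le> CARD('n) * d" using s by simp
  finally show ?thesis by (simp add: mult.commute)
qed

text \<open>The witness is built from its eigenvector: \<open>v\<close> lists inverse powers of a
  primitive \<open>d * n\<close>-th root of unity \<open>l\<close> along an \<open>n\<close>-cycle,
  and \<open>t\<close> is solved for so that \<open>v\<close> has eigenvalue \<open>l\<close>. Its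
  entries come out as 1 except where the cycle closes; that entry is \<open>l ^ n\<close>, a
  \<open>d\<close>-th root of unity.\<close>

lemma regular_integer_exists:
  assumes d: "d \<ge> 2"
  shows "regular_integer (Gd1n d :: 'n::finite cmat_group) (d * CARD('n))"
proof -
  let ?n = "CARD('n)" and ?N = "d * CARD('n)"
  have d0: "d > 0" and N: "1 \<le> ?N" using d by (auto simp: Suc_le_eq)
  define l where "l = exp (2 * of_real pi * \<i> / of_nat ?N)"
  have l_pow: "l ^ k = 1 \<longleftrightarrow> ?N dvd k" for k
    using complex_root_unity_eq_1[OF N, of k]
    by (simp add: l_def exp_of_nat_mult[symmetric] mult_ac del: of_nat_mult)
  have l0: "l \<noteq> 0" by (simp add: l_def)
  obtain e :: "'n \<Rightarrow> nat" where e: "bij_betw e UNIV {0..<?n}" using ex_bij_betw_finite_nat[of "UNIV :: 'n set"] by auto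
  define f where "f = inv_into UNIV e"
  have fe: "f (e j) = j" for j unfolding f_def using bij_betw_inv_into_left[OF e] by simp
  have ef: "e (f k) = k" if "k < ?n" for k unfolding f_def using bij_betw_inv_into_right[OF e] that by simp
  have e_less: "e j < ?n" for j using e by (auto simp: bij_betw_def)
  define \<sigma> where "\<sigma> j = f (Suc (e j) mod ?n)" for j
  have e\<sigma>: "e (\<sigma> j) = Suc (e j) mod ?n" for j unfolding \<sigma>_def by (rule ef) simp
  have "inj \<sigma>"
  proof
    fix x y assume "\<sigma> x = \<sigma> y"
    then have "Suc (e x) mod ?n = Suc (e y) mod ?n" using e\<sigma> by metis
    then have "e x = e y"
      using e_less[of x] e_less[of y] by (auto simp: mod_Suc split: if_splits)
    then show "x = y" using fe by metis
  qed
  then have \<sigma>: "\<sigma> permutes UNIV" using inj_imp_permutes[of \<sigma> UNIV] by auto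
  define v :: "complex ^ 'n" where "v = (\<chi> j. 1 / l ^ e j)"
  have v0: "v $ j \<noteq> 0" for j by (simp add: v_def l0)
  define t where "t j = l * v $ \<sigma> j / v $ j" for j
  have t: "t \<in> root_vectors d"
  proof -
    have "t j ^ d = 1" for j
    proof (cases "Suc (e j) < ?n")
      case True
      then have "t j = 1" by (simp add: t_def v_def e\<sigma> l0)
      then show ?thesis by simp
    next
      case False
      then have n: "Suc (e j) = ?n" using e_less[of j] by simp
      then have "t j = l * l ^ e j" by (simp add: t_def v_def e\<sigma>)
      also have "\<dots> = l ^ ?n" by (simp flip: n)
      finally have "t j ^ d = l ^ ?N" by (simp add: power_mult[symmetric] mult.commute)
      then show ?thesis using l_pow by simp
    qed
    then show ?thesis by simp
  qed
  let ?w = "mono_mat \<sigma> t"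
  have "regular_eigenpair (Gd1n d) ?w l v"
    unfolding regular_eigenpair_def
  proof (intro conjI ballI notI)
    show "v = 0 \<Longrightarrow> False" using v0 by auto
    show "?w *v v = l *s v" unfolding mono_mat_eigenvector_iff[OF \<sigma>] using v0 by (simp add: t_def)
    fix A assume A: "A \<in> reflections (Gd1n d)" and "v \<in> fix_space A"
    obtain \<tau> s where At: "A = mono_mat \<tau> s" and \<tau>: "\<tau> permutes UNIV" and s: "s \<in> root_vectors d"
      using A carrier_Gd1n_iff[OF d0] unfolding reflections_def by blast
    have eq: "v $ \<tau> j = s j * v $ j" for j
      using \<open>v \<in> fix_space A\<close> fix_space_mono_mat[OF \<tau>, of v s] by (simp add: At)
    \<comment> \<open>\<open>l ^ d\<close> has order \<open>n\<close>, so its powers with exponents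
      below \<open>n\<close> are distinct, and a group element fixing \<open>v\<close> cannot move
      any coordinate.\<close>
    have le: "e i = e j" if "l ^ (e i * d) = l ^ (e j * d)" "e i \<le> e j" for i j
    proof -
      have "l ^ (e j * d) = l ^ (e i * d) * l ^ ((e j - e i) * d)"
        using that(2) by (simp add: power_add[symmetric] diff_mult_distrib)
      then have "l ^ ((e j - e i) * d) = 1" using that(1) l0 by simp
      then have "d * ?n dvd (e j - e i) * d" using l_pow by blast
      then have "?n dvd e j - e i" using d0 by (simp add: mult.commute)
      then show ?thesis using e_less[of j] that(2) by (auto dest: dvd_imp_le)
    qed
    have \<tau>id: "\<tau> j = j" for j
    proof -
      have "(v $ \<tau> j) ^ d = (v $ j) ^ d" using s eq by (simp add: power_mult_distrib)
      then have "l ^ (e (\<tau> j) * d) = l ^ (e j * d)" using l0 by (simp add: v_def power_divide power_mult)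
      then have "e (\<tau> j) = e j" using le[of "\<tau> j" j] le[of j "\<tau> j"] by (metis nat_le_linear)
      then show ?thesis using fe by metis
    qed
    then have "s j = 1" for j using eq[of j] v0[of j] by simp
    then have "s = (\<lambda>_. 1)" "\<tau> = id" using \<tau>id by auto
    then have "A = mat 1" unfolding At by (simp only: mono_mat_id)
    then have "fix_space A = UNIV" by (simp add: fix_space_def)
    then have "vec.dim (fix_space A) = ?n" by (simp only: vec_dim_card)
    then show False using A unfolding reflections_def by simp
  qed
  moreover have "primitive_root_of_unity ?N l"
    unfolding primitive_root_of_unity_def using N l_pow by (auto dest: dvd_imp_le)
  ultimately show ?thesis
    unfolding regular_integer_def using mono_mat_in_carrier[OF d0 \<sigma> t] by blast
qed

lemma coxeter_number_Gd1n:
  "d \<ge> 2 \<Longrightarrow> coxeter_number (Gd1n d :: 'n::finite cmat_group) = d * CARD('n)"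
  unfolding coxeter_number_def
  by (rule Greatest_equality) (simp_all add: regular_integer_exists regular_integer_le)

text \<open>The order of the regular eigenvalue \<open>l\<close> is not given, but a power of
  \<open>c\<close> that fixes \<open>v\<close> is trivial, so \<open>l ^ k = 1\<close> implies that
  \<open>d * n\<close> divides \<open>k\<close>. A cycle of length \<open>s\<close> gives
  \<open>l ^ (s * d) = 1\<close>, hence \<open>n\<close> divides \<open>s\<close> and there is only
  one cycle. If the entries multiplied to 1, then \<open>l ^ n = 1\<close>, impossible for
  \<open>d \<ge> 2\<close>.\<close>

lemma coxeter_element_full_cycle:
  fixes c :: "complex ^ 'n ^ 'n::finite"
  assumes d: "d \<ge> 2" and c: "coxeter_element (Gd1n d) c"
  shows "c \<in> carrier (Gd1n d)" "is_full_cycle r (perm_of c)" "color_of c \<noteq> 1" "color_of c ^ d = 1"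
proof -
  let ?n = "CARD('n)"
  have d0: "d > 0" using d by simp
  interpret group "Gd1n d :: 'n cmat_group" by (rule group_Gd1n[OF d0])
  obtain l v where car: "c \<in> carrier (Gd1n d)" and reg: "regular_eigenpair (Gd1n d) c l v"
    using c unfolding coxeter_element_def regular_element_def by blast
  have ord: "ord c = d * ?n"
    using c coxeter_number_Gd1n[OF d, where 'n = 'n] unfolding coxeter_element_def by simp
  have v: "\<forall>t\<in>reflections (Gd1n d). v \<notin> fix_space t" and eig: "c *v v = l *s v"
    using reg by (auto simp: regular_eigenpair_def)
  show "c \<in> carrier (Gd1n d)" by (rule car)
  obtain \<sigma> t where ct: "c = mono_mat \<sigma> t" and \<sigma>: "\<sigma> permutes UNIV" and t: "t \<in> root_vectors d"
    using car carrier_Gd1n_iff[OF d0] by blast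
  have nz: "t j \<noteq> 0" for j using t root_nonzero[OF _ d0] by auto
  have pc: "perm_of c = \<sigma>" "color_of c = (\<Prod>j\<in>UNIV. t j)"
    unfolding ct by (rule perm_of_mono_mat[OF nz], rule color_of_mono_mat[OF nz])
  have pow_dvd: "d * ?n dvd k" if "l ^ k = 1" for k
  proof -
    have "(c [^]\<^bsub>Gd1n d\<^esub> m) *v v = l ^ m *s v" for m :: nat
    proof (induction m)
      case (Suc m)
      have "(c [^]\<^bsub>Gd1n d\<^esub> Suc m) *v v = (c [^]\<^bsub>Gd1n d\<^esub> m) *v (c *v v)"
        by (simp add: matrix_vector_mul_assoc)
      also have "\<dots> = l *s ((c [^]\<^bsub>Gd1n d\<^esub> m) *v v)" unfolding eig by (rule vec.scale)
      finally show ?case by (simp add: Suc.IH)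
    qed simp
    then have "(c [^]\<^bsub>Gd1n d\<^esub> k) *v v = v" using that by simp
    then have "c [^]\<^bsub>Gd1n d\<^esub> k = mat 1"
      using car by (intro regular_vector_stabilizer[OF d v]) auto
    then show ?thesis using pow_eq_id[OF car, of k] by (simp add: ord)
  qed
  have period: "?n \<le> s" if "0 < s" "(\<sigma> ^^ s) j = j" for s j
  proof -
    have "d * ?n dvd s * d" using regular_eigenvalue_power[OF d reg[unfolded ct] \<sigma> t that(2)] by (rule pow_dvd)
    then have "?n dvd s" using d0 by (simp add: mult.commute)
    then show ?thesis using that(1) by (rule dvd_imp_le)
  qed
  have "\<exists>k. (\<sigma> ^^ k) x = r" for x
  proof -
    have "inj_on (\<lambda>k. (\<sigma> ^^ k) x) {..<?n}"
    proof (rule inj_onI)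
      have "a = b" if "(\<sigma> ^^ a) x = (\<sigma> ^^ b) x" "a \<le> b" "b < ?n" for a b
      proof -
        have "(\<sigma> ^^ a) ((\<sigma> ^^ (b - a)) x) = (\<sigma> ^^ a) x"
          using that by (simp add: funpow_add[THEN fun_cong, unfolded comp_apply, symmetric])
        then have "(\<sigma> ^^ (b - a)) x = x" using inj_fn[OF permutes_inj[OF \<sigma>], of a] by (simp add: inj_eq)
        then show ?thesis using period[of "b - a" x] that by (cases "b - a = 0") auto
      qed
      then show "a = b" if "a \<in> {..<?n}" "b \<in> {..<?n}" "(\<sigma> ^^ a) x = (\<sigma> ^^ b) x" for a b
        using that by (metis lessThan_iff nat_le_linear)
    qed
    then have "card ((\<lambda>k. (\<sigma> ^^ k) x) ` {..<?n}) = ?n" by (simp add: card_image)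
    then have "(\<lambda>k. (\<sigma> ^^ k) x) ` {..<?n} = UNIV" by (intro card_subset_eq) auto
    then have "r \<in> (\<lambda>k. (\<sigma> ^^ k) x) ` {..<?n}" by simp
    then show ?thesis by auto
  qed
  then have full: "is_full_cycle r \<sigma>" by (simp add: is_full_cycle_def)
  then show "is_full_cycle r (perm_of c)" by (simp add: pc)
  show "color_of c ^ d = 1" unfolding pc using t by (simp add: prod_power_distrib)
  show "color_of c \<noteq> 1"
  proof
    assume "color_of c = 1"
    then have p: "(\<Prod>m<?n. t ((\<sigma> ^^ m) r)) = 1" using prod_full_cycle[OF \<sigma> full, of t] pc by simp
    have e: "t j * v $ j = l * v $ \<sigma> j" for j using eig mono_mat_eigenvector_iff[OF \<sigma>] unfolding ct by blast
    have "l ^ ?n = 1"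
      using eigenvalue_funpow[of t v l \<sigma>, OF e, where k = ?n and j = r] p full_cycle_enumeration(2)[OF \<sigma> full]
        regular_vector(1)[OF d v, of r] by simp
    then have "d * ?n dvd ?n" by (rule pow_dvd)
    then show False using d by (auto dest!: dvd_imp_le)
  qed
qed

section \<open>Counting factorizations\<close>

lemma word_sum_lists:
  assumes fin: "finite A"
  shows "word_sum A m e w js F =
    (\<Sum>us | set us \<subseteq> A \<and> length us = length js. (\<Prod>i<length js. w (js ! i) (us ! i)) * F (foldr m us e))"
proof (induction js arbitrary: F)
  case Nil
  have "{us. set us \<subseteq> A \<and> us = []} = {[]}" by auto
  then show ?case by simp
next
  case (Cons j js)
  let ?L = "{us. set us \<subseteq> A \<and> length us = length js}"
  have bij: "bij_betw (\<lambda>(u, us). u # us) (A \<times> ?L) {us. set us \<subseteq> A \<and> length us = length (j # js)}"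
    by (rule bij_betwI[where g = "\<lambda>us. (hd us, tl us)"]) (auto simp: length_Suc_conv)
  have "word_sum A m e w (j # js) F =
      (\<Sum>u\<in>A. \<Sum>us\<in>?L. w j u * ((\<Prod>i<length js. w (js ! i) (us ! i)) * F (m u (foldr m us e))))"
    unfolding word_sum.simps Cons.IH sum_distrib_left ..
  also have "\<dots> = (\<Sum>(u, us)\<in>A \<times> ?L.
      (\<Prod>i<length (j # js). w ((j # js) ! i) ((u # us) ! i)) * F (foldr m (u # us) e))"
    unfolding sum.cartesian_product
    by (intro sum.cong refl) (auto simp: prod.lessThan_Suc_shift mult_ac simp del: prod.lessThan_Suc)
  also have "\<dots> = (\<Sum>us | set us \<subseteq> A \<and> length us = length (j # js).
      (\<Prod>i<length (j # js). w ((j # js) ! i) (us ! i)) * F (foldr m us e))"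
    using sum.reindex_bij_betw[OF bij, of "\<lambda>us. (\<Prod>i<length (j # js). w ((j # js) ! i) (us ! i)) * F (foldr m us e)"]
    by (simp add: case_prod_unfold)
  finally show ?case .
qed

lemma finite_carrier_Gd1n: "d > 0 \<Longrightarrow> finite (carrier (Gd1n d :: 'n::finite cmat_group))"
  using bij_betw_finite[OF bij_betw_mono_mat, of d]
  by (auto simp: finite_permutations finite_root_vectors)

lemma factorization_count_support:
  fixes G :: "'n::finite cmat_group"
  assumes "factorization_count G c r \<noteq> 0"
  shows "set r \<subseteq> {..CARD('n)}"
proof
  fix x assume "x \<in> set r"
  then obtain i where i: "i < length r" "x = r ! i" by (auto simp: in_set_conv_nth)
  have "{u. length u = length r \<and> set u \<subseteq> carrier G \<and> foldr (monoid.mult G) u (one G) = c \<and>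
      (\<forall>i < length r. vec.dim (fix_space (u ! i)) = r ! i)} \<noteq> {}"
    using assms unfolding factorization_count_def by (metis card.empty)
  then obtain u where "\<forall>i < length r. vec.dim (fix_space (u ! i) :: (complex ^ 'n) set) = r ! i" by blast
  then have "x = vec.dim (fix_space (u ! i) :: (complex ^ 'n) set)" using i by simp
  then show "x \<in> {..CARD('n)}" by (simp add: dim_subset_UNIV_cart_gen)
qed

text \<open>Sorting words by the fixed space dimensions of their letters: the word sum is the
  generating function evaluated at the nodes \<open>1 + d * js ! i\<close>.\<close>

lemma factorization_count_generating:
  fixes c :: "complex ^ 'n ^ 'n::finite"
  assumes d: "d > 0"
  defines "G \<equiv> Gd1n d :: 'n cmat_group"
  shows "(\<Sum>r | set r \<subseteq> {..CARD('n)} \<and> length r = length js.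
      of_nat (factorization_count G c r) * (\<Prod>i<length js. (1 + of_nat (d * js ! i)) ^ (r ! i))) =
    word_sum (carrier G) (**) (mat 1) (fix_weight d) js (\<lambda>A. of_bool (A = c))"
proof -
  let ?k = "length js"
  let ?L = "{r. set r \<subseteq> {..CARD('n)} \<and> length r = ?k}"
  let ?U = "{us. set us \<subseteq> carrier G \<and> length us = ?k}"
  let ?V = "{us \<in> ?U. foldr (**) us (mat 1) = c}"
  let ?dims = "map (\<lambda>A. vec.dim (fix_space A))"
  have finU: "finite ?U"
    unfolding G_def by (rule finite_lists_length_eq[OF finite_carrier_Gd1n[OF d]])
  have finL: "finite ?L" by (rule finite_lists_length_eq) simp
  have "word_sum (carrier G) (**) (mat 1) (fix_weight d) js (\<lambda>A. of_bool (A = c)) =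
      (\<Sum>us\<in>?U. (\<Prod>i<?k. fix_weight d (js ! i) (us ! i)) * of_bool (foldr (**) us (mat 1) = c))"
    unfolding G_def by (rule word_sum_lists[OF finite_carrier_Gd1n[OF d]])
  also have "\<dots> = (\<Sum>us\<in>?V. \<Prod>i<?k. fix_weight d (js ! i) (us ! i))"
    using finU by (simp add: sum.inter_filter[symmetric] of_bool_def if_distrib cong: if_cong)
  also have "\<dots> = (\<Sum>r\<in>?L. \<Sum>us | us \<in> ?V \<and> ?dims us = r. \<Prod>i<?k. fix_weight d (js ! i) (us ! i))"
  proof (rule sum.group[symmetric])
    show "?dims ` ?V \<subseteq> ?L" by (auto simp: dim_subset_UNIV_cart_gen)
    show "finite ?V" by (rule finite_subset[OF _ finU]) auto
  qed (rule finL)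
  also have "\<dots> = (\<Sum>r\<in>?L. of_nat (factorization_count G c r) *
      (\<Prod>i<?k. (1 + of_nat (d * js ! i)) ^ (r ! i)))"
  proof (intro sum.cong refl)
    fix r assume r: "r \<in> ?L"
    have "{us. us \<in> ?V \<and> ?dims us = r} = {u. length u = length r \<and> set u \<subseteq> carrier G \<and>
        foldr (monoid.mult G) u (one G) = c \<and> (\<forall>i < length r. vec.dim (fix_space (u ! i)) = r ! i)}"
      using r by (auto simp: G_def list_eq_iff_nth_eq)
    then have "factorization_count G c r = card {us. us \<in> ?V \<and> ?dims us = r}"
      unfolding factorization_count_def by simp
    moreover have "(\<Sum>us | us \<in> ?V \<and> ?dims us = r. \<Prod>i<?k. fix_weight d (js ! i) (us ! i)) =
        (\<Sum>us | us \<in> ?V \<and> ?dims us = r. \<Prod>i<?k. (1 + of_nat (d * js ! i)) ^ (r ! i))"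
      by (intro sum.cong prod.cong refl) auto
    ultimately show "(\<Sum>us | us \<in> ?V \<and> ?dims us = r. \<Prod>i<?k. fix_weight d (js ! i) (us ! i)) =
        of_nat (factorization_count G c r) * (\<Prod>i<?k. (1 + of_nat (d * js ! i)) ^ (r ! i))"
      by simp
  qed
  finally show ?thesis by simp
qed

text \<open>Summation by parts: \<open>F t\<close> collects \<open>n - 1 choose t\<close> and
  \<open>n - 1 choose t - 1\<close>. Applied to the difference between \<open>j + 1\<close> and
  \<open>j\<close> colors, it turns the \<open>n - 1\<close> of the hooks into the \<open>n\<close>
  of \<open>M\<close>.\<close>

lemma alternating_pascal:
  fixes F :: "nat \<Rightarrow> rat"
  assumes "n > 0"
  shows "(\<Sum>l<n. (-1) ^ l * of_nat ((n - 1) choose l) * (F l - F (Suc l))) =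
    (\<Sum>t\<le>n. (-1) ^ t * of_nat (n choose t) * F t)"
proof -
  obtain m where n: "n = Suc m" using assms by (cases n) auto
  have "(\<Sum>l<n. (-1) ^ l * of_nat ((n - 1) choose l) * (F l - F (Suc l))) =
      (\<Sum>l\<le>m. (-1) ^ l * of_nat (m choose l) * F l) +
      (\<Sum>l\<le>m. (-1) ^ Suc l * of_nat (m choose l) * F (Suc l))"
    unfolding n lessThan_Suc_atMost sum.distrib[symmetric]
    by (intro sum.cong refl) (simp add: algebra_simps)
  also have "(\<Sum>l\<le>m. (-1) ^ l * of_nat (m choose l) * F l) =
      (\<Sum>l\<le>Suc m. (-1) ^ l * of_nat (m choose l) * F l)" by simp
  also have "\<dots> = F 0 + (\<Sum>l\<le>m. (-1) ^ Suc l * of_nat (m choose Suc l) * F (Suc l))"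
    by (subst sum.atMost_Suc_shift) simp
  also have "F 0 + (\<Sum>l\<le>m. (-1) ^ Suc l * of_nat (m choose Suc l) * F (Suc l)) +
      (\<Sum>l\<le>m. (-1) ^ Suc l * of_nat (m choose l) * F (Suc l)) =
      F 0 + (\<Sum>l\<le>m. (-1) ^ Suc l * of_nat (Suc m choose Suc l) * F (Suc l))"
    unfolding add.assoc sum.distrib[symmetric]
    by (intro arg_cong2[where f = "(+)"] refl sum.cong) (simp add: algebra_simps)
  also have "\<dots> = (\<Sum>t\<le>n. (-1) ^ t * of_nat (n choose t) * F t)"
    unfolding n by (subst sum.atMost_Suc_shift) simp
  finally show ?thesis .
qed

text \<open>All elements over full cycles with the color of \<open>c\<close> have as many weighted
  factorizations as \<open>c\<close>. This allows the indicator of \<open>c\<close> to be replaced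
  by that of its class, to which \<open>word_sum_pushforward\<close> applies.\<close>

lemma conjugate_word_sum_eq:
  fixes c g :: "complex ^ 'n ^ 'n::finite"
  assumes d: "d > 0"
    and c: "c \<in> carrier (Gd1n d)" "is_full_cycle r (perm_of c)"
    and g: "g \<in> carrier (Gd1n d)" "is_full_cycle r (perm_of g)" "color_of g = color_of c"
  shows "word_sum (carrier (Gd1n d)) (**) (mat 1) (fix_weight d) js (\<lambda>A. of_bool (A = g)) =
    word_sum (carrier (Gd1n d)) (**) (mat 1) (fix_weight d) js (\<lambda>A. of_bool (A = c))"
proof -
  interpret group "Gd1n d :: 'n cmat_group" by (rule group_Gd1n[OF d])
  obtain \<sigma> t where ct: "c = mono_mat \<sigma> t" "\<sigma> permutes UNIV" "t \<in> root_vectors d"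
    using c carrier_Gd1n_iff[OF d] by blast
  obtain \<tau> s where gs: "g = mono_mat \<tau> s" "\<tau> permutes UNIV" "s \<in> root_vectors d"
    using g carrier_Gd1n_iff[OF d] by blast
  have nz: "t j \<noteq> 0" "s j \<noteq> 0" for j using ct gs root_nonzero[OF _ d] by auto
  have "\<exists>h\<in>carrier (Gd1n d). h ** mono_mat \<tau> s = mono_mat \<sigma> t ** h"
  proof (rule full_cycles_conjugate[OF d gs(2) _ gs(3) ct(2) _ ct(3)])
    show "is_full_cycle r \<tau>" using g(2) unfolding gs(1) perm_of_mono_mat[OF nz(2)] .
    show "is_full_cycle r \<sigma>" using c(2) unfolding ct(1) perm_of_mono_mat[OF nz(1)] .
    show "(\<Prod>i\<in>UNIV. s i) = (\<Prod>i\<in>UNIV. t i)"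
      using g(3) unfolding gs(1) ct(1) color_of_mono_mat[OF nz(1)] color_of_mono_mat[OF nz(2)] .
  qed
  then obtain h where h: "h \<in> carrier (Gd1n d)" "h ** g = c ** h" unfolding ct(1) gs(1) by blast
  define k where "k = inv\<^bsub>Gd1n d\<^esub> h"
  have k: "k \<in> carrier (Gd1n d)" "h ** k = mat 1" "k ** h = mat 1"
    using h(1) r_inv[OF h(1)] l_inv[OF h(1)] by (simp_all add: k_def)
  have conj: "h ** A ** k = c \<longleftrightarrow> A = g" for A
  proof
    assume "h ** A ** k = c"
    then have "h ** A ** k ** h = h ** g" using h(2) by simp
    then have "h ** A = h ** g" by (simp add: matrix_mul_assoc[symmetric] k)
    then have "k ** h ** A = k ** h ** g" by (simp add: matrix_mul_assoc[symmetric])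
    then show "A = g" by (simp add: k)
  next
    assume "A = g"
    then show "h ** A ** k = c" using h(2) by (simp add: matrix_mul_assoc[symmetric] k)
  qed
  have "word_sum (carrier (Gd1n d)) (monoid.mult (Gd1n d)) (one (Gd1n d)) (fix_weight d) js
      (\<lambda>A. of_bool (h \<otimes>\<^bsub>Gd1n d\<^esub> A \<otimes>\<^bsub>Gd1n d\<^esub> inv\<^bsub>Gd1n d\<^esub> h = c)) =
    word_sum (carrier (Gd1n d)) (monoid.mult (Gd1n d)) (one (Gd1n d)) (fix_weight d) js (\<lambda>A. of_bool (A = c))"
    by (rule word_sum_conjugate[OF is_group h(1), where F = "\<lambda>A. of_bool (A = c)"])
       (simp add: dim_fix_space_conjugate k flip: k_def)
  then show ?thesis unfolding Gd1n_simps k_def[symmetric] conj .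
qed

text \<open>The indicator of the color of \<open>c\<close> has mean \<open>1 / d\<close> among the
  roots of unity and value 0 at 1, so \<open>word_sum_pushforward\<close> leaves the difference of
  two full-cycle sums, which \<open>alternating_pascal\<close> merges into one.\<close>

lemma coxeter_factorization_value:
  fixes c :: "complex ^ 'n ^ 'n::finite"
  assumes d: "d \<ge> 2" and c: "coxeter_element (Gd1n d) c" and js: "js \<noteq> []"
  defines "n \<equiv> CARD('n)" and "G \<equiv> Gd1n d :: 'n cmat_group"
  shows "word_sum (carrier G) (**) (mat 1) (fix_weight d) js (\<lambda>A. of_bool (A = c)) =
    of_nat (order G ^ (length js - 1)) *
    (\<Sum>t\<le>n. (-1) ^ t * of_nat (n choose t) * (\<Prod>j\<leftarrow>js. of_nat ((j + n - t) choose n)))"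
proof -
  have d0: "d > 0" using d by simp
  have n0: "n > 0" by (simp add: n_def)
  define r :: 'n where "r = undefined"
  note cox = coxeter_element_full_cycle[OF d c]
  define \<omega> where "\<omega> = color_of c"
  define Y where "Y = {A \<in> carrier G. is_full_cycle r (perm_of A) \<and> color_of A = \<omega>}"
  have finY: "finite Y" unfolding Y_def G_def by (rule finite_subset[OF _ finite_carrier_Gd1n[OF d0]]) auto
  let ?W = "\<lambda>js. word_sum (carrier G) (**) (mat 1) (fix_weight d) js"
  define N where "N js = ?W js (\<lambda>A. of_bool (A = c))" for js
  define WS where "WS ys = word_sum {p :: 'n \<Rightarrow> 'n. p permutes UNIV} (\<circ>) id
      (\<lambda>y \<tau>. of_nat (invariant_colorings y \<tau>)) ys (\<lambda>\<sigma>. of_bool (is_full_cycle r \<sigma>))" for ys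
  define S where "S js = (\<Sum>t\<le>n. (-1) ^ t * of_nat (n choose t) *
      (\<Prod>j\<leftarrow>js. of_nat ((j + n - t) choose n)) :: rat)" for js
  have mean: "root_mean d (\<lambda>z. of_bool (z = \<omega>)) = 1 / of_nat d"
  proof -
    have "(\<Sum>z | z ^ d = 1. of_bool (z = \<omega>)) = (\<Sum>z | z ^ d = 1. if z = \<omega> then 1 else 0 :: rat)"
      by (intro sum.cong refl) simp
    also have "\<dots> = 1" using cox(4) finite_roots_of_unity[OF d0] by (simp add: \<omega>_def)
    finally show ?thesis by (simp add: root_mean_def)
  qed
  have at_1: "of_bool (1 = \<omega>) = (0 :: rat)" using cox(3) by (auto simp: \<omega>_def)
  have WS: "of_nat n * WS ys = (\<Sum>l<n. (-1) ^ l * of_nat ((n - 1) choose l) *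
      (fact n ^ length ys * (\<Prod>y\<leftarrow>ys. of_nat ((y + n - 1 - l) choose n))))" for ys
  proof -
    have "(\<Prod>y\<leftarrow>ys. fact n * of_nat ((y + n - 1 - l) choose n)) =
        (fact n ^ length ys * (\<Prod>y\<leftarrow>ys. of_nat ((y + n - 1 - l) choose n)) :: rat)" for l
      by (induction ys) (simp_all add: mult_ac)
    then show ?thesis unfolding WS_def n_def word_sum_full_cycle by (simp only:)
  qed
  have main: "of_nat (n * d * card Y) * N js = of_nat (d ^ (n * length js)) * fact n ^ length js * S js" for js
  proof -
    have "of_nat (card Y) * N js = (\<Sum>g\<in>Y. 1 * ?W js (\<lambda>A. of_bool (A = g)))"
    proof -
      have "?W js (\<lambda>A. of_bool (A = g)) = N js" if "g \<in> Y" for g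
        unfolding N_def G_def using that cox by (intro conjugate_word_sum_eq[OF d0, of c r g])
          (auto simp: Y_def \<omega>_def G_def)
      then show ?thesis by simp
    qed
    also have "\<dots> = ?W js (\<lambda>A. \<Sum>g\<in>Y. 1 * of_bool (A = g))"
      by (rule word_sum_linear[symmetric])
    also have "\<dots> = ?W js (\<lambda>A. of_bool (is_full_cycle r (perm_of A)) * of_bool (color_of A = \<omega>))"
    proof (rule word_sum_cong)
      interpret group G unfolding G_def by (rule group_Gd1n[OF d0])
      show "mat 1 \<in> carrier G" using one_closed by (simp add: G_def)
      show "A ** B \<in> carrier G" if "A \<in> carrier G" "B \<in> carrier G" for A B
        using m_closed[OF that] by (simp add: G_def)
      fix A assume "A \<in> carrier G"
      moreover have "(\<Sum>g\<in>Y. 1 * of_bool (A = g)) = (of_bool (A \<in> Y) :: rat)"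
        using finY by (simp add: of_bool_def)
      ultimately show "(\<Sum>g\<in>Y. 1 * of_bool (A = g)) =
          (of_bool (is_full_cycle r (perm_of A)) * of_bool (color_of A = \<omega>) :: rat)"
        by (simp add: Y_def)
    qed
    also have "\<dots> = of_nat (d ^ (n * length js)) * (WS (map Suc js) * (1 / of_nat d) + WS js * (0 - 1 / of_nat d))"
      using word_sum_pushforward[OF d0, where D = "\<lambda>\<sigma>. of_bool (is_full_cycle r \<sigma>)" and js = js and
          \<psi> = "\<lambda>z. of_bool (z = \<omega>)"]
      unfolding mean at_1 G_def[symmetric] n_def[symmetric] WS_def[symmetric] .
    finally have "of_nat n * of_nat d * (of_nat (card Y) * N js) = of_nat n * of_nat d *
        (of_nat (d ^ (n * length js)) * (WS (map Suc js) * (1 / of_nat d) + WS js * (0 - 1 / of_nat d)))"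
      by (simp only:)
    also have "\<dots> = of_nat (d ^ (n * length js)) * (of_nat n * WS (map Suc js) - of_nat n * WS js)"
      using d0 by (simp add: field_simps)
    \<comment> \<open>With \<open>y = Suc j\<close> the upper index is \<open>j + n - l\<close>,
      with \<open>y = j\<close> it is \<open>j + n - Suc l\<close>: one color fewer has the effect
      of one more leg box.\<close>
    also have "of_nat n * WS (map Suc js) - of_nat n * WS js =
        (\<Sum>l<n. (-1) ^ l * of_nat ((n - 1) choose l) * (fact n ^ length js * (\<Prod>j\<leftarrow>js. of_nat ((j + n - l) choose n))
          - fact n ^ length js * (\<Prod>j\<leftarrow>js. of_nat ((j + n - Suc l) choose n))))"
      unfolding WS sum_subtractf[symmetric] right_diff_distrib
      by (simp add: o_def)
    also have "\<dots> = (\<Sum>t\<le>n. (-1) ^ t * of_nat (n choose t) *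
        (fact n ^ length js * (\<Prod>j\<leftarrow>js. of_nat ((j + n - t) choose n))))"
      by (rule alternating_pascal[OF n0])
    also have "\<dots> = fact n ^ length js * S js"
      unfolding S_def sum_distrib_left by (intro sum.cong refl) (simp only: mult_ac)
    finally show ?thesis by (simp add: mult_ac)
  qed
  txt \<open>The number of conjugates of \<open>c\<close> is read off from the trivial case \<open>js = [0]\<close>.\<close>
  have "N [0] = 1"
  proof -
    have "N [0] = (\<Sum>u\<in>carrier G. if u = c then 1 else 0)"
      unfolding N_def by (simp add: of_bool_def)
    then show ?thesis using cox(1) finite_carrier_Gd1n[OF d0, where 'n = 'n] by (simp add: G_def)
  qed
  \<comment> \<open>\<open>n - t choose n\<close> vanishes for \<open>t > 0\<close>.\<close>
  moreover have "S [0] = 1"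
  proof -
    have "S [0] = (\<Sum>t\<le>n. if t = 0 then 1 else 0)"
      unfolding S_def using n0 by (intro sum.cong refl) auto
    then show ?thesis by simp
  qed
  ultimately have Y: "of_nat (n * d * card Y) = (of_nat (order G) :: rat)"
    using main[of "[0]"] order_Gd1n[OF d0, where 'n = 'n] by (simp add: G_def n_def)
  have "rat_of_nat (order G) * N js = of_nat (d ^ (n * length js)) * fact n ^ length js * S js"
    using main[of js] unfolding Y .
  also have "of_nat (d ^ (n * length js)) * fact n ^ length js = rat_of_nat (order G) ^ length js"
    using order_Gd1n[OF d0, where 'n = 'n] by (simp add: G_def n_def power_mult power_mult_distrib)
  finally have "rat_of_nat (order G) * N js = of_nat (order G) ^ length js * S js" .
  moreover have "length js = Suc (length js - 1)" using js by (cases js) auto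
  moreover have "rat_of_nat (order G) \<noteq> 0"
    using order_Gd1n[OF d0, where 'n = 'n] d0 by (simp add: G_def)
  ultimately have "N js = of_nat (order G) ^ (length js - 1) * S js"
    by (metis (no_types, lifting) mult.assoc mult_left_cancel power_Suc)
  then show ?thesis by (simp add: N_def S_def)
qed

text \<open>Taking the \<open>p ! i\<close>-th difference in each variable is a fixed linear
  combination of evaluations at the nodes. It is applied to both sides of the known evaluations;
  \<open>newton_coeff_binomial\<close> then turns the values into the binomials of
  \<open>M_coeff_eq\<close>.\<close>

lemma newton_coefficients_of_counts:
  fixes c :: "complex ^ 'n ^ 'n::finite"
  assumes d: "d \<ge> 2" and c: "coxeter_element (Gd1n d) c" and k: "k \<ge> 1"
    and p: "set p \<subseteq> {..CARD('n)}" "length p = k"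
  shows "(\<Sum>r | set r \<subseteq> {..CARD('n)} \<and> length r = k. of_nat (factorization_count (Gd1n d) c r) *
      (\<Prod>i<k. newton_coeff (p ! i) (\<lambda>j. (1 + of_nat (d * j)) ^ (r ! i)))) =
    of_nat (order (Gd1n d :: 'n cmat_group) ^ (k - 1)) * of_int (M_coeff CARD('n) p)"
proof -
  let ?n = "CARD('n)"
  let ?L = "{r. set r \<subseteq> {..?n} \<and> length r = k}"
  let ?g = "of_nat (order (Gd1n d :: 'n cmat_group) ^ (k - 1)) :: rat"
  have d0: "d > 0" using d by simp
  have pi: "p ! i \<le> ?n" if "i < k" for i using p that by (auto simp: subset_iff)
  define s where "s i j = (-1) ^ (p ! i + j) * rat_of_nat ((p ! i) choose j)" for i j
  have nc: "newton_coeff (p ! i) h = (\<Sum>j\<le>?n. s i j * h j)" if "i < k" for i h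
    unfolding s_def using newton_coeff_eq_sum[OF pi[OF that]] by simp
  have expand: "(\<Prod>i<k. newton_coeff (p ! i) (h i)) = (\<Sum>js\<in>?L. (\<Prod>i<k. s i (js ! i)) * (\<Prod>i<k. h i (js ! i)))" for h
  proof -
    have "(\<Prod>i<k. newton_coeff (p ! i) (h i)) = (\<Prod>i<k. \<Sum>j\<le>?n. s i j * h i j)"
      by (intro prod.cong refl nc) simp
    also have "\<dots> = (\<Sum>js\<in>?L. \<Prod>i<k. s i (js ! i) * h i (js ! i))" by (rule prod_sum_lists) simp
    finally show ?thesis by (simp only: prod.distrib)
  qed
  have "(\<Sum>r\<in>?L. of_nat (factorization_count (Gd1n d) c r) *
      (\<Prod>i<k. newton_coeff (p ! i) (\<lambda>j. (1 + of_nat (d * j)) ^ (r ! i)))) =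
    (\<Sum>r\<in>?L. \<Sum>js\<in>?L. (\<Prod>i<k. s i (js ! i)) * (of_nat (factorization_count (Gd1n d) c r) *
      (\<Prod>i<k. (1 + of_nat (d * js ! i)) ^ (r ! i))))"
    unfolding expand sum_distrib_left by (intro sum.cong refl) (simp only: mult_ac)
  also have "\<dots> = (\<Sum>js\<in>?L. (\<Prod>i<k. s i (js ! i)) * (\<Sum>r\<in>?L. of_nat (factorization_count (Gd1n d) c r) *
      (\<Prod>i<k. (1 + of_nat (d * js ! i)) ^ (r ! i))))"
    unfolding sum_distrib_left by (rule sum.swap)
  also have "\<dots> = (\<Sum>js\<in>?L. (\<Prod>i<k. s i (js ! i)) * (?g *
      (\<Sum>t\<le>?n. (-1) ^ t * of_nat (?n choose t) * (\<Prod>i<k. of_nat ((js ! i + (?n - t)) choose ?n)))))"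
  proof (intro sum.cong refl arg_cong2[where f = "(*)"])
    fix js assume "js \<in> ?L"
    then have len: "length js = k" by simp
    then have ne: "js \<noteq> []" using k by auto
    have "(\<Prod>j\<leftarrow>js. rat_of_nat ((j + ?n - t) choose ?n)) = (\<Prod>i<k. of_nat ((js ! i + (?n - t)) choose ?n))"
      if "t \<le> ?n" for t
      using that len by (simp add: prod.list_conv_set_nth atLeast0LessThan)
    then show "(\<Sum>r\<in>?L. of_nat (factorization_count (Gd1n d) c r) *
        (\<Prod>i<k. (1 + of_nat (d * js ! i)) ^ (r ! i))) = ?g *
        (\<Sum>t\<le>?n. (-1) ^ t * of_nat (?n choose t) * (\<Prod>i<k. of_nat ((js ! i + (?n - t)) choose ?n)))"
      using factorization_count_generating[OF d0, where js = js and c = c] coxeter_factorization_value[OF d c ne]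
      by (simp add: len)
  qed
  also have "\<dots> = (\<Sum>js\<in>?L. \<Sum>t\<le>?n. ?g * ((-1) ^ t * of_nat (?n choose t)) *
      ((\<Prod>i<k. s i (js ! i)) * (\<Prod>i<k. of_nat ((js ! i + (?n - t)) choose ?n))))"
    unfolding sum_distrib_left by (intro sum.cong refl) (simp only: mult_ac)
  also have "\<dots> = (\<Sum>t\<le>?n. ?g * ((-1) ^ t * of_nat (?n choose t)) *
      (\<Prod>i<k. newton_coeff (p ! i) (\<lambda>j. of_nat ((j + (?n - t)) choose ?n))))"
    unfolding expand sum_distrib_left by (rule sum.swap)
  also have "\<dots> = (\<Sum>t\<le>?n. ?g * ((-1) ^ t * of_nat (?n choose t)) *
      (\<Prod>i<k. of_nat ((?n - t) choose (?n - p ! i))))"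
    by (intro sum.cong prod.cong arg_cong2[where f = "(*)"] refl newton_coeff_binomial pi) simp
  also have "\<dots> = ?g * of_int (M_coeff ?n p)"
    using p by (simp add: M_coeff_eq[OF p(2)] sum_distrib_left mult_ac)
  finally show ?thesis .
qed

theorem theorem3p1:
  fixes d k :: nat and c :: "complex^'n^'n"
  assumes "d \<ge> 2" and "k \<ge> 1"
    and "coxeter_element (Gd1n d) c"
  shows "(\<Sum>r | length r = k \<and> factorization_count (Gd1n d) c r \<noteq> 0.
            of_nat (factorization_count (Gd1n d) c r) * (\<Prod>i<k. X i ^ (r ! i)))
       = (of_nat (order (Gd1n d :: 'n cmat_group) ^ (k - 1)) *
          (\<Sum>p | length p = k \<and> M_coeff CARD('n) p \<noteq> 0.
             of_int (M_coeff CARD('n) p) *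
             (\<Prod>i<k. Cst (1 / (of_nat d ^ (p ! i) * fact (p ! i))) * falling d (p ! i) (X i)))
          :: rat multipoly)"
proof -
  let ?n = "CARD('n)"
  let ?L = "{r. set r \<subseteq> {..?n} \<and> length r = k}"
  let ?fc = "factorization_count (Gd1n d :: 'n cmat_group) c"
  let ?c = "\<lambda>p r. newton_coeff p (\<lambda>j. (1 + of_nat (d * j)) ^ r)"
  have d0: "d > 0" using assms(1) by simp
  have finL: "finite ?L" by (rule finite_lists_length_eq) simp
  have supp: "set p \<subseteq> {..?n}" if "M_coeff ?n p \<noteq> 0" for p
    using that unfolding M_coeff_eq[OF refl] by (rule contrapos_np) simp
  \<comment> \<open>The support is enlarged to the box of tuples with entries at most
    \<open>n\<close>, on which every power of a variable interpolates with the same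
    \<open>n + 1\<close> basis polynomials; the support of \<open>M_coeff\<close> is restored at the
    end.\<close>
  have "(\<Sum>r | length r = k \<and> ?fc r \<noteq> 0. of_nat (?fc r) * (\<Prod>i<k. X i ^ (r ! i))) =
      (\<Sum>r\<in>?L. of_nat (?fc r) * (\<Prod>i<k. X i ^ (r ! i)) :: rat multipoly)"
    using finL factorization_count_support by (intro sum.mono_neutral_left) auto
  also have "\<dots> = (\<Sum>r\<in>?L. of_nat (?fc r) * (\<Sum>p\<in>?L. \<Prod>i<k. Cst (?c (p ! i) (r ! i)) * newton_basis d (p ! i) (X i)))"
  proof (intro sum.cong refl arg_cong2[where f = "(*)"])
    fix r assume r: "r \<in> ?L"
    have "(\<Prod>i<k. X i ^ (r ! i)) = (\<Prod>i<k. \<Sum>p\<le>?n. Cst (?c p (r ! i)) * newton_basis d p (X i))"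
      using r by (intro prod.cong refl power_eq_newton_sum[OF d0]) (auto simp: subset_iff)
    also have "\<dots> = (\<Sum>p\<in>?L. \<Prod>i<k. Cst (?c (p ! i) (r ! i)) * newton_basis d (p ! i) (X i))"
      by (rule prod_sum_lists) simp
    finally show "(\<Prod>i<k. X i ^ (r ! i)) =
        (\<Sum>p\<in>?L. \<Prod>i<k. Cst (?c (p ! i) (r ! i)) * newton_basis d (p ! i) (X i))" .
  qed
  also have "\<dots> = (\<Sum>p\<in>?L. \<Sum>r\<in>?L. Cst (of_nat (?fc r) * (\<Prod>i<k. ?c (p ! i) (r ! i))) *
      (\<Prod>i<k. newton_basis d (p ! i) (X i)))"
    unfolding sum_distrib_left
    by (subst sum.swap) (simp only: prod.distrib Cst_mult Cst_prod Cst_of_nat[symmetric] mult.assoc)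
  also have "\<dots> = (\<Sum>p\<in>?L. Cst (\<Sum>r\<in>?L. of_nat (?fc r) * (\<Prod>i<k. ?c (p ! i) (r ! i))) *
      (\<Prod>i<k. newton_basis d (p ! i) (X i)))"
    by (simp only: Cst_sum sum_distrib_right)
  also have "\<dots> = (\<Sum>p\<in>?L. Cst (of_nat (order (Gd1n d :: 'n cmat_group) ^ (k - 1)) * of_int (M_coeff ?n p)) *
      (\<Prod>i<k. newton_basis d (p ! i) (X i)))"
    using newton_coefficients_of_counts[OF assms(1,3,2)] by (intro sum.cong refl) simp
  also have "\<dots> = of_nat (order (Gd1n d :: 'n cmat_group) ^ (k - 1)) *
      (\<Sum>p\<in>?L. of_int (M_coeff ?n p) * (\<Prod>i<k. newton_basis d (p ! i) (X i)))"
    unfolding sum_distrib_left by (simp only: Cst_mult Cst_of_nat Cst_of_int mult.assoc)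
  also have "(\<Sum>p\<in>?L. of_int (M_coeff ?n p) * (\<Prod>i<k. newton_basis d (p ! i) (X i))) =
      (\<Sum>p | length p = k \<and> M_coeff ?n p \<noteq> 0. of_int (M_coeff ?n p) * (\<Prod>i<k. newton_basis d (p ! i) (X i)))"
    using finL supp by (intro sum.mono_neutral_right) auto
  finally show ?thesis unfolding newton_basis_def .
qed

end
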